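(* Let $b$ be a prime. There exist constants $C_{\alpha,\beta,b,t,u}>0$, depending only on $\alpha,\beta,b,t,u$, such that the following holds. Let $s,\alpha,\beta,m\in\mathbb{N}$ and $t\in\mathbb{N}_0$ with $\alpha\ge 2$, $\beta\ge 2\alpha$ and $0\le t\le \beta m$, let $P\subset[0,1)^s$ be an order $\beta$ digital $(t,m,s)$-net over $\mathbb{F}_b$, and let $\boldsymbol{\gamma}=(\gamma_u)_{u\subseteq\{1,\ldots,s\}}$ be a set of non-negative real weights. Then there exists a $\boldsymbol{\sigma}\in[0,1)^s$ such that, with $N=|P|=b^m$, the worst-case error of quasi-Monte Carlo integration over $P\oplus\boldsymbol{\sigma}$ in $\mathcal{H}_{\alpha,\boldsymbol{\gamma}}$ satisfies $$e^{\mathrm{wor}}(\mathcal{H}_{\alpha,\boldsymbol{\gamma}};P\oplus\boldsymbol{\sigma})\le \frac{1}{N^{\alpha}}\sum_{\emptyset\ne u\subseteq\{1,\ldots,s\}}\gamma_u^{1/2}\,C_{\alpha,\beta,b,t,u}\,(\log N)^{(|u|-1)/2}.$$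
   Context: Notation: $\mathbb{N}=\{1,2,\ldots\}$, $\mathbb{N}_0=\mathbb{N}\cup\{0\}$, $b$ is a prime, $\mathbb{F}_b$ is the field with $b$ elements, identified with $\{0,1,\ldots,b-1\}$ with arithmetic modulo $b$. Point sets are finite multisets (elements counted with multiplicity). Digital net: for $m,n,s\in\mathbb{N}$ and matrices $C_1,\ldots,C_s\in\mathbb{F}_b^{n\times m}$, for each integer $0\le h<b^m$ with $b$-adic expansion $h=\sum_{i=0}^{m-1}\eta_i b^i$ put $(\xi_{1,h,j},\ldots,\xi_{n,h,j})^{\top}=C_j(\eta_0,\ldots,\eta_{m-1})^{\top}$ and $x_{h,j}=\sum_{i=1}^n\xi_{i,h,j}b^{-i}$ for $1\le j\le s$. The multiset $P=\{\boldsymbol{x}_0,\ldots,\boldsymbol{x}_{b^m-1}\}\subset[0,1)^s$, $\boldsymbol{x}_h=(x_{h,1},\ldots,x_{h,s})$, is the digital net over $\mathbb{F}_b$ with generating matrices $C_1,\ldots,C_s$. Order $\beta$ digital $(t,m,s)$-net: let $n\ge\beta m$ and let $P$ be a digital net over $\mathbb{F}_b$ with generating matrices $C_1,\ldots,C_s\in\mathbb{F}_b^{n\times m}$; let $\boldsymbol{c}_{i,j}\in\mathbb{F}_b^m$ be the $i$-th row of $C_j$. Let $t$ be an integer with $0\le t\le\beta m$. $P$ is an order $\beta$ digital $(t,m,s)$-net over $\mathbb{F}_b$ if for all choices of integers $v_j\ge 0$ and $1\le i_{j,v_j}<\cdots<i_{j,1}\le n$ ($1\le j\le s$) with $\sum_{j=1}^s\sum_{l=1}^{\min(\beta,v_j)}i_{j,l}\le\beta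 m-t$, the vectors $\boldsymbol{c}_{i_{1,v_1},1},\ldots,\boldsymbol{c}_{i_{1,1},1},\ldots,\boldsymbol{c}_{i_{s,v_s},s},\ldots,\boldsymbol{c}_{i_{s,1},s}$ are linearly independent over $\mathbb{F}_b$. Digital shift: for $x=\sum_{i\ge1}\xi_ib^{-i}$, $x'=\sum_{i\ge1}\xi_i'b^{-i}$ in $[0,1)$ (unique $b$-adic expansions with infinitely many digits different from $b-1$), $x\oplus x':=\sum_{i\ge1}\eta_ib^{-i}$ with $\eta_i\in\{0,\ldots,b-1\}$, $\eta_i\equiv\xi_i+\xi_i'\pmod b$; applied componentwise to vectors. $P\oplus\boldsymbol{\sigma}:=\{\boldsymbol{x}\oplus\boldsymbol{\sigma}:\boldsymbol{x}\in P\}$ for $\boldsymbol{\sigma}\in[0,1)^s$ (well defined in $[0,1)^s$ since points of $P$ have finite $b$-adic expansions). Errors: $I(f)=\int_{[0,1)^s}f(\boldsymbol{x})\,d\boldsymbol{x}$, $I(f;P)=\frac1{|P|}\sum_{\boldsymbol{x}\in P}f(\boldsymbol{x})$. For a normed function space $V$, $e^{\mathrm{wor}}(V;P)=\sup_{f\in V,\ \|f\|_V\le1}|I(f;P)-I(f)|$. Weighted Sobolev space: for an integer $\alpha\ge2$ and non-negative weights $\boldsymbol{\gamma}=(\gamma_u)_{u\subseteq\{1,\ldots,s\}}$, $\mathcal{H}_{\alpha,\boldsymbol{\gamma}}$ is the reproducing kernel Hilbert space of real functions on $[0,1)^s$ with reproducing kernel $$\mathcal{K}_{\alpha,\boldsymbol{\gamma}}(\boldsymbol{x},\boldsymbol{y})=\sum_{u\subseteq\{1,\ldots,s\}}\gamma_u\prod_{j\in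 u}\left\{\sum_{r=1}^{\alpha}\frac{B_r(x_j)B_r(y_j)}{(r!)^2}+(-1)^{\alpha+1}\frac{B_{2\alpha}(|x_j-y_j|)}{(2\alpha)!}\right\},$$ where $B_r$ is the Bernoulli polynomial of degree $r$ and the empty product is $1$. Its inner product is $$\langle f,g\rangle_{\alpha,\boldsymbol{\gamma}}=\sum_{u\subseteq\{1,\ldots,s\}}\gamma_u^{-1}\sum_{v\subseteq u}\ \sum_{\boldsymbol{r}_{u\setminus v}\in\{1,\ldots,\alpha-1\}^{|u\setminus v|}}\int_{[0,1)^{|v|}}\left(\int_{[0,1)^{s-|v|}}f^{(\boldsymbol{r}_{u\setminus v},\boldsymbol{\alpha}_v,\boldsymbol{0})}d\boldsymbol{x}_{\{1,\ldots,s\}\setminus v}\right)\left(\int_{[0,1)^{s-|v|}}g^{(\boldsymbol{r}_{u\setminus v},\boldsymbol{\alpha}_v,\boldsymbol{0})}d\boldsymbol{x}_{\{1,\ldots,s\}\setminus v}\right)d\boldsymbol{x}_v,$$ where $(\boldsymbol{r}_{u\setminus v},\boldsymbol{\alpha}_v,\boldsymbol{0})$ is the vector of derivative orders with $j$-th component $r_j$ if $j\in u\setminus v$, $\alpha$ if $j\in v$, and $0$ otherwise; for $u$ with $\gamma_u=0$ the corresponding inner double sum is assumed to be $0$, and $0/0:=0$. *)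

theory Defs
  imports "HOL-Analysis.Analysis" "HOL-Library.Multiset" "HOL-Computational_Algebra.Primes"
begin

section \<open>The unit cube\<close>

text \<open>Points of the half-open unit cube are extensional functions on \<open>{1..s}\<close>, so that the
  dimension \<open>s\<close> is an ordinary natural number and index sets \<open>u\<close> live in one type for all \<open>s\<close>.\<close>

definition cube :: "nat \<Rightarrow> (nat \<Rightarrow> real) set" where
  "cube s = {1..s} \<rightarrow>\<^sub>E {0..<1}"


section \<open>Digital nets\<close>

text \<open>The field with \<open>b\<close> elements is \<open>{0..<b}\<close> with arithmetic modulo \<open>b\<close>. The entry of the matrix
  \<open>C\<^sub>j\<close> in row \<open>i \<in> {1..n}\<close> and column \<open>k \<in> {0..<m}\<close> is \<open>C j i k\<close>; the columns are numbered like the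
  digits \<open>\<eta>\<^sub>0, \<dots>, \<eta>\<^bsub>m-1\<^esub>\<close>.\<close>

definition generating_matrices ::
    "nat \<Rightarrow> nat \<Rightarrow> nat \<Rightarrow> nat \<Rightarrow> (nat \<Rightarrow> nat \<Rightarrow> nat \<Rightarrow> nat) \<Rightarrow> bool" where
  "generating_matrices b n m s C \<longleftrightarrow> (\<forall>j\<in>{1..s}. \<forall>i\<in>{1..n}. \<forall>k<m. C j i k < b)"

definition net_digit ::
    "nat \<Rightarrow> nat \<Rightarrow> (nat \<Rightarrow> nat \<Rightarrow> nat \<Rightarrow> nat) \<Rightarrow> nat \<Rightarrow> nat \<Rightarrow> nat \<Rightarrow> nat" where
  "net_digit b m C i h j = (\<Sum>k<m. C j i k * (h div b ^ k mod b)) mod b"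

definition net_point ::
    "nat \<Rightarrow> nat \<Rightarrow> nat \<Rightarrow> nat \<Rightarrow> (nat \<Rightarrow> nat \<Rightarrow> nat \<Rightarrow> nat) \<Rightarrow> nat \<Rightarrow> (nat \<Rightarrow> real)" where
  "net_point b n m s C h = (\<lambda>j\<in>{1..s}. \<Sum>i=1..n. real (net_digit b m C i h j) / real b ^ i)"

definition digital_net ::
    "nat \<Rightarrow> nat \<Rightarrow> nat \<Rightarrow> nat \<Rightarrow> (nat \<Rightarrow> nat \<Rightarrow> nat \<Rightarrow> nat) \<Rightarrow> (nat \<Rightarrow> real) multiset" where
  "digital_net b n m s C = image_mset (net_point b n m s C) (mset_set {0..<b ^ m})"

text \<open>Linear independence over the field with \<open>b\<close> elements of a finite family of vectors of length
  \<open>m\<close>. It is a property of the family: a repeated vector makes it dependent.\<close>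

definition lin_indep_family :: "nat \<Rightarrow> nat \<Rightarrow> 'i set \<Rightarrow> ('i \<Rightarrow> nat \<Rightarrow> nat) \<Rightarrow> bool" where
  "lin_indep_family b m I c \<longleftrightarrow>
     (\<forall>a. (\<forall>p\<in>I. a p < b) \<and> (\<forall>k<m. (\<Sum>p\<in>I. a p * c p k) mod b = 0) \<longrightarrow> (\<forall>p\<in>I. a p = 0))"

text \<open>\<open>i j l\<close> is the index \<open>i\<^bsub>j,l\<^esub>\<close>, decreasing in \<open>l \<in> {1..v j}\<close>.\<close>

definition order_digital_net ::
    "nat \<Rightarrow> nat \<Rightarrow> nat \<Rightarrow> nat \<Rightarrow> nat \<Rightarrow> (nat \<Rightarrow> real) multiset \<Rightarrow> bool" where
  "order_digital_net b \<beta> t m s P \<longleftrightarrow>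
     t \<le> \<beta> * m \<and>
     (\<exists>n C. \<beta> * m \<le> n \<and> generating_matrices b n m s C \<and> P = digital_net b n m s C \<and>
        (\<forall>(v :: nat \<Rightarrow> nat) (i :: nat \<Rightarrow> nat \<Rightarrow> nat).
           (\<forall>j\<in>{1..s}. (\<forall>l\<in>{1..v j}. i j l \<in> {1..n}) \<and>
                        (\<forall>l\<in>{1..v j}. \<forall>l'\<in>{1..v j}. l < l' \<longrightarrow> i j l' < i j l)) \<and>
           (\<Sum>j=1..s. \<Sum>l=1..min \<beta> (v j). i j l) \<le> \<beta> * m - t \<longrightarrow>
           lin_indep_family b m (SIGMA j:{1..s}. {1..v j}) (\<lambda>(j, l). C j (i j l))))"


section \<open>Digital shifts\<close>

text \<open>The \<open>i\<close>-th digit, \<open>i \<ge> 1\<close>, of the \<open>b\<close>-adic expansion of \<open>x \<in> [0,1)\<close> having infinitely many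
  digits different from \<open>b - 1\<close>; that this is the meaning of the formula is shown in
  \<open>badic_expansion_iff\<close> below.\<close>

definition badic_digit :: "nat \<Rightarrow> real \<Rightarrow> nat \<Rightarrow> nat" where
  "badic_digit b x i = nat \<lfloor>x * real b ^ i\<rfloor> mod b"

definition badic_expansion :: "nat \<Rightarrow> real \<Rightarrow> (nat \<Rightarrow> nat) \<Rightarrow> bool" where
  "badic_expansion b x \<xi> \<longleftrightarrow>
     (\<forall>i\<ge>1. \<xi> i < b) \<and> infinite {i. i \<ge> 1 \<and> \<xi> i \<noteq> b - 1} \<and>
     (\<lambda>i. real (\<xi> (Suc i)) / real b ^ Suc i) sums x"

lemma badic_expansion_digit:
  assumes b: "2 \<le> b" and x: "0 \<le> x" "x < 1"
  shows "badic_expansion b x (badic_digit b x)"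
proof -
  define F where "F n = nat \<lfloor>x * real b ^ n\<rfloor>" for n
  have bpos: "real b > 0" using b by simp
  have F0: "F 0 = 0" using x by (simp add: F_def)
  have Fle: "real (F n) \<le> x * real b ^ n" for n
    using x unfolding F_def by (simp add: of_nat_nat)
  have Flt: "x * real b ^ n < real (F n) + 1" for n
    using x unfolding F_def by (simp add: of_nat_nat)
  have Fdiv: "F (Suc n) div b = F n" for n
  proof -
    have "x * real b ^ n = x * real b ^ Suc n / real b" using bpos by simp
    hence "\<lfloor>x * real b ^ n\<rfloor> = \<lfloor>x * real b ^ Suc n\<rfloor> div int b"
      using floor_divide_real_eq_div[of "int b" "x * real b ^ Suc n"] by simp
    thus ?thesis unfolding F_def by (simp add: nat_div_distrib' nat_div_distrib)
  qed
  have step: "F (Suc n) = b * F n + badic_digit b x (Suc n)" for n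
    unfolding badic_digit_def F_def[symmetric] using Fdiv[of n] mult_div_mod_eq[of b "F (Suc n)"]
    by simp
  have part: "(\<Sum>k<n. real (badic_digit b x (Suc k)) / real b ^ Suc k) = real (F n) / real b ^ n" for n
  proof (induction n)
    case (Suc n)
    then show ?case using bpos by (simp add: step field_simps)
  qed (simp add: F0)
  have lim0: "(\<lambda>n. 1 / real b ^ n) \<longlonglongrightarrow> 0"
    using LIMSEQ_divide_realpow_zero[of "real b" 1] b by simp
  have "(\<lambda>n. real (F n) / real b ^ n) \<longlonglongrightarrow> x"
  proof (rule real_tendsto_sandwich[where f = "\<lambda>n. x - 1 / real b ^ n" and h = "\<lambda>_. x"])
    show "\<forall>\<^sub>F n in sequentially. x - 1 / real b ^ n \<le> real (F n) / real b ^ n"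
    proof (intro always_eventually allI)
      fix n
      have "x * real b ^ n / real b ^ n \<le> (real (F n) + 1) / real b ^ n"
        using Flt[of n] bpos by (intro divide_right_mono) auto
      thus "x - 1 / real b ^ n \<le> real (F n) / real b ^ n" using bpos by (simp add: add_divide_distrib)
    qed
    show "\<forall>\<^sub>F n in sequentially. real (F n) / real b ^ n \<le> x"
      using Fle bpos by (intro always_eventually allI) (simp add: field_simps)
    show "(\<lambda>n. x - 1 / real b ^ n) \<longlonglongrightarrow> x" using tendsto_diff[OF tendsto_const lim0, of x] by simp
  qed simp
  hence sums: "(\<lambda>i. real (badic_digit b x (Suc i)) / real b ^ Suc i) sums x"
    unfolding sums_def part .
  have "infinite {i. i \<ge> 1 \<and> badic_digit b x i \<noteq> b - 1}"
  proof
    assume "finite {i. i \<ge> 1 \<and> badic_digit b x i \<noteq> b - 1}"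
    then obtain N where N: "\<And>i. i \<ge> 1 \<Longrightarrow> badic_digit b x i \<noteq> b - 1 \<Longrightarrow> i \<le> N"
      by (auto simp: finite_nat_set_iff_bounded_le)
    have G: "real (F (N + k)) + 1 = (real (F N) + 1) * real b ^ k" for k
    proof (induction k)
      case (Suc k)
      have "badic_digit b x (Suc (N + k)) = b - 1" using N[of "Suc (N + k)"] by fastforce
      then have "F (N + Suc k) = b * F (N + k) + (b - 1)" using step[of "N + k"] by simp
      then have "real (F (N + Suc k)) + 1 = real b * (real (F (N + k)) + 1)"
        using b by (simp add: of_nat_diff algebra_simps)
      then show ?case using Suc by simp
    qed simp
    define d where "d = real (F N) + 1 - x * real b ^ N"
    have d: "d > 0" using Flt[of N] by (simp add: d_def)
    have "d * real b ^ k \<le> 1" for k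
      using Fle[of "N + k"] G[of k] by (simp add: d_def algebra_simps power_add)
    moreover obtain k where "1 / d < real b ^ k" using real_arch_pow[of "real b" "1 / d"] b by auto
    ultimately show False using d by (simp add: field_simps) (meson not_less)
  qed
  with sums show ?thesis using b unfolding badic_expansion_def badic_digit_def by simp
qed

lemma badic_expansion_iff:
  assumes b: "2 \<le> b" and x: "0 \<le> x" "x < 1"
  shows "badic_expansion b x \<xi> \<longleftrightarrow> (\<forall>i\<ge>1. \<xi> i = badic_digit b x i)"
proof
  assume eq: "\<forall>i\<ge>1. \<xi> i = badic_digit b x i"
  hence "{i. i \<ge> 1 \<and> \<xi> i \<noteq> b - 1} = {i. i \<ge> 1 \<and> badic_digit b x i \<noteq> b - 1}" by auto
  thus "badic_expansion b x \<xi>"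
    using badic_expansion_digit[OF assms] eq unfolding badic_expansion_def by simp
next
  assume e: "badic_expansion b x \<xi>"
  have bpos: "real b > 0" using b by simp
  define a where "a i = real (\<xi> (Suc i)) / real b ^ Suc i" for i
  have lt: "\<And>i. i \<ge> 1 \<Longrightarrow> \<xi> i < b" and inf: "infinite {i. i \<ge> 1 \<and> \<xi> i \<noteq> b - 1}" and s: "a sums x"
    using e unfolding badic_expansion_def a_def by auto
  define F where "F n = (\<Sum>k<n. \<xi> (Suc k) * b ^ (n - Suc k))" for n
  have step: "F (Suc n) = b * F n + \<xi> (Suc n)" for n
  proof -
    have "(\<Sum>k<n. \<xi> (Suc k) * b ^ (n - k)) = b * F n"
      unfolding F_def sum_distrib_left
      by (rule sum.cong) (auto simp: Suc_diff_Suc[symmetric] simp del: diff_Suc_Suc)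
    thus ?thesis by (simp add: F_def)
  qed
  have part: "(\<Sum>k<n. a k) = real (F n) / real b ^ n" for n
  proof (induction n)
    case (Suc n)
    then show ?case using bpos by (simp add: step a_def field_simps)
  qed (simp add: F_def)
  have floor: "\<lfloor>x * real b ^ n\<rfloor> = int (F n)" for n
  proof -
    define g where "g k = (real b - 1) / real b ^ Suc (k + n)" for k
    have "(\<lambda>k. (1 / real b) ^ k) sums (1 / (1 - 1 / real b))"
      using b by (intro geometric_sums) simp
    hence "(\<lambda>k. (real b - 1) / real b ^ Suc n * (1 / real b) ^ k)
             sums ((real b - 1) / real b ^ Suc n * (1 / (1 - 1 / real b)))"
      by (rule sums_mult)
    moreover have "(real b - 1) / real b ^ Suc n * (1 / (1 - 1 / real b)) = 1 / real b ^ n"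
      using b by (simp add: field_simps)
    moreover have "(\<lambda>k. (real b - 1) / real b ^ Suc n * (1 / real b) ^ k) = g"
      by (simp add: g_def fun_eq_iff power_add power_divide)
    ultimately have gs: "g sums (1 / real b ^ n)" by simp
    have ts: "(\<lambda>k. a (k + n)) sums (x - real (F n) / real b ^ n)"
      using sums_split_initial_segment[OF s, of n] by (simp add: part)
    have le: "a (k + n) \<le> g k" for k
      using lt[of "Suc (k + n)"] bpos unfolding a_def g_def
      by (intro divide_right_mono) (auto simp: of_nat_diff)
    have "\<exists>k. \<xi> (Suc (k + n)) \<noteq> b - 1"
    proof (rule ccontr)
      assume "\<not> ?thesis"
      hence all: "\<xi> (Suc (k + n)) = b - 1" for k by simp
      have "{i. i \<ge> 1 \<and> \<xi> i \<noteq> b - 1} \<subseteq> {..n}"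
      proof
        fix i assume i: "i \<in> {i. i \<ge> 1 \<and> \<xi> i \<noteq> b - 1}"
        show "i \<in> {..n}"
        proof (rule ccontr)
          assume "i \<notin> {..n}"
          hence "i = Suc ((i - Suc n) + n)" by simp
          with all[of "i - Suc n"] i show False by simp
        qed
      qed
      with inf finite_subset show False by blast
    qed
    then obtain k0 where k0: "\<xi> (Suc (k0 + n)) \<noteq> b - 1" by blast
    hence "\<xi> (Suc (k0 + n)) + 1 < b" using lt[of "Suc (k0 + n)"] by simp
    hence "real (\<xi> (Suc (k0 + n))) < real b - 1" by linarith
    hence k0': "a (k0 + n) < g k0"
      unfolding a_def g_def using bpos by (intro divide_strict_right_mono) auto
    have ds: "(\<lambda>k. g k - a (k + n)) sums (1 / real b ^ n - (x - real (F n) / real b ^ n))"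
      by (rule sums_diff[OF gs ts])
    have "0 < (\<Sum>k. g k - a (k + n))"
      using le k0' by (intro suminf_pos2[where i = k0] sums_summable[OF ds]) auto
    hence up: "x - real (F n) / real b ^ n < 1 / real b ^ n" using sums_unique[OF ds] by simp
    have "0 \<le> (\<Sum>k. a (k + n))"
      by (intro suminf_nonneg sums_summable[OF ts]) (simp add: a_def)
    hence lo: "0 \<le> x - real (F n) / real b ^ n" using sums_unique[OF ts] by simp
    have "(x - real (F n) / real b ^ n) * real b ^ n < 1 / real b ^ n * real b ^ n"
      using up bpos by (intro mult_strict_right_mono) auto
    hence "x * real b ^ n < real (F n) + 1" using bpos by (simp add: left_diff_distrib)
    moreover have "0 \<le> (x - real (F n) / real b ^ n) * real b ^ n" using lo bpos by simp
    hence "real (F n) \<le> x * real b ^ n" using bpos by (simp add: left_diff_distrib)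
    ultimately show ?thesis by (intro floor_unique) auto
  qed
  show "\<forall>i\<ge>1. \<xi> i = badic_digit b x i"
  proof (intro allI impI)
    fix i :: nat assume "i \<ge> 1"
    then obtain n where i: "i = Suc n" by (cases i) auto
    have "badic_digit b x i = F (Suc n) mod b" unfolding badic_digit_def floor i by simp
    also have "\<dots> = \<xi> i" using step[of n] lt[of i] \<open>i \<ge> 1\<close> by (simp add: i)
    finally show "\<xi> i = badic_digit b x i" by simp
  qed
qed

definition digit_add :: "nat \<Rightarrow> real \<Rightarrow> real \<Rightarrow> real" where
  "digit_add b x y =
     (\<Sum>i. real ((badic_digit b x (Suc i) + badic_digit b y (Suc i)) mod b) / real b ^ Suc i)"

definition digital_shift ::
    "nat \<Rightarrow> nat \<Rightarrow> (nat \<Rightarrow> real) multiset \<Rightarrow> (nat \<Rightarrow> real) \<Rightarrow> (nat \<Rightarrow> real) multiset" where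
  "digital_shift b s P \<sigma> = image_mset (\<lambda>x. \<lambda>j\<in>{1..s}. digit_add b (x j) (\<sigma> j)) P"


section \<open>Reproducing kernel Hilbert spaces\<close>

text \<open>A real function on a set \<open>X\<close> is an extensional HOL function; \<open>V\<close> is the set of all functions
  in the space and \<open>ip\<close> its inner product, of which only the values on \<open>V\<close> matter.\<close>

locale hilbert_function_space =
  fixes X :: "'x set" and V :: "('x \<Rightarrow> real) set"
    and ip :: "('x \<Rightarrow> real) \<Rightarrow> ('x \<Rightarrow> real) \<Rightarrow> real"
  assumes extensional: "V \<subseteq> extensional X"
    and zero: "(\<lambda>x\<in>X. 0) \<in> V"
    and add: "f \<in> V \<Longrightarrow> g \<in> V \<Longrightarrow> (\<lambda>x\<in>X. f x + g x) \<in> V"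
    and scale: "f \<in> V \<Longrightarrow> (\<lambda>x\<in>X. c * f x) \<in> V"
    and ip_commute: "f \<in> V \<Longrightarrow> g \<in> V \<Longrightarrow> ip f g = ip g f"
    and ip_add: "f \<in> V \<Longrightarrow> g \<in> V \<Longrightarrow> h \<in> V \<Longrightarrow> ip (\<lambda>x\<in>X. f x + g x) h = ip f h + ip g h"
    and ip_scale: "f \<in> V \<Longrightarrow> g \<in> V \<Longrightarrow> ip (\<lambda>x\<in>X. c * f x) g = c * ip f g"
    and ip_nonneg: "f \<in> V \<Longrightarrow> 0 \<le> ip f f"
    and ip_definite: "f \<in> V \<Longrightarrow> ip f f = 0 \<Longrightarrow> f = (\<lambda>x\<in>X. 0)"
    and complete: "Metric_space.mcomplete V
      (\<lambda>f g. sqrt (ip (\<lambda>x\<in>X. f x - g x) (\<lambda>x\<in>X. f x - g x)))"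

text \<open>By the Moore--Aronszajn theorem \<open>V\<close> and \<open>ip\<close> (on \<open>V\<close>) exist and are uniquely determined by \<open>X\<close>
  and a symmetric positive semidefinite kernel \<open>K\<close>.\<close>

locale rkhs = hilbert_function_space X V ip
  for X :: "'x set" and K :: "'x \<Rightarrow> 'x \<Rightarrow> real" and V ip +
  assumes kernel_in: "y \<in> X \<Longrightarrow> (\<lambda>x\<in>X. K x y) \<in> V"
    and reproducing: "f \<in> V \<Longrightarrow> y \<in> X \<Longrightarrow> f y = ip f (\<lambda>x\<in>X. K x y)"


section \<open>The weighted Sobolev kernel\<close>

fun bernoulli_number :: "nat \<Rightarrow> real" where
  "bernoulli_number n =
     (if n = 0 then 1
      else - (\<Sum>k<n. real (Suc n choose k) * bernoulli_number k) / real (Suc n))"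

declare bernoulli_number.simps [simp del]

definition bernoulli_poly :: "nat \<Rightarrow> real \<Rightarrow> real" where
  "bernoulli_poly n x = (\<Sum>k\<le>n. real (n choose k) * bernoulli_number k * x ^ (n - k))"

definition sobolev_kernel ::
    "nat \<Rightarrow> nat \<Rightarrow> (nat set \<Rightarrow> real) \<Rightarrow> (nat \<Rightarrow> real) \<Rightarrow> (nat \<Rightarrow> real) \<Rightarrow> real" where
  "sobolev_kernel s \<alpha> \<gamma> x y =
     (\<Sum>u\<in>Pow {1..s}. \<gamma> u *
        (\<Prod>j\<in>u. (\<Sum>r=1..\<alpha>. bernoulli_poly r (x j) * bernoulli_poly r (y j) / (fact r)\<^sup>2) +
                (-1) ^ (\<alpha> + 1) * bernoulli_poly (2 * \<alpha>) \<bar>x j - y j\<bar> / fact (2 * \<alpha>)))"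


section \<open>Worst-case error\<close>

definition cube_integral :: "nat \<Rightarrow> ((nat \<Rightarrow> real) \<Rightarrow> real) \<Rightarrow> real" where
  "cube_integral s f = set_lebesgue_integral (Pi\<^sub>M {1..s} (\<lambda>_. lborel)) (cube s) f"

definition qmc :: "('x \<Rightarrow> real) \<Rightarrow> 'x multiset \<Rightarrow> real" where
  "qmc f P = (\<Sum>x\<in>#P. f x) / real (size P)"

text \<open>The supremum is taken in the extended reals, so that it is meaningful without knowing
  beforehand that the set is bounded.\<close>

definition worst_case_error ::
    "nat \<Rightarrow> ((nat \<Rightarrow> real) \<Rightarrow> real) set \<Rightarrow> (((nat \<Rightarrow> real) \<Rightarrow> real) \<Rightarrow> ((nat \<Rightarrow> real) \<Rightarrow> real) \<Rightarrow> real) \<Rightarrow>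
     (nat \<Rightarrow> real) multiset \<Rightarrow> ereal" where
  "worst_case_error s V ip P =
     (SUP f\<in>{f \<in> V. sqrt (ip f f) \<le> 1}. ereal \<bar>qmc f P - cube_integral s f\<bar>)"

end

theory Submission
  imports Defs
begin

text \<open>
  All shifts are taken from the grid of points with \<open>n\<close> base \<open>b\<close> digits, \<open>n\<close> being the number of rows
  of the generating matrices, so that only Fourier analysis on a finite group is needed and no
  Walsh series has to converge.

  For a function \<open>f\<close> in the space, the integral is a limit of Riemann sums. Cauchy--Schwarz applied to
  the difference of two kernel averages, together with the vanishing mean of the Bernoulli
  polynomials, bounds the squared error by the kernel sum over pairs of points from which the
  constant term is removed. Averaging this sum over the shifts leaves the sum over the dual net of
  products of diagonal Walsh coefficients of the one-dimensional kernel.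

  Such a coefficient is \<open>O(b ^ (-2 \<mu>\<^sub>\<alpha>(k)))\<close>: a nonzero digit of \<open>k\<close> at position \<open>a\<close> allows one to
  replace the function by a difference with step \<open>O(b ^ (-a))\<close>, and this is done for the \<open>\<alpha>\<close>
  highest nonzero digits in both variables. Only the kink of the kernel on the diagonal is not smooth
  enough for \<open>2 \<alpha>\<close> differences, and few grid points are close to it.

  Finally \<open>(\<beta> - 1) \<mu>\<^sub>\<alpha> \<ge> (\<alpha> - 1) \<mu>\<^sub>\<beta> + (\<beta> - \<alpha>) \<mu>\<^sub>1\<close>. On the dual net \<open>\<mu>\<^sub>\<beta> > \<beta> m - t\<close>, while the
  vectors with \<open>\<mu>\<^sub>1 = z\<close> number at most \<open>(z + 1) ^ (\<bar>u\<bar> - 1) b ^ (z - m + t)\<close>. The resulting series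
  converges because \<open>2 (\<beta> - \<alpha>) > \<beta> - 1\<close>.
\<close>

section \<open>Bernoulli polynomials and the one-dimensional kernel\<close>

text \<open>The space is given only by its reproducing property, so boundedness, measurability and
  pointwise limits of its elements must all be extracted from the kernel. Working on a grid has a
  price: the Walsh coefficient at frequency 0 is a grid mean and need not vanish. It is
  O(\<open>b ^ (-n)\<close>), which \<open>n \<ge> \<beta> m \<ge> 2 \<alpha> m\<close> makes
  negligible. The zero vector lies in every dual net and has weight 0, so the net property says
  nothing about it and it is treated apart. The interpolation inequality uses the net property
  twice. Besides the bound for \<open>\<mu>\<^sub>\<beta>\<close>, the inequality
  \<open>\<mu>\<^sub>\<beta> \<le> \<beta> \<mu>\<^sub>1\<close> gives
  \<open>\<mu>\<^sub>1 > m - t\<close>. Inserting both yields exactly \<open>\<alpha> m - t\<close>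
  as lower bound for \<open>\<mu>\<^sub>\<alpha>\<close>, while counting involves leading positions
  only. The number of ways to distribute \<open>z\<close> over \<open>u\<close> then produces the
  power |u| - 1 of the logarithm in the squared error, hence half of it in the error. One shift has
  to serve all functions and all \<open>u\<close>: the bounds are summed over \<open>u\<close>
  before averaging, and the root of a sum of squares is at most the sum.\<close>

definition nbern :: "nat \<Rightarrow> real \<Rightarrow> real" where
  "nbern n x = bernoulli_poly n x / fact n"

lemma nbern_altdef:
  "nbern n x = (\<Sum>k\<le>n. bernoulli_number k / fact k * (x ^ (n - k) / fact (n - k)))"
  unfolding nbern_def bernoulli_poly_def sum_divide_distrib
  by (intro sum.cong) (auto simp: binomial_fact field_simps)

lemma nbern_0 [simp]: "nbern 0 x = 1"
  by (simp add: nbern_altdef bernoulli_number.simps)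

lemma DERIV_shift_minus:
  fixes f :: "real \<Rightarrow> real"
  assumes "(f has_field_derivative D) (at (y - x))"
  shows "((\<lambda>y. f (y - x)) has_field_derivative D) (at y)"
  using assms DERIV_shift[of f D y "- x"] by simp

lemma DERIV_reflect_shift:
  fixes f :: "real \<Rightarrow> real"
  assumes "(f has_field_derivative D) (at (x - y))"
  shows "((\<lambda>y. f (x - y)) has_field_derivative - D) (at y)"
  using DERIV_shift_minus[of "\<lambda>t. f (- t)" "- D" y x] assms DERIV_mirror[of f D "y - x"] by simp

lemma DERIV_power_fact: "((\<lambda>x :: real. x ^ Suc n / fact (Suc n)) has_field_derivative x ^ n / fact n) (at x)"
  by (rule DERIV_cong[OF DERIV_cdivide[OF DERIV_pow]]) (simp del: of_nat_Suc)

text \<open>Division by n! makes this an Appell sequence without factors: differentiation just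
  lowers the index, so iterated derivatives bring in no constants.\<close>

lemma DERIV_nbern_Suc: "(nbern (Suc n) has_field_derivative nbern n x) (at x)"
proof -
  have d: "((\<lambda>x. bernoulli_number k / fact k * (x ^ (Suc n - k) / fact (Suc n - k))) has_field_derivative
          bernoulli_number k / fact k * (x ^ (n - k) / fact (n - k))) (at x)" if "k \<le> n" for k
  proof -
    have "Suc n - k = Suc (n - k)" using that by simp
    thus ?thesis
      using DERIV_cmult[OF DERIV_power_fact[of "n - k" x], of "bernoulli_number k / fact k"] by (simp only:)
  qed
  have "((\<lambda>x. (\<Sum>k\<le>n. bernoulli_number k / fact k * (x ^ (Suc n - k) / fact (Suc n - k)))
           + bernoulli_number (Suc n) / fact (Suc n)) has_field_derivative nbern n x) (at x)"
    unfolding nbern_altdef[of n]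
    using DERIV_add[OF DERIV_sum[of "{..n}", OF d] DERIV_const] by simp
  thus ?thesis by (simp add: nbern_altdef[abs_def] del: fact_Suc)
qed

lemmas [derivative_intros] = DERIV_nbern_Suc[THEN DERIV_chain2]

text \<open>The recursion for the Bernoulli numbers says that the terms with k < n of the value at 1
  add up to zero, which leaves \<open>bernoulli_number n\<close>, the value at 0. For n = 1 the
  recursion gives no such relation.\<close>

lemma nbern_1_eq_0:
  assumes "2 \<le> n" shows "nbern n 1 = nbern n 0"
proof -
  obtain N where n: "n = Suc N" and N: "N \<noteq> 0" using assms by (cases n) auto
  have "real (Suc N) * bernoulli_number N = - (\<Sum>k<N. real (Suc N choose k) * bernoulli_number k)"
    using N by (simp add: bernoulli_number.simps[of N] field_simps del: binomial_Suc_Suc)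
  hence z: "(\<Sum>k\<le>N. real (Suc N choose k) * bernoulli_number k) = 0"
    unfolding lessThan_Suc_atMost[symmetric] by simp
  have "bernoulli_poly n 1 = bernoulli_number n"
    using z by (simp add: bernoulli_poly_def n del: binomial_Suc_Suc)
  moreover have "bernoulli_poly n 0 = (\<Sum>k\<in>{n}. real (n choose k) * bernoulli_number k * 0 ^ (n - k))"
    unfolding bernoulli_poly_def by (rule sum.mono_neutral_right) auto
  ultimately show ?thesis by (simp add: nbern_def)
qed

text \<open>By the induction hypothesis the two sides have the same derivative; their values at 0
  agree because the endpoint values on [0,1] do.\<close>

lemma nbern_add_1: "nbern (Suc n) (x + 1) - nbern (Suc n) x = x ^ n / fact n"
proof (induction n arbitrary: x)
  case 0
  show ?case by (simp add: nbern_altdef bernoulli_number.simps)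
next
  case (Suc n)
  define f where "f x = nbern (Suc (Suc n)) (x + 1) - nbern (Suc (Suc n)) x - x ^ Suc n / fact (Suc n)" for x
  have "(f has_field_derivative nbern (Suc n) (x + 1) - nbern (Suc n) x - x ^ n / fact n) (at x)" for x
    unfolding f_def
    by (intro DERIV_diff DERIV_power_fact) (auto intro!: derivative_eq_intros)
  hence "\<forall>x. (f has_field_derivative 0) (at x)" using Suc by simp
  hence "f x = f 0" by (rule DERIV_isconst_all)
  also have "f 0 = 0" using nbern_1_eq_0[of "Suc (Suc n)"] by (simp add: f_def)
  finally show ?case by (simp add: f_def)
qed

text \<open>The defect for index n + 1 is constant by the induction hypothesis. Up to sign it is the
  derivative of the defect for n + 2, whose values at 0 and 1 coincide, so the constant is
  zero.\<close>

lemma nbern_reflect: "nbern n (1 - x) = (-1) ^ n * nbern n x"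
proof (induction n arbitrary: x)
  case (Suc n)
  define f where "f k x = nbern k (1 - x) - (-1) ^ k * nbern k x" for k x
  have d: "(f (Suc k) has_field_derivative - f k x) (at x)" for k x
    unfolding f_def
    by (auto intro!: derivative_eq_intros simp: algebra_simps)
  have "\<forall>x. (f (Suc n) has_field_derivative 0) (at x)" using d[of n] Suc by (simp add: f_def)
  hence c: "f (Suc n) x = f (Suc n) 0" for x by (rule DERIV_isconst_all)
  have "f (Suc (Suc n)) 1 - f (Suc (Suc n)) 0 = (1 - 0) * - f (Suc n) 0"
  proof -
    obtain z where "f (Suc (Suc n)) 1 - f (Suc (Suc n)) 0 = (1 - 0) * - f (Suc n) z"
      using MVT2[of 0 1 "f (Suc (Suc n))" "\<lambda>z. - f (Suc n) z"] d[of "Suc n"] by auto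
    thus ?thesis using c[of z] by simp
  qed
  hence "f (Suc n) 0 = 0" using nbern_1_eq_0[of "Suc (Suc n)"] by (simp add: f_def)
  thus ?case using c[of x] by (simp add: f_def)
qed auto

lemma continuous_on_nbern: "continuous_on S (nbern n)"
  by (simp add: nbern_altdef[abs_def]) (intro continuous_intros; simp)

text \<open>The interval [-3,3] leaves room for the later evaluation points, which lie in [-2,2] up
  to a translation by 1.\<close>

lemma nbern_bounded: "\<exists>M\<ge>1. \<forall>n\<le>N. \<forall>x\<in>{-3..3::real}. \<bar>nbern n x\<bar> \<le> M"
proof -
  have "\<exists>M. \<forall>x\<in>{-3..3::real}. \<bar>nbern n x\<bar> \<le> M" for n
    using compact_imp_bounded[OF compact_continuous_image[OF continuous_on_nbern[of "{-3..3}" n] compact_Icc]]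
    by (auto simp: bounded_iff)
  then obtain M where M: "\<And>n x. x \<in> {-3..3::real} \<Longrightarrow> \<bar>nbern n x\<bar> \<le> M n" by metis
  have "M n \<le> 1 + (\<Sum>n\<le>N. \<bar>M n\<bar>)" if "n \<le> N" for n
    using member_le_sum[of n "{..N}" "\<lambda>n. \<bar>M n\<bar>"] that by auto
  thus ?thesis using M
    by (intro exI[of _ "1 + (\<Sum>n\<le>N. \<bar>M n\<bar>)"] conjI allI impI ballI) (auto intro!: sum_nonneg intro: order_trans)
qed

section \<open>Truncated powers\<close>

definition tpower :: "nat \<Rightarrow> real \<Rightarrow> real" where
  "tpower p t = (if 0 < t then t ^ p / fact p else 0)"

text \<open>Away from 0 both branches are smooth. At 0 the difference quotient is at most
  \<open>\<bar>h\<bar> ^ p\<close>, which tends to zero once p is at least 1; this marks the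
  smoothness limit at the kink.\<close>

lemma DERIV_tpower:
  assumes "t \<noteq> 0 \<or> 1 \<le> p"
  shows "(tpower (Suc p) has_field_derivative tpower p t) (at t)"
proof (cases t "0 :: real" rule: linorder_cases)
  case less
  have "((\<lambda>_. 0) has_field_derivative 0) (at t)" by simp
  thus ?thesis using less
    by (rule_tac has_field_derivative_transform_within_open[of "\<lambda>_. 0" _ _ "{..<0}"])
       (auto simp: tpower_def)
next
  case greater
  have "((\<lambda>t. t ^ Suc p / fact (Suc p)) has_field_derivative t ^ p / fact p) (at t)"
    by (rule DERIV_power_fact)
  thus ?thesis using greater
    by (rule_tac has_field_derivative_transform_within_open[of "\<lambda>t. t ^ Suc p / fact (Suc p)" _ _ "{0<..}"])
       (auto simp: tpower_def)
next
  case equal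
  have p: "1 \<le> p" using assms equal by simp
  have "(\<lambda>h. tpower (Suc p) h / h) \<midarrow>0\<rightarrow> 0"
  proof (rule Lim_null_comparison)
    show "\<forall>\<^sub>F h in at 0. norm (tpower (Suc p) h / h) \<le> \<bar>h\<bar> ^ p"
    proof (intro always_eventually allI)
      fix h :: real
      have "h ^ p / fact (Suc p) \<le> h ^ p / 1" if "h > 0"
        using that by (intro divide_left_mono fact_ge_1) auto
      thus "norm (tpower (Suc p) h / h) \<le> \<bar>h\<bar> ^ p" by (auto simp: tpower_def abs_mult power_abs)
    qed
    show "(\<lambda>h. \<bar>h\<bar> ^ p) \<midarrow>0\<rightarrow> (0 :: real)"
      using p by (auto intro!: tendsto_eq_intros)
  qed
  thus ?thesis using equal p by (simp add: DERIV_def tpower_def)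
qed

lemma tpower_nonneg: "0 \<le> tpower p t"
  by (auto simp: tpower_def)

lemma tpower_le:
  assumes "t \<le> 3" shows "tpower p t \<le> 3 ^ p"
proof (cases "0 < t")
  case True
  have "t ^ p / fact p \<le> t ^ p / 1" using True by (intro divide_left_mono fact_ge_1) auto
  also have "\<dots> \<le> 3 ^ p" using True assms by (auto intro: power_mono)
  finally show ?thesis using True by (simp add: tpower_def)
qed (auto simp: tpower_def)

section \<open>The kernel in one variable\<close>

definition sob_ker :: "nat \<Rightarrow> real \<Rightarrow> real \<Rightarrow> real" where
  "sob_ker \<alpha> x y =
     (\<Sum>r=1..\<alpha>. bernoulli_poly r x * bernoulli_poly r y / (fact r)\<^sup>2) +
     (-1) ^ (\<alpha> + 1) * bernoulli_poly (2 * \<alpha>) \<bar>x - y\<bar> / fact (2 * \<alpha>)"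

lemma sobolev_kernel_altdef:
  "sobolev_kernel s \<alpha> \<gamma> x y = (\<Sum>u\<in>Pow {1..s}. \<gamma> u * (\<Prod>j\<in>u. sob_ker \<alpha> (x j) (y j)))"
  by (simp add: sobolev_kernel_def sob_ker_def)

text \<open>For negative t, reflection and the difference equation give
  \<open>nbern (2 * \<alpha>) (- t)\<close> as \<open>nbern (2 * \<alpha>) t\<close> plus a power of
  t. All non-smoothness is thereby concentrated in one truncated power of degree 2 \<alpha> -
  1.\<close>

lemma sob_ker_altdef:
  assumes "1 \<le> \<alpha>"
  shows "sob_ker \<alpha> x y = (\<Sum>r=1..\<alpha>. nbern r x * nbern r y) +
     (-1) ^ (\<alpha> + 1) * (nbern (2 * \<alpha>) (x - y) - tpower (2 * \<alpha> - 1) (y - x))"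
proof -
  have "nbern (2 * \<alpha>) \<bar>t\<bar> = nbern (2 * \<alpha>) t - tpower (2 * \<alpha> - 1) (- t)" for t
  proof (cases "0 \<le> t")
    case False
    obtain n where n: "2 * \<alpha> = Suc n" using assms by (cases "2 * \<alpha>") auto
    have "nbern (2 * \<alpha>) (- t) = nbern (2 * \<alpha>) (t + 1)"
      using nbern_reflect[of "2 * \<alpha>" "t + 1"] by simp
    also have "\<dots> = nbern (2 * \<alpha>) t + t ^ n / fact n" using nbern_add_1[of n t] n by simp
    also have "t ^ n = - ((- t) ^ n)"
    proof -
      have "odd n" using n by presburger
      thus ?thesis by simp
    qed
    finally show ?thesis using False n by (auto simp: tpower_def)
  qed (simp add: tpower_def)
  from this[of "x - y"] have "bernoulli_poly (2 * \<alpha>) \<bar>x - y\<bar> / fact (2 * \<alpha>) =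
      nbern (2 * \<alpha>) (x - y) - tpower (2 * \<alpha> - 1) (y - x)"
    by (simp add: nbern_def)
  thus ?thesis
    unfolding sob_ker_def times_divide_eq_right[symmetric] by (simp add: nbern_def power2_eq_square)
qed

lemma sob_ker_commute: "sob_ker \<alpha> x y = sob_ker \<alpha> y x"
  by (simp add: sob_ker_def mult.commute abs_minus_commute)

lemma continuous_on_sob_ker: "continuous_on S (\<lambda>z. sob_ker \<alpha> (fst z) (snd z))"
  unfolding sob_ker_def bernoulli_poly_def by (intro continuous_intros) simp_all

lemma tendsto_sob_ker:
  assumes "(f \<longlongrightarrow> x) F" "(g \<longlongrightarrow> y) F"
  shows "((\<lambda>z. sob_ker \<alpha> (f z) (g z)) \<longlongrightarrow> sob_ker \<alpha> x y) F"
  unfolding sob_ker_def bernoulli_poly_def by (intro tendsto_intros assms) simp_all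

lemma sob_ker_bounded:
  assumes "1 \<le> \<alpha>"
  shows "\<exists>M\<ge>1. \<forall>x\<in>{0..1}. \<forall>y\<in>{0..1}. \<bar>sob_ker \<alpha> x y\<bar> \<le> M"
proof -
  have "bounded ((\<lambda>z. sob_ker \<alpha> (fst z) (snd z)) ` ({0..1} \<times> {0..1}))"
    by (intro compact_imp_bounded compact_continuous_image continuous_on_sob_ker compact_Times) auto
  then obtain M where "\<And>z. z \<in> {0..1} \<times> {0..1} \<Longrightarrow> \<bar>sob_ker \<alpha> (fst z) (snd z)\<bar> \<le> M"
    unfolding bounded_iff by fastforce
  thus ?thesis by (intro exI[of _ "max 1 M"]) force
qed

text \<open>As 2 \<alpha> - 2 is at least 1, the kernel is differentiable in y even on the diagonal,
  with bounded derivative. This controls the error on one cell of a Riemann sum.\<close>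

lemma sob_ker_lipschitz:
  assumes "2 \<le> \<alpha>"
  shows "\<exists>L\<ge>0. \<forall>x\<in>{0..1}. \<forall>y\<in>{0..1}. \<forall>y'\<in>{0..1}. \<bar>sob_ker \<alpha> x y - sob_ker \<alpha> x y'\<bar> \<le> L * \<bar>y - y'\<bar>"
proof -
  obtain M where M: "M \<ge> 1" "\<And>n x. n \<le> 2 * \<alpha> \<Longrightarrow> x \<in> {-3..3::real} \<Longrightarrow> \<bar>nbern n x\<bar> \<le> M"
    using nbern_bounded[of "2 * \<alpha>"] by blast
  define L where "L = \<alpha> * M\<^sup>2 + (M + 3 ^ (2 * \<alpha> - 2))"
  define d where "d x y = (\<Sum>r=1..\<alpha>. nbern r x * nbern (r - 1) y) +
     (-1) ^ (\<alpha> + 1) * (- nbern (2 * \<alpha> - 1) (x - y) - tpower (2 * \<alpha> - 2) (y - x))" for x y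
  have eqs: "2 * \<alpha> = Suc (2 * \<alpha> - 1)" "2 * \<alpha> - 1 = Suc (2 * \<alpha> - 2)" using assms by auto
  have D1: "((\<lambda>y. nbern r x * nbern r y) has_field_derivative nbern r x * nbern (r - 1) y) (at y)"
    if "r \<in> {1..\<alpha>}" for r x y
  proof -
    have "Suc (r - 1) = r" using that by simp
    thus ?thesis using DERIV_nbern_Suc[of "r - 1" y] by (auto intro!: DERIV_cmult)
  qed
  have D2: "((\<lambda>y. nbern (2 * \<alpha>) (x - y)) has_field_derivative - nbern (2 * \<alpha> - 1) (x - y)) (at y)" for x y
  proof -
    have *: "(nbern (2 * \<alpha>) has_field_derivative nbern (2 * \<alpha> - 1) (x - y)) (at (x - y))"
      using DERIV_nbern_Suc[of "2 * \<alpha> - 1"] eqs by simp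
    show ?thesis by (rule DERIV_reflect_shift[OF *])
  qed
  have D3: "((\<lambda>y. tpower (2 * \<alpha> - 1) (y - x)) has_field_derivative tpower (2 * \<alpha> - 2) (y - x)) (at y)" for x y
  proof -
    have *: "(tpower (2 * \<alpha> - 1) has_field_derivative tpower (2 * \<alpha> - 2) (y - x)) (at (y - x))"
      using DERIV_tpower[of "y - x" "2 * \<alpha> - 2"] eqs assms by simp
    show ?thesis by (rule DERIV_shift_minus[OF *])
  qed
  have deriv: "((\<lambda>y. sob_ker \<alpha> x y) has_field_derivative d x y) (at y)" for x y
    using assms unfolding d_def
    by (subst sob_ker_altdef, simp) (intro DERIV_add DERIV_sum D1 DERIV_cmult DERIV_diff D2 D3)
  have bnd: "\<bar>d x y\<bar> \<le> L" if "x \<in> {0..1}" "y \<in> {0..1}" for x y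
  proof -
    have "\<bar>\<Sum>r=1..\<alpha>. nbern r x * nbern (r - 1) y\<bar> \<le> (\<Sum>r=1..\<alpha>. \<bar>nbern r x * nbern (r - 1) y\<bar>)"
      by (rule sum_abs)
    also have "\<dots> \<le> (\<Sum>r=1..\<alpha>. M\<^sup>2)"
      using that M(1) unfolding abs_mult power2_eq_square
      by (intro sum_mono mult_mono M(2)) auto
    finally have "\<bar>\<Sum>r=1..\<alpha>. nbern r x * nbern (r - 1) y\<bar> \<le> \<alpha> * M\<^sup>2" by simp
    moreover have "\<bar>nbern (2 * \<alpha> - 1) (x - y)\<bar> \<le> M" using that by (intro M(2)) auto
    moreover have "tpower (2 * \<alpha> - 2) (y - x) \<le> 3 ^ (2 * \<alpha> - 2)" using that by (intro tpower_le) auto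
    moreover note tpower_nonneg[of "2 * \<alpha> - 2" "y - x"]
    moreover have "\<bar>(-1) ^ (\<alpha> + 1) * (- nbern (2 * \<alpha> - 1) (x - y) - tpower (2 * \<alpha> - 2) (y - x))\<bar>
      = \<bar>- nbern (2 * \<alpha> - 1) (x - y) - tpower (2 * \<alpha> - 2) (y - x)\<bar>"
      by (simp add: abs_mult power_abs)
    ultimately show ?thesis unfolding d_def L_def by linarith
  qed
  have "\<bar>sob_ker \<alpha> x y - sob_ker \<alpha> x y'\<bar> \<le> L * \<bar>y - y'\<bar>"
    if "x \<in> {0..1}" "y \<in> {0..1}" "y' \<in> {0..1}" for x y y'
    using field_differentiable_bound[of "{0..1}" "sob_ker \<alpha> x" "d x" L y y'] deriv bnd that
    by (auto intro: has_field_derivative_at_within)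
  moreover have "L \<ge> 0" using M(1) by (simp add: L_def)
  ultimately show ?thesis by blast
qed

text \<open>The antiderivative of the kernel in \<open>y\<close> takes the same value at \<open>0\<close> and \<open>1\<close>, so on each
  cell the Riemann sum is compared with a telescoping increment of it.\<close>

lemma sob_ker_riemann:
  assumes "2 \<le> \<alpha>"
  shows "\<exists>L\<ge>0. \<forall>x\<in>{0..1}. \<forall>M\<ge>1. \<bar>\<Sum>i<M. sob_ker \<alpha> x (real i / real M)\<bar> \<le> L"
proof -
  obtain L where L: "L \<ge> 0" "\<And>x y y'. x \<in> {0..1} \<Longrightarrow> y \<in> {0..1} \<Longrightarrow> y' \<in> {0..1} \<Longrightarrow>
      \<bar>sob_ker \<alpha> x y - sob_ker \<alpha> x y'\<bar> \<le> L * \<bar>y - y'\<bar>"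
    using sob_ker_lipschitz[OF assms] by blast
  have "\<bar>\<Sum>i<M. sob_ker \<alpha> x (real i / real M)\<bar> \<le> L" if x: "x \<in> {0..1}" and M: "M \<ge> 1" for x :: real and M :: nat
  proof -
    define F where "F y = (\<Sum>r=1..\<alpha>. nbern r x * nbern (Suc r) y) +
       (-1) ^ (\<alpha> + 1) * (- nbern (Suc (2 * \<alpha>)) (x - y) - tpower (2 * \<alpha>) (y - x))" for y
    have D2: "((\<lambda>y. - nbern (Suc (2 * \<alpha>)) (x - y)) has_field_derivative nbern (2 * \<alpha>) (x - y)) (at y)" for y
      by (auto intro!: derivative_eq_intros)
    have D3: "((\<lambda>y. tpower (2 * \<alpha>) (y - x)) has_field_derivative tpower (2 * \<alpha> - 1) (y - x)) (at y)" for y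
    proof -
      have *: "(tpower (2 * \<alpha>) has_field_derivative tpower (2 * \<alpha> - 1) (y - x)) (at (y - x))"
        using DERIV_tpower[of "y - x" "2 * \<alpha> - 1"] assms by (simp add: Suc_leI)
      show ?thesis by (rule DERIV_shift_minus[OF *])
    qed
    have dF: "(F has_field_derivative sob_ker \<alpha> x y) (at y)" for y
      using assms unfolding F_def
      by (subst sob_ker_altdef, simp)
         (intro DERIV_add DERIV_sum DERIV_cmult DERIV_diff D2 D3 DERIV_nbern_Suc)
    \<comment> \<open>The vanishing mean of the kernel: the increment of the Bernoulli polynomial
      from x - 1 to x is exactly the truncated power at 1 - x.\<close>
    have F01: "F 1 = F 0"
    proof -
      have e: "even (2 * \<alpha>)" by simp
      have "nbern (Suc (2 * \<alpha>)) x = nbern (Suc (2 * \<alpha>)) (x - 1) + (1 - x) ^ (2 * \<alpha>) / fact (2 * \<alpha>)"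
        using nbern_add_1[of "2 * \<alpha>" "x - 1"] power_even_abs[OF e, of "x - 1"] power_even_abs[OF e, of "1 - x"]
        by (simp add: abs_minus_commute algebra_simps)
      moreover have "tpower (2 * \<alpha>) (1 - x) = (1 - x) ^ (2 * \<alpha>) / fact (2 * \<alpha>)"
        using x assms by (auto simp: tpower_def)
      moreover have "tpower (2 * \<alpha>) (0 - x) = 0" using x by (simp add: tpower_def)
      moreover have "(\<Sum>r=1..\<alpha>. nbern r x * nbern (Suc r) 1) = (\<Sum>r=1..\<alpha>. nbern r x * nbern (Suc r) 0)"
        by (intro sum.cong refl) (use nbern_1_eq_0 in auto)
      ultimately show ?thesis by (simp add: F_def)
    qed
    have cell: "\<bar>sob_ker \<alpha> x (real i / real M) - real M * (F (real (Suc i) / real M) - F (real i / real M))\<bar> \<le> L / real M"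
      if i: "i < M" for i
    proof -
      have lt: "real i / real M < real (Suc i) / real M" using M by (simp add: divide_simps)
      obtain z where z: "real i / real M < z" "z < real (Suc i) / real M"
          "F (real (Suc i) / real M) - F (real i / real M) = (real (Suc i) / real M - real i / real M) * sob_ker \<alpha> x z"
        using MVT2[OF lt, of F "sob_ker \<alpha> x"] dF by blast
      have "real (Suc i) / real M - real i / real M = 1 / real M"
        by (simp add: add_divide_distrib)
      hence "real M * (F (real (Suc i) / real M) - F (real i / real M)) = sob_ker \<alpha> x z"
        using z(3) M by simp
      moreover have "\<bar>sob_ker \<alpha> x (real i / real M) - sob_ker \<alpha> x z\<bar> \<le> L * \<bar>real i / real M - z\<bar>"
      proof (rule L(2)[OF x])
        have le1: "real (Suc i) / real M \<le> 1" using i M by (simp add: divide_simps)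
        have ge0: "0 \<le> real i / real M" by simp
        show "z \<in> {0..1}" 
          using order.trans[OF ge0 less_imp_le[OF z(1)]] order.trans[OF less_imp_le[OF z(2)] le1] by simp
        show "real i / real M \<in> {0..1}" using i by (simp add: divide_simps)
      qed
      moreover have "\<bar>real i / real M - z\<bar> \<le> 1 / real M"
        using z by (simp add: add_divide_distrib)
      hence "L * \<bar>real i / real M - z\<bar> \<le> L * (1 / real M)" using L(1) by (rule mult_left_mono)
      ultimately show ?thesis by simp
    qed
    have tele: "(\<Sum>i<M. real M * (F (real (Suc i) / real M) - F (real i / real M))) = 0"
      using M F01 sum_lessThan_telescope[of "\<lambda>i. F (real i / real M)" M]
      by (simp add: sum_distrib_left[symmetric] del: of_nat_Suc)
    have "\<bar>\<Sum>i<M. sob_ker \<alpha> x (real i / real M)\<bar> =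
        \<bar>\<Sum>i<M. sob_ker \<alpha> x (real i / real M) - real M * (F (real (Suc i) / real M) - F (real i / real M))\<bar>"
      unfolding sum_subtractf tele by simp
    also have "\<dots> \<le> (\<Sum>i<M. L / real M)"
      by (intro sum_abs[THEN order_trans] sum_mono cell) auto
    also have "\<dots> = L" using M by simp
    finally show ?thesis .
  qed
  with L(1) show ?thesis by blast
qed

text \<open>Coordinates outside \<open>u\<close> receive the factor 1, so that the product may run
  over all of \<open>S\<close> and the sum factors. It serves both the grid averages on the cube and
  the averages over shifts.\<close>

lemma PiE_average_prod:
  fixes \<phi> :: "'i \<Rightarrow> 'a \<Rightarrow> real"
  assumes S: "finite S" "u \<subseteq> S" and B: "finite B" "B \<noteq> {}"
  shows "(\<Sum>z\<in>PiE S (\<lambda>_. B). \<Prod>j\<in>u. \<phi> j (z j)) / real (card B) ^ card S =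
         (\<Prod>j\<in>u. (\<Sum>c\<in>B. \<phi> j c) / real (card B))"
proof -
  have c: "real (card B) \<noteq> 0" using B by simp
  have restr: "(\<Prod>j\<in>S. if j \<in> u then g j else 1) = (\<Prod>j\<in>u. g j)" for g :: "'i \<Rightarrow> real"
    using S by (intro prod.mono_neutral_cong_right) auto
  have "(\<Sum>z\<in>PiE S (\<lambda>_. B). \<Prod>j\<in>u. \<phi> j (z j)) =
        (\<Sum>z\<in>PiE S (\<lambda>_. B). \<Prod>j\<in>S. if j \<in> u then \<phi> j (z j) else 1)"
    by (simp only: restr)
  also have "\<dots> = (\<Prod>j\<in>S. \<Sum>c\<in>B. if j \<in> u then \<phi> j c else 1)"
    using S B by (simp add: prod_sum_PiE[of S "\<lambda>_. B" "\<lambda>j c. if j \<in> u then \<phi> j c else 1"])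
  also have "\<dots> / real (card B) ^ card S = (\<Prod>j\<in>S. (\<Sum>c\<in>B. if j \<in> u then \<phi> j c else 1) / real (card B))"
    by (simp add: prod_dividef)
  also have "\<dots> = (\<Prod>j\<in>S. if j \<in> u then (\<Sum>c\<in>B. \<phi> j c) / real (card B) else 1)"
    using c by (intro prod.cong) auto
  finally show ?thesis by (simp only: restr)
qed

section \<open>Error bounds in reproducing kernel Hilbert spaces\<close>

context hilbert_function_space
begin

lemma ip_zero_right: "f \<in> V \<Longrightarrow> ip f (\<lambda>x\<in>X. 0) = 0"
  using ip_scale[of f f 0] ip_commute[OF _ zero, of f] by simp

text \<open>The quadratic polynomial in c given by the squared norm of f + c h is nonnegative; its
  minimum yields the inequality. If h has norm zero, the polynomial is affine and its slope must
  vanish.\<close>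

lemma cauchy_schwarz:
  assumes f: "f \<in> V" and h: "h \<in> V"
  shows "(ip f h)\<^sup>2 \<le> ip f f * ip h h"
proof -
  have q: "0 \<le> ip f f + 2 * c * ip f h + c\<^sup>2 * ip h h" for c
  proof -
    define g where "g = (\<lambda>x\<in>X. c * h x)"
    have g: "g \<in> V" unfolding g_def by (rule scale[OF h])
    have s: "(\<lambda>x\<in>X. f x + g x) \<in> V" by (rule add[OF f g])
    have "ip (\<lambda>x\<in>X. f x + g x) (\<lambda>x\<in>X. f x + g x) = ip f (\<lambda>x\<in>X. f x + g x) + ip g (\<lambda>x\<in>X. f x + g x)"
      by (rule ip_add[OF f g s])
    also have "ip f (\<lambda>x\<in>X. f x + g x) = ip f f + ip g f"
      using ip_commute[OF f s] ip_add[OF f g f] by simp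
    also have "ip g (\<lambda>x\<in>X. f x + g x) = ip f g + ip g g"
      using ip_commute[OF g s] ip_add[OF f g g] by simp
    also have "ip f g = c * ip f h"
      using ip_commute[OF f g] ip_commute[OF f h] ip_scale[OF h f, of c] by (simp add: g_def)
    also have "ip g f = c * ip f h"
      using ip_commute[OF f h] ip_scale[OF h f, of c] by (simp add: g_def)
    also have "ip g g = c * (c * ip h h)"
      using ip_scale[OF h g, of c] ip_commute[OF h g] ip_scale[OF h h, of c] by (simp add: g_def)
    finally have "ip (\<lambda>x\<in>X. f x + g x) (\<lambda>x\<in>X. f x + g x) = ip f f + 2 * c * ip f h + c\<^sup>2 * ip h h"
      by (simp only: power2_eq_square algebra_simps mult_2)
    thus ?thesis using ip_nonneg[OF s] by (simp only:)
  qed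
  show ?thesis
  proof (cases "ip h h = 0")
    case True
    have "ip f h = 0"
    proof (rule ccontr)
      assume n: "ip f h \<noteq> 0"
      \<comment> \<open>At this c the affine function takes the value -1.\<close>
      show False using q[of "- (ip f f + 1) / (2 * ip f h)"] n True by (simp add: field_simps)
    qed
    thus ?thesis using True by simp
  next
    case False
    hence p: "ip h h > 0" using ip_nonneg[OF h] by simp
    show ?thesis
      using q[of "- ip f h / ip h h"] p by (simp add: field_simps power2_eq_square)
  qed
qed

end

context rkhs
begin

lemma kernel_combination:
  assumes "finite I" "\<And>i. i \<in> I \<Longrightarrow> p i \<in> X"
  shows "(\<lambda>x\<in>X. \<Sum>i\<in>I. w i * K x (p i)) \<in> V \<and>
         (\<forall>f\<in>V. ip f (\<lambda>x\<in>X. \<Sum>i\<in>I. w i * K x (p i)) = (\<Sum>i\<in>I. w i * f (p i)))"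
  using assms
proof (induction I rule: finite_induct)
  case empty
  show ?case unfolding sum.empty using zero ip_zero_right by blast
next
  case (insert i I)
  define g where "g = (\<lambda>x\<in>X. \<Sum>i\<in>I. w i * K x (p i))"
  define k where "k = (\<lambda>x\<in>X. K x (p i))"
  define h where "h = (\<lambda>x\<in>X. w i * k x)"
  have g: "g \<in> V" "\<And>f. f \<in> V \<Longrightarrow> ip f g = (\<Sum>i\<in>I. w i * f (p i))"
    unfolding g_def using insert.IH insert.prems by blast+
  have k: "k \<in> V" unfolding k_def using insert by (intro kernel_in) auto
  have h: "h \<in> V" unfolding h_def by (rule scale[OF k])
  have eq: "(\<lambda>x\<in>X. \<Sum>i\<in>insert i I. w i * K x (p i)) = (\<lambda>x\<in>X. h x + g x)"
    using insert by (auto simp: g_def h_def k_def fun_eq_iff)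
  have "ip f (\<lambda>x\<in>X. h x + g x) = (\<Sum>i\<in>insert i I. w i * f (p i))" if f: "f \<in> V" for f
  proof -
    have "ip f (\<lambda>x\<in>X. h x + g x) = ip h f + ip g f"
      using ip_commute[OF f add[OF h g(1)]] ip_add[OF h g(1) f] by simp
    also have "ip h f = w i * ip k f" unfolding h_def by (rule ip_scale[OF k f])
    also have "ip k f = f (p i)"
      using reproducing[OF f, of "p i"] ip_commute[OF k f] insert by (simp add: k_def)
    also have "ip g f = (\<Sum>i\<in>I. w i * f (p i))" using g(2)[OF f] ip_commute[OF f g(1)] by simp
    also have "w i * f (p i) + (\<Sum>i\<in>I. w i * f (p i)) = (\<Sum>i\<in>insert i I. w i * f (p i))"
      using insert.hyps by simp
    finally show ?thesis .
  qed
  thus ?case unfolding eq using add[OF h g(1)] by blast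
qed

text \<open>The functional of weighted point evaluations is represented by the same combination of
  kernel sections, and the squared norm of that representer is the double kernel sum. The points may
  repeat, since only the index set matters.\<close>

lemma weighted_sum_bound:
  assumes "finite I" "\<And>i. i \<in> I \<Longrightarrow> p i \<in> X" "f \<in> V"
  shows "(\<Sum>i\<in>I. w i * f (p i))\<^sup>2 \<le> ip f f * (\<Sum>i\<in>I. \<Sum>j\<in>I. w i * w j * K (p i) (p j))"
proof -
  define h where "h = (\<lambda>x\<in>X. \<Sum>i\<in>I. w i * K x (p i))"
  have h: "h \<in> V" "\<And>g. g \<in> V \<Longrightarrow> ip g h = (\<Sum>i\<in>I. w i * g (p i))"
    using kernel_combination[of I p w] assms by (auto simp: h_def)
  have "ip h h = (\<Sum>i\<in>I. w i * (\<Sum>j\<in>I. w j * K (p i) (p j)))"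
    using h(2)[OF h(1)] assms(2) by (simp add: h_def)
  also have "\<dots> = (\<Sum>i\<in>I. \<Sum>j\<in>I. w i * w j * K (p i) (p j))"
    by (simp add: sum_distrib_left mult.assoc)
  finally show ?thesis using cauchy_schwarz[OF assms(3) h(1)] h(2)[OF assms(3)] by simp
qed

end

section \<open>Riemann sums on the cube\<close>

definition grid_point :: "nat \<Rightarrow> nat \<Rightarrow> (nat \<Rightarrow> nat) \<Rightarrow> (nat \<Rightarrow> real)" where
  "grid_point s M z = (\<lambda>j\<in>{1..s}. real (z j) / real M)"

lemma grid_point_in_cube:
  assumes "z \<in> {1..s} \<rightarrow>\<^sub>E {0..<M}" shows "grid_point s M z \<in> cube s"
  using assms by (auto simp: cube_def grid_point_def PiE_iff)

lemma floor_grid: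
  fixes x :: real
  assumes "0 \<le> x" "x < 1" "1 \<le> M"
  shows "nat \<lfloor>real M * x\<rfloor> < M" "real (nat \<lfloor>real M * x\<rfloor>) / real M \<le> x"
    "x < (real (nat \<lfloor>real M * x\<rfloor>) + 1) / real M"
proof -
  have r: "real (nat \<lfloor>real M * x\<rfloor>) = of_int \<lfloor>real M * x\<rfloor>" using assms by simp
  have "real M * x < real M" using assms by simp
  hence "real (nat \<lfloor>real M * x\<rfloor>) < real M" unfolding r by linarith
  thus "nat \<lfloor>real M * x\<rfloor> < M" by simp
  show "real (nat \<lfloor>real M * x\<rfloor>) / real M \<le> x"
    using assms of_int_floor_le[of "real M * x"] unfolding r by (simp add: divide_simps mult.commute)
  show "x < (real (nat \<lfloor>real M * x\<rfloor>) + 1) / real M"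
  proof -
    have "real M * x < of_int \<lfloor>real M * x\<rfloor> + 1" by linarith
    thus ?thesis using assms unfolding r by (simp add: divide_simps mult.commute)
  qed
qed

lemma tendsto_floor_grid:
  fixes x :: real
  assumes "0 \<le> x" "x < 1"
  shows "(\<lambda>M. real (nat \<lfloor>real (Suc M) * x\<rfloor>) / real (Suc M)) \<longlonglongrightarrow> x"
proof (rule real_tendsto_sandwich)
  show "\<forall>\<^sub>F M in sequentially. x - inverse (real (Suc M)) \<le> real (nat \<lfloor>real (Suc M) * x\<rfloor>) / real (Suc M)"
  proof (intro always_eventually allI)
    fix M
    show "x - inverse (real (Suc M)) \<le> real (nat \<lfloor>real (Suc M) * x\<rfloor>) / real (Suc M)"
      using floor_grid(3)[OF assms, of "Suc M"] by (simp add: add_divide_distrib inverse_eq_divide del: of_nat_Suc)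
  qed
  show "\<forall>\<^sub>F M in sequentially. real (nat \<lfloor>real (Suc M) * x\<rfloor>) / real (Suc M) \<le> x"
    using floor_grid(2)[OF assms, of "Suc _"] by (intro always_eventually allI) simp
  show "(\<lambda>M. x - inverse (real (Suc M))) \<longlonglongrightarrow> x"
    using tendsto_diff[OF tendsto_const LIMSEQ_inverse_real_of_nat, of x] by simp
qed simp

lemma cube_coord:
  assumes "x \<in> cube s" "j \<in> {1..s}" shows "0 \<le> x j" "x j < 1"
  using assms by (auto simp: cube_def PiE_iff)

lemma tendsto_sobolev_kernel:
  assumes "\<And>j. j \<in> {1..s} \<Longrightarrow> ((\<lambda>z. f z j) \<longlongrightarrow> x j) F" "\<And>j. j \<in> {1..s} \<Longrightarrow> ((\<lambda>z. g z j) \<longlongrightarrow> y j) F"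
  shows "((\<lambda>z. sobolev_kernel s \<alpha> \<gamma> (f z) (g z)) \<longlongrightarrow> sobolev_kernel s \<alpha> \<gamma> x y) F"
  unfolding sobolev_kernel_altdef
  by (intro tendsto_sum tendsto_mult tendsto_const tendsto_prod tendsto_sob_ker assms) auto

lemma sobolev_kernel_commute: "sobolev_kernel s \<alpha> \<gamma> x y = sobolev_kernel s \<alpha> \<gamma> y x"
  unfolding sobolev_kernel_altdef by (intro sum.cong prod.cong arg_cong2[of _ _ _ _ "(*)"] sob_ker_commute refl)

lemma sobolev_kernel_bounded:
  assumes "1 \<le> \<alpha>"
  shows "\<exists>B\<ge>0. \<forall>x\<in>cube s. sobolev_kernel s \<alpha> \<gamma> x x \<le> B"
proof -
  obtain M where M: "M \<ge> 1" "\<And>x y. x \<in> {0..1} \<Longrightarrow> y \<in> {0..1} \<Longrightarrow> \<bar>sob_ker \<alpha> x y\<bar> \<le> M"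
    using sob_ker_bounded[OF assms] by blast
  have "sobolev_kernel s \<alpha> \<gamma> x x \<le> (\<Sum>u\<in>Pow {1..s}. \<bar>\<gamma> u\<bar> * M ^ card u)" if x: "x \<in> cube s" for x
    unfolding sobolev_kernel_altdef
  proof (rule sum_mono)
    fix u assume u: "u \<in> Pow {1..s}"
    have "\<bar>\<Prod>j\<in>u. sob_ker \<alpha> (x j) (x j)\<bar> = (\<Prod>j\<in>u. \<bar>sob_ker \<alpha> (x j) (x j)\<bar>)" by (rule abs_prod)
    also have "\<dots> \<le> (\<Prod>j\<in>u. M)"
    proof (intro prod_mono conjI)
      fix j assume "j \<in> u"
      hence "x j \<in> {0..1}" using cube_coord[OF x, of j] u by auto
      thus "\<bar>sob_ker \<alpha> (x j) (x j)\<bar> \<le> M" by (intro M(2))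
    qed simp
    finally have "\<bar>\<Prod>j\<in>u. sob_ker \<alpha> (x j) (x j)\<bar> \<le> M ^ card u" by simp
    hence "\<bar>\<gamma> u\<bar> * \<bar>\<Prod>j\<in>u. sob_ker \<alpha> (x j) (x j)\<bar> \<le> \<bar>\<gamma> u\<bar> * M ^ card u" by (rule mult_left_mono) simp
    thus "\<gamma> u * (\<Prod>j\<in>u. sob_ker \<alpha> (x j) (x j)) \<le> \<bar>\<gamma> u\<bar> * M ^ card u"
      by (simp add: abs_mult[symmetric])
  qed
  moreover have "0 \<le> (\<Sum>u\<in>Pow {1..s}. \<bar>\<gamma> u\<bar> * M ^ card u)" using M(1) by (intro sum_nonneg) simp
  ultimately show ?thesis by blast
qed

text \<open>Everything about \<open>f\<close> comes from the kernel: it is bounded because the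
  kernel is bounded on the diagonal, and its values at grid points converge because the kernel is
  continuous. So the step functions \<open>F M\<close> converge pointwise, which gives measurability
  of the limit, and dominated convergence applies.\<close>

lemma riemann_sum_tendsto:
  assumes "1 \<le> \<alpha>" and H: "rkhs (cube s) (sobolev_kernel s \<alpha> \<gamma>) V ip" and f: "f \<in> V"
  shows "(\<lambda>M. (\<Sum>z\<in>{1..s} \<rightarrow>\<^sub>E {0..<Suc M}. f (grid_point s (Suc M) z)) / real (Suc M) ^ s)
           \<longlonglongrightarrow> cube_integral s f"
proof -
  interpret rkhs "cube s" "sobolev_kernel s \<alpha> \<gamma>" V ip by (rule H)
  interpret product_sigma_finite "\<lambda>_ :: nat. lborel :: real measure" ..
  let ?K = "sobolev_kernel s \<alpha> \<gamma>"
  let ?N = "Pi\<^sub>M {1..s} (\<lambda>_. lborel :: real measure)"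
  obtain B where B: "B \<ge> 0" "\<And>x. x \<in> cube s \<Longrightarrow> ?K x x \<le> B"
    using sobolev_kernel_bounded[OF assms(1)] by blast
  have fb: "\<bar>f x\<bar> \<le> sqrt (ip f f * B)" if x: "x \<in> cube s" for x
  proof -
    have "(f x)\<^sup>2 \<le> ip f f * ?K x x"
      using weighted_sum_bound[of "{0::nat}" "\<lambda>_. x" f "\<lambda>_. 1"] f x by simp
    also have "\<dots> \<le> ip f f * B" by (intro mult_left_mono B x ip_nonneg f)
    finally show ?thesis using real_sqrt_le_mono by fastforce
  qed
  define cell :: "nat \<Rightarrow> (nat \<Rightarrow> nat) \<Rightarrow> (nat \<Rightarrow> real) set" where
    "cell M z = PiE {1..s} (\<lambda>j. {real (z j) / real (Suc M) ..< (real (z j) + 1) / real (Suc M)})" for M z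
  define Z where "Z M = ({1..s} \<rightarrow>\<^sub>E {0..<Suc M})" for M
  define fl where "fl M x = (\<lambda>j\<in>{1..s}. nat \<lfloor>real (Suc M) * x j\<rfloor>)" for M and x :: "nat \<Rightarrow> real"
  define F where "F M x = (\<Sum>z\<in>Z M. f (grid_point s (Suc M) z) * indicator (cell M z) x)" for M x
  have finZ: "finite (Z M)" for M unfolding Z_def by (intro finite_PiE) auto
  have cell_sets: "cell M z \<in> sets ?N" for M z
    unfolding cell_def by (intro sets_PiM_I_finite) auto
  have cell_em: "emeasure ?N (cell M z) = ennreal (1 / real (Suc M) ^ s)" for M z
    unfolding cell_def
    by (subst emeasure_PiM) (auto simp: add_divide_distrib divide_right_mono prod_ennreal[symmetric] power_one_over ennreal_power)
  have flZ: "fl M x \<in> Z M" if "x \<in> cube s" for M x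
    unfolding Z_def fl_def using floor_grid(1)[OF cube_coord[OF that], of _ "Suc M"] by auto
  have flcell: "x \<in> cell M z \<longleftrightarrow> z = fl M x" if x: "x \<in> cube s" and z: "z \<in> Z M" for M x z
  proof
    assume c: "x \<in> cell M z"
    show "z = fl M x"
    proof (rule PiE_ext[OF z[unfolded Z_def] flZ[OF x, unfolded Z_def]])
      fix j assume j: "j \<in> {1..s}"
      have "real (z j) / real (Suc M) \<le> x j" "x j < (real (z j) + 1) / real (Suc M)"
        using c j by (auto simp: cell_def PiE_iff)
      hence "real (z j) \<le> real (Suc M) * x j" "real (Suc M) * x j < real (z j) + 1"
        by (simp_all add: divide_simps mult.commute del: of_nat_Suc)
      hence "\<lfloor>real (Suc M) * x j\<rfloor> = int (z j)" by (intro floor_unique) auto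
      thus "z j = fl M x j" using j by (simp add: fl_def)
    qed
  next
    assume "z = fl M x"
    thus "x \<in> cell M z"
      using x floor_grid(2,3)[OF cube_coord[OF x], of _ "Suc M"]
      by (auto simp: cell_def fl_def PiE_iff cube_def)
  qed
  have cell_cube: "x \<in> cube s" if "x \<in> cell M z" "z \<in> Z M" for x M z
    unfolding cube_def
  proof (rule PiE_I)
    fix j assume j: "j \<in> {1..s}"
    have "real (z j) / real (Suc M) \<le> x j" "x j < (real (z j) + 1) / real (Suc M)"
      using that j by (auto simp: cell_def PiE_iff)
    moreover have "0 \<le> real (z j) / real (Suc M)" by simp
    moreover have "z j < Suc M" using that(2) j by (auto simp: Z_def PiE_iff)
    hence "real (z j) + 1 \<le> real (Suc M)" by simp
    hence "(real (z j) + 1) / real (Suc M) \<le> 1" by (simp only: divide_le_eq_1) simp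
    ultimately show "x j \<in> {0..<1}" unfolding atLeastLessThan_iff by linarith
  qed (use that in \<open>auto simp: cell_def PiE_iff extensional_def\<close>)
  have F_in: "F M x = f (grid_point s (Suc M) (fl M x))" if x: "x \<in> cube s" for M x
  proof -
    have "F M x = (\<Sum>z\<in>Z M. if z = fl M x then f (grid_point s (Suc M) z) else 0)"
      unfolding F_def by (intro sum.cong refl) (auto simp: indicator_def flcell[OF x])
    thus ?thesis using finZ flZ[OF x] by simp
  qed
  have F_out: "F M x = 0" if "x \<notin> cube s" for M x
    unfolding F_def using cell_cube that by (intro sum.neutral) (auto simp: indicator_def)
  have F_meas: "F M \<in> borel_measurable ?N" for M
    unfolding F_def using cell_sets by measurable
  have conv: "(\<lambda>M. F M x) \<longlonglongrightarrow> indicator (cube s) x *\<^sub>R f x" for x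
  proof (cases "x \<in> cube s")
    case x: True
    let ?y = "\<lambda>M. grid_point s (Suc M) (fl M x)"
    have y: "?y M \<in> cube s" for M using flZ[OF x] by (intro grid_point_in_cube) (simp add: Z_def)
    have yc: "(\<lambda>M. ?y M j) \<longlonglongrightarrow> x j" if "j \<in> {1..s}" for j
      using tendsto_floor_grid[OF cube_coord[OF x that]] that by (simp add: grid_point_def fl_def)
    \<comment> \<open>The weights 1 and -1 bound the increment of \<open>f\<close> by the distance
      of two kernel sections.\<close>
    have le: "(f (?y M) - f x)\<^sup>2 \<le> ip f f * (?K (?y M) (?y M) - 2 * ?K (?y M) x + ?K x x)" for M
      using weighted_sum_bound[of "{0, 1::nat}" "\<lambda>i. if i = 0 then ?y M else x" f "\<lambda>i. if i = 0 then 1 else -1"]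
        f x y[of M] sobolev_kernel_commute[of s \<alpha> \<gamma> x "?y M"] by (simp split: if_splits add: algebra_simps)
    have "(\<lambda>M. ip f f * (?K (?y M) (?y M) - 2 * ?K (?y M) x + ?K x x))
        \<longlonglongrightarrow> ip f f * (?K x x - 2 * ?K x x + ?K x x)"
      by (intro tendsto_intros tendsto_sobolev_kernel yc)
    hence "(\<lambda>M. ip f f * (?K (?y M) (?y M) - 2 * ?K (?y M) x + ?K x x)) \<longlonglongrightarrow> 0" by simp
    hence "(\<lambda>M. (f (?y M) - f x)\<^sup>2) \<longlonglongrightarrow> 0"
      by (rule Lim_null_comparison[rotated]) (use le in \<open>simp add: always_eventually\<close>)
    hence "(\<lambda>M. sqrt ((f (?y M) - f x)\<^sup>2)) \<longlonglongrightarrow> sqrt 0" by (rule tendsto_real_sqrt)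
    hence "(\<lambda>M. \<bar>f (?y M) - f x\<bar>) \<longlonglongrightarrow> 0" by simp
    hence "(\<lambda>M. f (?y M)) \<longlonglongrightarrow> f x" by (simp add: tendsto_rabs_zero_iff LIM_zero_iff)
    thus ?thesis using x by (simp add: F_in)
  qed (simp add: F_out)
  have cube_em: "emeasure ?N (cube s) = 1" "cube s \<in> sets ?N"
    unfolding cube_def by (subst emeasure_PiM) (auto intro!: sets_PiM_I_finite)
  have "(\<lambda>M. integral\<^sup>L ?N (F M)) \<longlonglongrightarrow> integral\<^sup>L ?N (\<lambda>x. indicator (cube s) x *\<^sub>R f x)"
  proof (rule integral_dominated_convergence[where w = "\<lambda>x. sqrt (ip f f * B) * indicator (cube s) x"])
    show "F M \<in> borel_measurable ?N" for M by (rule F_meas)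
    show "(\<lambda>x. indicator (cube s) x *\<^sub>R f x) \<in> borel_measurable ?N"
      by (rule borel_measurable_LIMSEQ_real[OF conv F_meas])
    show "integrable ?N (\<lambda>x. sqrt (ip f f * B) * indicator (cube s) x)"
      using cube_em by (intro integrable_mult_right integrable_real_indicator) auto
    show "AE x in ?N. (\<lambda>M. F M x) \<longlonglongrightarrow> indicator (cube s) x *\<^sub>R f x" using conv by simp
    show "AE x in ?N. norm (F M x) \<le> sqrt (ip f f * B) * indicator (cube s) x" for M
    proof (rule AE_I2)
      fix x
      show "norm (F M x) \<le> sqrt (ip f f * B) * indicator (cube s) x"
      proof (cases "x \<in> cube s")
        case True
        thus ?thesis using fb[OF grid_point_in_cube[OF flZ[OF True, unfolded Z_def]]] by (simp add: F_in)
      qed (simp add: F_out)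
    qed
  qed
  moreover have "integral\<^sup>L ?N (F M) = (\<Sum>z\<in>Z M. f (grid_point s (Suc M) z)) / real (Suc M) ^ s" for M
  proof -
    have int: "integrable ?N (indicator (cell M z) :: _ \<Rightarrow> real)" for z
      using cell_em[of M z] by (intro integrable_real_indicator cell_sets) simp
    have "measure ?N (cell M z) = 1 / real (Suc M) ^ s" for z
      unfolding measure_def cell_em by simp
    hence I: "integral\<^sup>L ?N (indicator (cell M z)) = 1 / real (Suc M) ^ s" for z
      by (simp only: Bochner_Integration.integral_indicator sets.Int_space_eq2[OF cell_sets])
    have "integral\<^sup>L ?N (F M) = (\<Sum>z\<in>Z M. integral\<^sup>L ?N (\<lambda>x. f (grid_point s (Suc M) z) * indicator (cell M z) x))"
      unfolding F_def by (intro Bochner_Integration.integral_sum integrable_mult_right int)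
    also have "\<dots> = (\<Sum>z\<in>Z M. f (grid_point s (Suc M) z) * (1 / real (Suc M) ^ s))"
      by (simp only: integral_mult_right_zero I)
    finally show ?thesis by (simp add: sum_divide_distrib)
  qed
  ultimately show ?thesis
    unfolding cube_integral_def set_lebesgue_integral_def Z_def[symmetric] by (simp only:)
qed

text \<open>The one-dimensional kernel sums are bounded before normalisation, so every coordinate in
  \<open>u\<close> contributes a factor O(1/M); since \<open>u\<close> is nonempty, at least one
  such factor is available.\<close>

lemma grid_average_bound:
  assumes L: "L \<ge> 0" "\<And>x M. x \<in> {0..1} \<Longrightarrow> M \<ge> 1 \<Longrightarrow> \<bar>\<Sum>i<M. sob_ker \<alpha> x (real i / real M)\<bar> \<le> L"
    and x: "x \<in> cube s" and u: "u \<subseteq> {1..s}" "u \<noteq> {}"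
  shows "\<bar>(\<Sum>z\<in>{1..s} \<rightarrow>\<^sub>E {0..<Suc M}. \<Prod>j\<in>u. sob_ker \<alpha> (x j) (grid_point s (Suc M) z j)) / real (Suc M) ^ s\<bar>
          \<le> L ^ card u / real (Suc M)"
proof -
  have fin: "finite u" using u finite_subset by blast
  have "(\<Sum>z\<in>{1..s} \<rightarrow>\<^sub>E {0..<Suc M}. \<Prod>j\<in>u. sob_ker \<alpha> (x j) (grid_point s (Suc M) z j)) =
        (\<Sum>z\<in>{1..s} \<rightarrow>\<^sub>E {0..<Suc M}. \<Prod>j\<in>u. sob_ker \<alpha> (x j) (real (z j) / real (Suc M)))"
    using u by (intro sum.cong prod.cong) (auto simp: grid_point_def)
  also have "\<dots> / real (Suc M) ^ s = (\<Prod>j\<in>u. (\<Sum>i\<in>{0..<Suc M}. sob_ker \<alpha> (x j) (real i / real (Suc M))) / real (Suc M))"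
    using PiE_average_prod[of "{1..s}" u "{0..<Suc M}" "\<lambda>j i. sob_ker \<alpha> (x j) (real i / real (Suc M))"] u
    by simp
  finally have "\<bar>(\<Sum>z\<in>{1..s} \<rightarrow>\<^sub>E {0..<Suc M}. \<Prod>j\<in>u. sob_ker \<alpha> (x j) (grid_point s (Suc M) z j)) / real (Suc M) ^ s\<bar>
     = (\<Prod>j\<in>u. \<bar>\<Sum>i<Suc M. sob_ker \<alpha> (x j) (real i / real (Suc M))\<bar> / real (Suc M))"
    by (simp add: abs_prod atLeast0LessThan del: sum.lessThan_Suc of_nat_Suc)
  also have "\<dots> \<le> (\<Prod>j\<in>u. L / real (Suc M))"
  proof (intro prod_mono conjI divide_right_mono)
    fix j assume "j \<in> u"
    hence "x j \<in> {0..1}" using cube_coord[OF x, of j] u by auto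
    thus "\<bar>\<Sum>i<Suc M. sob_ker \<alpha> (x j) (real i / real (Suc M))\<bar> \<le> L" by (intro L(2)) auto
  qed auto
  also have "\<dots> = L ^ card u / real (Suc M) ^ card u" by (simp add: power_divide)
  also have "\<dots> \<le> L ^ card u / real (Suc M) ^ 1"
  proof (intro divide_left_mono power_increasing)
    show "1 \<le> card u" using u fin by (simp add: Suc_le_eq card_gt_0_iff)
  qed (use L(1) in auto)
  finally show ?thesis by simp
qed

text \<open>A fine grid stands in for the integral. For nonempty \<open>u\<close> every kernel sum
  that involves the grid is O(1/M), so letting M grow removes the grid from the bound while the grid
  average of \<open>f\<close> tends to the integral.\<close>

lemma quadrature_error_bound:
  assumes \<alpha>: "2 \<le> \<alpha>" and H: "rkhs (cube s) (sobolev_kernel s \<alpha> \<gamma>) V ip" and f: "f \<in> V"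
    and \<gamma>: "\<And>u. u \<subseteq> {1..s} \<Longrightarrow> 0 \<le> \<gamma> u"
    and I: "finite I" "I \<noteq> {}" and p: "\<And>h. h \<in> I \<Longrightarrow> p h \<in> cube s"
  shows "((\<Sum>h\<in>I. f (p h)) / real (card I) - cube_integral s f)\<^sup>2 \<le>
    ip f f * (\<Sum>u\<in>Pow {1..s} - {{}}. \<gamma> u * ((\<Sum>h\<in>I. \<Sum>h'\<in>I. \<Prod>j\<in>u. sob_ker \<alpha> (p h j) (p h' j)) / (real (card I))\<^sup>2))"
    (is "_ \<le> ip f f * ?A")
proof -
  interpret rkhs "cube s" "sobolev_kernel s \<alpha> \<gamma>" V ip by (rule H)
  let ?K = "sobolev_kernel s \<alpha> \<gamma>"
  define N where "N = real (card I)"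
  have N: "N > 0" using I by (simp add: N_def card_gt_0_iff)
  obtain L where L: "L \<ge> 0" "\<And>x M. x \<in> {0..1} \<Longrightarrow> M \<ge> 1 \<Longrightarrow> \<bar>\<Sum>i<M. sob_ker \<alpha> x (real i / real M)\<bar> \<le> L"
    using sob_ker_riemann[OF \<alpha>] by blast
  define Z where "Z M = ({1..s} \<rightarrow>\<^sub>E {0..<Suc M})" for M
  have finZ: "finite (Z M)" for M unfolding Z_def by (intro finite_PiE) auto
  let ?g = "\<lambda>M. grid_point s (Suc M)"
  have g: "?g M z \<in> cube s" if "z \<in> Z M" for M z
    using that unfolding Z_def by (rule grid_point_in_cube)
  \<comment> \<open>The factor 3 counts the two mixed terms and the grid-grid term.\<close>
  define D where "D M = (\<Sum>u\<in>Pow {1..s} - {{}}. \<gamma> u * (3 * L ^ card u))" for M :: nat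
  have main: "((\<Sum>h\<in>I. f (p h)) / N - (\<Sum>z\<in>Z M. f (?g M z)) / real (Suc M) ^ s)\<^sup>2 \<le>
      ip f f * (?A + D M * inverse (real (Suc M)))" for M
  proof -
    define R where "R = real (Suc M) ^ s"
    have R: "R > 0" by (simp add: R_def del: of_nat_Suc)
    have cardZ: "real (card (Z M)) = R" by (simp add: Z_def R_def card_PiE)
    \<comment> \<open>The index set is a disjoint sum, so a point occurring both in the rule and in
      the grid keeps both weights.\<close>
    define w where "w = case_sum (\<lambda>_ :: 'a. 1 / N) (\<lambda>_ :: nat \<Rightarrow> nat. - 1 / R)"
    define q where "q = case_sum p (?g M)"
    have fin: "finite (I <+> Z M)" using I finZ by simp
    have E: "(\<Sum>i\<in>I <+> Z M. w i * f (q i)) = (\<Sum>h\<in>I. f (p h)) / N - (\<Sum>z\<in>Z M. f (?g M z)) / R"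
      using I finZ by (simp add: sum.Plus w_def q_def sum_divide_distrib sum_negf)
    have "(\<Sum>i\<in>I <+> Z M. \<Sum>j\<in>I <+> Z M. w i * w j * ?K (q i) (q j)) \<le> ?A + D M * inverse (real (Suc M))"
    proof -
      define k where "k u x y = (\<Prod>j\<in>u. sob_ker \<alpha> (x j) (y j))" for u and x y :: "nat \<Rightarrow> real"
      define G where "G u x = (\<Sum>z\<in>Z M. k u x (?g M z)) / R" for u x
      define T where "T u = (\<Sum>h\<in>I. \<Sum>h'\<in>I. k u (p h) (p h')) / N\<^sup>2 - 2 * ((\<Sum>h\<in>I. G u (p h)) / N)
          + (\<Sum>z\<in>Z M. G u (?g M z)) / R" for u
      have kc: "k u x y = k u y x" for u x y unfolding k_def by (intro prod.cong sob_ker_commute refl)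
      have sw: "(\<Sum>z\<in>Z M. \<Sum>h\<in>I. k u (?g M z) (p h)) = (\<Sum>h\<in>I. \<Sum>z\<in>Z M. k u (p h) (?g M z))" for u
        by (subst sum.swap) (simp add: kc)
      have "(\<Sum>i\<in>I <+> Z M. \<Sum>j\<in>I <+> Z M. w i * w j * ?K (q i) (q j)) =
        (\<Sum>u\<in>Pow {1..s}. \<gamma> u * (\<Sum>i\<in>I <+> Z M. \<Sum>j\<in>I <+> Z M. w i * w j * k u (q i) (q j)))"
      proof -
        have "(\<Sum>u\<in>Pow {1..s}. \<gamma> u * (\<Sum>i\<in>I <+> Z M. \<Sum>j\<in>I <+> Z M. w i * w j * k u (q i) (q j))) =
          (\<Sum>u\<in>Pow {1..s}. \<Sum>i\<in>I <+> Z M. \<Sum>j\<in>I <+> Z M. \<gamma> u * (w i * w j * k u (q i) (q j)))"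
          by (simp only: sum_distrib_left)
        also have "\<dots> = (\<Sum>i\<in>I <+> Z M. \<Sum>u\<in>Pow {1..s}. \<Sum>j\<in>I <+> Z M. \<gamma> u * (w i * w j * k u (q i) (q j)))"
          by (rule sum.swap)
        also have "\<dots> = (\<Sum>i\<in>I <+> Z M. \<Sum>j\<in>I <+> Z M. \<Sum>u\<in>Pow {1..s}. \<gamma> u * (w i * w j * k u (q i) (q j)))"
          by (intro sum.cong refl sum.swap)
        also have "\<dots> = (\<Sum>i\<in>I <+> Z M. \<Sum>j\<in>I <+> Z M. w i * w j * ?K (q i) (q j))"
          unfolding sobolev_kernel_altdef k_def sum_distrib_left by (intro sum.cong refl) simp
        finally show ?thesis by simp
      qed
      also have "\<dots> = (\<Sum>u\<in>Pow {1..s}. \<gamma> u * T u)"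
      proof (intro sum.cong refl arg_cong2[of _ _ _ _ "(*)"])
        fix u
        have "(\<Sum>i\<in>I <+> Z M. \<Sum>j\<in>I <+> Z M. w i * w j * k u (q i) (q j)) =
          (\<Sum>h\<in>I. (\<Sum>h'\<in>I. 1 / N * (1 / N) * k u (p h) (p h')) + (\<Sum>z\<in>Z M. 1 / N * (- 1 / R) * k u (p h) (?g M z))) +
          (\<Sum>z\<in>Z M. (\<Sum>h\<in>I. - 1 / R * (1 / N) * k u (?g M z) (p h)) + (\<Sum>z'\<in>Z M. - 1 / R * (- 1 / R) * k u (?g M z) (?g M z')))"
          using I finZ by (simp add: sum.Plus w_def q_def)
        also have "\<dots> = T u"
          unfolding T_def G_def sum.distrib sum_distrib_left[symmetric] sw sum_divide_distrib[symmetric]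
          using N R by (simp add: field_simps power2_eq_square)
        finally show "(\<Sum>i\<in>I <+> Z M. \<Sum>j\<in>I <+> Z M. w i * w j * k u (q i) (q j)) = T u" .
      qed
      also have "\<dots> = \<gamma> {} * T {} + (\<Sum>u\<in>Pow {1..s} - {{}}. \<gamma> u * T u)"
        by (subst sum.remove[of _ "{}"]) auto
      \<comment> \<open>The constant part of the kernel sees only the total weight, which is
        zero.\<close>
      also have "T {} = 0"
        using N R cardZ by (simp add: T_def G_def k_def N_def[symmetric] power2_eq_square)
      also have "(\<Sum>u\<in>Pow {1..s} - {{}}. \<gamma> u * T u) \<le>
         (\<Sum>u\<in>Pow {1..s} - {{}}. \<gamma> u * ((\<Sum>h\<in>I. \<Sum>h'\<in>I. k u (p h) (p h')) / N\<^sup>2 + 3 * L ^ card u / real (Suc M)))"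
      proof (intro sum_mono mult_left_mono \<gamma>)
        fix u assume u: "u \<in> Pow {1..s} - {{}}"
        have Gb: "\<bar>G u x\<bar> \<le> L ^ card u / real (Suc M)" if "x \<in> cube s" for x
          using grid_average_bound[OF L that, of u M] u unfolding G_def k_def Z_def R_def by simp
        have "\<bar>\<Sum>h\<in>I. G u (p h)\<bar> \<le> (\<Sum>h\<in>I. L ^ card u / real (Suc M))"
          by (intro sum_abs[THEN order_trans] sum_mono Gb p)
        hence 1: "\<bar>(\<Sum>h\<in>I. G u (p h)) / N\<bar> \<le> L ^ card u / real (Suc M)"
          using N by (simp add: N_def field_simps)
        have "\<bar>\<Sum>z\<in>Z M. G u (?g M z)\<bar> \<le> (\<Sum>z\<in>Z M. L ^ card u / real (Suc M))"
          by (intro sum_abs[THEN order_trans] sum_mono Gb g)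
        hence 2: "\<bar>(\<Sum>z\<in>Z M. G u (?g M z)) / R\<bar> \<le> L ^ card u / real (Suc M)"
          using R by (simp add: cardZ field_simps del: of_nat_Suc)
        have "3 * L ^ card u / real (Suc M) = 3 * (L ^ card u / real (Suc M))" by simp
        thus "T u \<le> (\<Sum>h\<in>I. \<Sum>h'\<in>I. k u (p h) (p h')) / N\<^sup>2 + 3 * L ^ card u / real (Suc M)"
          using 1 2 unfolding T_def by linarith
      qed auto
      also have "\<dots> = ?A + D M * inverse (real (Suc M))"
        unfolding D_def k_def N_def by (simp add: sum.distrib distrib_left sum_distrib_right divide_inverse mult.assoc)
      finally show ?thesis by simp
    qed
    hence B: "ip f f * (\<Sum>i\<in>I <+> Z M. \<Sum>j\<in>I <+> Z M. w i * w j * ?K (q i) (q j))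
        \<le> ip f f * (?A + D M * inverse (real (Suc M)))"
      by (rule mult_left_mono) (rule ip_nonneg[OF f])
    have "(\<Sum>i\<in>I <+> Z M. w i * f (q i))\<^sup>2
        \<le> ip f f * (\<Sum>i\<in>I <+> Z M. \<Sum>j\<in>I <+> Z M. w i * w j * ?K (q i) (q j))"
      using p g by (intro weighted_sum_bound fin f) (auto simp: q_def)
    from order.trans[OF this B] show ?thesis unfolding E R_def .
  qed
  have lim1: "(\<lambda>M. ((\<Sum>h\<in>I. f (p h)) / N - (\<Sum>z\<in>Z M. f (?g M z)) / real (Suc M) ^ s)\<^sup>2)
      \<longlonglongrightarrow> ((\<Sum>h\<in>I. f (p h)) / N - cube_integral s f)\<^sup>2"
    unfolding Z_def using \<alpha> by (intro tendsto_intros riemann_sum_tendsto[OF _ H f]) auto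
  have lim2: "(\<lambda>M. ip f f * (?A + D M * inverse (real (Suc M)))) \<longlonglongrightarrow> ip f f * (?A + D 0 * 0)"
    unfolding D_def by (intro tendsto_intros LIMSEQ_inverse_real_of_nat)
  show ?thesis
    using LIMSEQ_le[OF lim1 lim2] main unfolding N_def by (simp only: mult_zero_right add_0_right) blast
qed

section \<open>Digit vectors\<close>

text \<open>The same vectors encode points and Walsh frequencies: position i carries the digit of
  weight \<open>b ^ (-i)\<close> in a point and that of weight \<open>b ^ (i - 1)\<close> in a
  frequency, so characters pair equal positions.\<close>

definition digit_vecs :: "nat \<Rightarrow> nat \<Rightarrow> (nat \<Rightarrow> nat) set" where
  "digit_vecs b n = {1..n} \<rightarrow>\<^sub>E {0..<b}"

definition dval :: "nat \<Rightarrow> nat \<Rightarrow> (nat \<Rightarrow> nat) \<Rightarrow> real" where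
  "dval b n d = (\<Sum>i=1..n. real (d i) / real b ^ i)"

definition dnum :: "nat \<Rightarrow> nat \<Rightarrow> (nat \<Rightarrow> nat) \<Rightarrow> nat" where
  "dnum b n d = (\<Sum>i=1..n. d i * b ^ (n - i))"

definition dadd :: "nat \<Rightarrow> nat \<Rightarrow> (nat \<Rightarrow> nat) \<Rightarrow> (nat \<Rightarrow> nat) \<Rightarrow> (nat \<Rightarrow> nat)" where
  "dadd b n d e = (\<lambda>i\<in>{1..n}. (d i + e i) mod b)"

lemma finite_digit_vecs [simp]: "finite (digit_vecs b n)"
  unfolding digit_vecs_def by (intro finite_PiE) auto

lemma card_digit_vecs: "card (digit_vecs b n) = b ^ n"
  by (simp add: digit_vecs_def card_PiE)

lemma digit_vecs_less: "d \<in> digit_vecs b n \<Longrightarrow> i \<in> {1..n} \<Longrightarrow> d i < b"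
  by (auto simp: digit_vecs_def PiE_iff)

lemma digit_vecs_ext:
  "d \<in> digit_vecs b n \<Longrightarrow> e \<in> digit_vecs b n \<Longrightarrow> (\<And>i. i \<in> {1..n} \<Longrightarrow> d i = e i) \<Longrightarrow> d = e"
  unfolding digit_vecs_def by (rule PiE_ext)

lemma dadd_in: "0 < b \<Longrightarrow> dadd b n d e \<in> digit_vecs b n"
  by (auto simp: dadd_def digit_vecs_def)

lemma dnum_Suc: "dnum b (Suc n) d = b * dnum b n d + d (Suc n)"
proof -
  have "(\<Sum>i=1..n. d i * b ^ (Suc n - i)) = b * dnum b n d"
    unfolding dnum_def sum_distrib_left by (intro sum.cong) (auto simp: Suc_diff_le)
  thus ?thesis by (simp add: dnum_def)
qed

lemma dnum_less: "(\<And>i. i \<in> {1..n} \<Longrightarrow> d i < b) \<Longrightarrow> dnum b n d < b ^ n"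
proof (induction n)
  case (Suc n)
  have "dnum b n d + 1 \<le> b ^ n" using Suc by (simp add: Suc_leI)
  hence "b * (dnum b n d + 1) \<le> b * b ^ n" by (rule mult_le_mono2)
  moreover have "d (Suc n) < b" using Suc.prems by simp
  ultimately show ?case by (simp add: dnum_Suc)
qed (simp add: dnum_def)

lemma dval_eq_dnum:
  assumes "0 < b" shows "dval b n d = real (dnum b n d) / real b ^ n"
proof -
  have "real (d i) / real b ^ i = real (d i * b ^ (n - i)) / real b ^ n" if "i \<in> {1..n}" for i
  proof -
    have "real b ^ n = real b ^ i * real b ^ (n - i)" using that by (simp add: power_add[symmetric])
    thus ?thesis using assms by (simp add: field_simps)
  qed
  thus ?thesis unfolding dval_def dnum_def of_nat_sum sum_divide_distrib by (intro sum.cong) auto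
qed

lemma dval_bounds:
  assumes "0 < b" "d \<in> digit_vecs b n"
  shows "0 \<le> dval b n d" "dval b n d < 1"
proof -
  have "real (dnum b n d) < real (b ^ n)"
    using dnum_less digit_vecs_less[OF assms(2)] by (subst of_nat_less_iff) blast
  thus "0 \<le> dval b n d" "dval b n d < 1" using assms(1) by (simp_all add: dval_eq_dnum)
qed

lemma sums_dval:
  "(\<lambda>i. real (if Suc i \<le> n then d (Suc i) else 0) / real b ^ Suc i) sums dval b n d"
proof -
  have "(\<lambda>i. real (if Suc i \<le> n then d (Suc i) else 0) / real b ^ Suc i) sums
      (\<Sum>i<n. real (if Suc i \<le> n then d (Suc i) else 0) / real b ^ Suc i)"
    by (rule sums_finite) auto
  also have "(\<Sum>i<n. real (if Suc i \<le> n then d (Suc i) else 0) / real b ^ Suc i) = dval b n d"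
    unfolding dval_def One_nat_def sum.atLeast1_atMost_eq by (intro sum.cong) auto
  finally show ?thesis .
qed

text \<open>A terminating digit string continued by zeros has infinitely many digits different from
  b - 1, so it is the expansion selected by \<open>badic_expansion\<close>.\<close>

lemma badic_digit_dval:
  assumes b: "2 \<le> b" and d: "d \<in> digit_vecs b n" and i: "1 \<le> i"
  shows "badic_digit b (dval b n d) i = (if i \<le> n then d i else 0)"
proof -
  have "{i. i \<ge> 1 \<and> (if i \<le> n then d i else 0) \<noteq> b - 1} \<supseteq> {n<..}" using b by auto
  hence "infinite {i. i \<ge> 1 \<and> (if i \<le> n then d i else 0) \<noteq> b - 1}"
    using infinite_Ioi infinite_super by blast
  hence "badic_expansion b (dval b n d) (\<lambda>i. if i \<le> n then d i else 0)"
    unfolding badic_expansion_def using sums_dval[of n d b] digit_vecs_less[OF d] b by auto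
  thus ?thesis using badic_expansion_iff[OF b, of "dval b n d"] dval_bounds[of b d n] b d i by auto
qed

lemma digit_add_dval:
  assumes b: "2 \<le> b" and "d \<in> digit_vecs b n" "e \<in> digit_vecs b n"
  shows "digit_add b (dval b n d) (dval b n e) = dval b n (dadd b n d e)"
proof -
  have "(\<lambda>i. real ((badic_digit b (dval b n d) (Suc i) + badic_digit b (dval b n e) (Suc i)) mod b) / real b ^ Suc i)
      = (\<lambda>i. real (if Suc i \<le> n then dadd b n d e (Suc i) else 0) / real b ^ Suc i)"
    using assms by (intro ext) (simp add: badic_digit_dval dadd_def)
  thus ?thesis unfolding digit_add_def using sums_unique[OF sums_dval[of n "dadd b n d e" b]] by simp
qed

text \<open>The digits can be read off from \<open>dval b n d\<close>, which is the integer divided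
  by \<open>b ^ n\<close>.\<close>

lemma inj_on_dnum: assumes "2 \<le> b" shows "inj_on (dnum b n) (digit_vecs b n)"
proof (rule inj_onI)
  fix d e assume d: "d \<in> digit_vecs b n" and e: "e \<in> digit_vecs b n" and eq: "dnum b n d = dnum b n e"
  have "dval b n d = dval b n e" using eq assms by (simp add: dval_eq_dnum)
  thus "d = e"
    using badic_digit_dval[OF assms d] badic_digit_dval[OF assms e]
    by (intro digit_vecs_ext[OF d e]) (metis atLeastAtMost_iff)
qed

lemma bij_betw_dnum: assumes "2 \<le> b" shows "bij_betw (dnum b n) (digit_vecs b n) {..<b ^ n}"
proof -
  have "dnum b n ` digit_vecs b n \<subseteq> {..<b ^ n}" using dnum_less digit_vecs_less by blast
  moreover have "card (dnum b n ` digit_vecs b n) = card {..<b ^ n}"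
    using card_image[OF inj_on_dnum[OF assms]] by (simp add: card_digit_vecs)
  ultimately have "dnum b n ` digit_vecs b n = {..<b ^ n}" by (intro card_subset_eq) auto
  thus ?thesis using inj_on_dnum[OF assms] by (simp add: bij_betw_def)
qed

lemma sum_dval:
  assumes "2 \<le> b"
  shows "(\<Sum>d\<in>digit_vecs b n. f (dval b n d)) = (\<Sum>i<b ^ n. f (real i / real b ^ n))"
  using sum.reindex_bij_betw[OF bij_betw_dnum[OF assms], of "\<lambda>i. f (real i / real b ^ n)" n] assms
  by (simp add: dval_eq_dnum)

lemma mod_eq_iff_int_dvd: "x mod b = y mod b \<longleftrightarrow> int b dvd int x - int y" for x y b :: nat
  by (metis mod_eq_dvd_iff of_nat_eq_iff zmod_int)

lemma int_dvd_diff_imp_eq: "x < b \<Longrightarrow> y < b \<Longrightarrow> int b dvd int x - int y \<Longrightarrow> x = y" for x y b :: nat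
  using mod_eq_iff_int_dvd[of x b y] by simp

lemma bij_betw_dadd:
  assumes "0 < b" shows "bij_betw (dadd b n d) (digit_vecs b n) (digit_vecs b n)"
proof -
  have "inj_on (dadd b n d) (digit_vecs b n)"
  proof (rule inj_onI)
    fix e f assume e: "e \<in> digit_vecs b n" and f: "f \<in> digit_vecs b n" and eq: "dadd b n d e = dadd b n d f"
    show "e = f"
    proof (rule digit_vecs_ext[OF e f])
      fix i assume i: "i \<in> {1..n}"
      have "(d i + e i) mod b = (d i + f i) mod b" using fun_cong[OF eq, of i] i by (simp add: dadd_def)
      hence "int b dvd int (e i) - int (f i)" by (simp add: mod_eq_iff_int_dvd)
      thus "e i = f i" using digit_vecs_less[OF e i] digit_vecs_less[OF f i] by (intro int_dvd_diff_imp_eq)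
    qed
  qed
  moreover have "dadd b n d ` digit_vecs b n \<subseteq> digit_vecs b n" using dadd_in[OF assms] by blast
  ultimately show ?thesis using endo_inj_surj[OF finite_digit_vecs] by (simp add: bij_betw_def)
qed

section \<open>Characters\<close>

text \<open>The additive character of the integers modulo b. Integer arguments keep differences of
  digits free of truncated subtraction.\<close>

definition uroot :: "nat \<Rightarrow> int \<Rightarrow> complex" where
  "uroot b z = cis (2 * pi * real_of_int z / real b)"

lemma uroot_0 [simp]: "uroot b 0 = 1" by (simp add: uroot_def)

lemma uroot_add: "uroot b (x + y) = uroot b x * uroot b y"
  by (simp add: uroot_def cis_mult add_divide_distrib distrib_left)

lemma uroot_sum: "uroot b (\<Sum>i\<in>A. f i) = (\<Prod>i\<in>A. uroot b (f i))"
  by (induction A rule: infinite_finite_induct) (simp_all add: uroot_add)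

lemma norm_uroot [simp]: "norm (uroot b z) = 1" by (simp add: uroot_def)

lemma cnj_uroot: "cnj (uroot b z) = uroot b (- z)" by (simp add: uroot_def cis_cnj)

lemma uroot_nat_mult: "uroot b (int c * z) = uroot b z ^ c"
  unfolding uroot_def Complex.DeMoivre by (rule arg_cong[of _ _ cis]) simp

lemma uroot_of_nat_eq_1: assumes "0 < b" shows "uroot b (int j) = 1 \<longleftrightarrow> b dvd j"
proof -
  have "uroot b (int j) = exp (2 * of_real pi * \<i> * of_nat j / of_nat b)"
    unfolding uroot_def cis_conv_exp by (rule arg_cong[of _ _ exp]) (simp add: mult_ac)
  thus ?thesis using complex_root_unity_eq_1[of b j] assms by simp
qed

lemma uroot_eq_1: assumes "0 < b" shows "uroot b z = 1 \<longleftrightarrow> int b dvd z"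
proof (cases "0 \<le> z")
  case True
  thus ?thesis using uroot_of_nat_eq_1[OF assms, of "nat z"] by (simp add: int_dvd_int_iff[symmetric])
next
  case False
  have "uroot b z = 1 \<longleftrightarrow> uroot b (- z) = 1" by (metis cnj_uroot complex_cnj_cnj complex_cnj_one)
  thus ?thesis using uroot_of_nat_eq_1[OF assms, of "nat (- z)"] False by (simp add: int_dvd_int_iff[symmetric])
qed

lemma uroot_cong:
  assumes "0 < b" "int b dvd x - y" shows "uroot b x = uroot b y"
  using uroot_add[of b "x - y" y] uroot_eq_1[OF assms(1), of "x - y"] assms(2) by simp

lemma sum_uroot:
  assumes "0 < b"
  shows "(\<Sum>c\<in>{0..<b}. uroot b (int c * z)) = (if int b dvd z then of_nat b else 0)"
proof -
  have "uroot b z ^ b = 1" using uroot_nat_mult[of b b z] uroot_eq_1[OF assms, of "int b * z"] by simp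
  thus ?thesis
    unfolding uroot_nat_mult atLeast0LessThan sum_gp_strict using uroot_eq_1[OF assms, of z] by simp
qed

lemma sum_uroot_PiE:
  assumes "0 < b" "finite S"
  shows "(\<Sum>k\<in>S \<rightarrow>\<^sub>E {0..<b}. uroot b (\<Sum>i\<in>S. int (k i) * z i)) =
         (if \<forall>i\<in>S. int b dvd z i then of_nat b ^ card S else 0)"
proof -
  have "(\<Sum>k\<in>S \<rightarrow>\<^sub>E {0..<b}. uroot b (\<Sum>i\<in>S. int (k i) * z i)) = (\<Prod>i\<in>S. \<Sum>c\<in>{0..<b}. uroot b (int c * z i))"
    unfolding uroot_sum using assms by (intro prod_sum_PiE[symmetric]) auto
  also have "\<dots> = (\<Prod>i\<in>S. if int b dvd z i then of_nat b else 0)"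
    by (simp add: sum_uroot[OF assms(1)])
  also have "\<dots> = (if \<forall>i\<in>S. int b dvd z i then of_nat b ^ card S else 0)"
    using assms(2) by (auto intro!: prod_zero)
  finally show ?thesis .
qed

text \<open>The diagonal Walsh coefficient of the kernel \<open>g\<close> restricted to the grid of \<open>n\<close>-digit points.\<close>

definition walsh_coeff :: "nat \<Rightarrow> nat \<Rightarrow> (real \<Rightarrow> real \<Rightarrow> real) \<Rightarrow> (nat \<Rightarrow> nat) \<Rightarrow> complex" where
  "walsh_coeff b n g k =
     (\<Sum>d\<in>digit_vecs b n. \<Sum>e\<in>digit_vecs b n.
        of_real (g (dval b n d) (dval b n e)) * uroot b (\<Sum>i=1..n. int (k i) * (int (e i) - int (d i))))
     / of_nat b ^ (2 * n)"

text \<open>Summation over all frequencies \<open>k\<close> selects by orthogonality the pairs (d,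
  e) with the same digitwise difference as (\<open>d0\<close>, \<open>e0\<close>). These pairs are
  exactly the common shifts of (\<open>d0\<close>, \<open>e0\<close>), so only diagonal coefficients
  survive the average.\<close>

lemma shift_average_eq:
  assumes b: "0 < b" and d0: "d0 \<in> digit_vecs b n" and e0: "e0 \<in> digit_vecs b n"
  shows "of_real ((\<Sum>\<sigma>\<in>digit_vecs b n. g (dval b n (dadd b n d0 \<sigma>)) (dval b n (dadd b n e0 \<sigma>))) / real b ^ n) =
    (\<Sum>k\<in>digit_vecs b n. walsh_coeff b n g k * uroot b (\<Sum>i=1..n. int (k i) * (int (d0 i) - int (e0 i))))"
proof -
  let ?G = "digit_vecs b n"
  define h where "h d e = (of_real (g (dval b n d) (dval b n e)) :: complex)" for d e
  define z where "z d e i = int (e i) - int (d i) + (int (d0 i) - int (e0 i))" for d e :: "nat \<Rightarrow> nat" and i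
  have B: "(of_nat b :: complex) \<noteq> 0" using b by simp
  have delta: "(\<forall>i\<in>{1..n}. int b dvd z (dadd b n d0 \<sigma>) e i) \<longleftrightarrow> e = dadd b n e0 \<sigma>"
    if \<sigma>: "\<sigma> \<in> ?G" and e: "e \<in> ?G" for \<sigma> e
  proof -
    have *: "int b dvd z (dadd b n d0 \<sigma>) e i \<longleftrightarrow> e i = dadd b n e0 \<sigma> i" if i: "i \<in> {1..n}" for i
    proof -
      have "int b dvd int (dadd b n d0 \<sigma> i) - int (d0 i + \<sigma> i)"
        unfolding mod_eq_iff_int_dvd[symmetric] using i by (simp add: dadd_def)
      hence "int b dvd z (dadd b n d0 \<sigma>) e i \<longleftrightarrow>
          int b dvd z (dadd b n d0 \<sigma>) e i + (int (dadd b n d0 \<sigma> i) - int (d0 i + \<sigma> i))"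
        by (simp add: dvd_add_left_iff)
      also have "z (dadd b n d0 \<sigma>) e i + (int (dadd b n d0 \<sigma> i) - int (d0 i + \<sigma> i)) = int (e i) - int (e0 i + \<sigma> i)"
        by (simp add: z_def)
      also have "int b dvd \<dots> \<longleftrightarrow> e i mod b = (e0 i + \<sigma> i) mod b" by (rule mod_eq_iff_int_dvd[symmetric])
      also have "\<dots> \<longleftrightarrow> e i = dadd b n e0 \<sigma> i" using digit_vecs_less[OF e i] i by (simp add: dadd_def)
      finally show ?thesis .
    qed
    show ?thesis using * digit_vecs_ext[OF e dadd_in[OF b]] by auto
  qed
  have "(\<Sum>k\<in>?G. walsh_coeff b n g k * uroot b (\<Sum>i=1..n. int (k i) * (int (d0 i) - int (e0 i)))) * of_nat b ^ (2 * n)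
     = (\<Sum>k\<in>?G. (\<Sum>d\<in>?G. \<Sum>e\<in>?G. h d e * uroot b (\<Sum>i=1..n. int (k i) * (int (e i) - int (d i))))
          * uroot b (\<Sum>i=1..n. int (k i) * (int (d0 i) - int (e0 i))))"
    unfolding walsh_coeff_def h_def sum_distrib_right[of _ ?G "of_nat b ^ (2 * n)"]
    using B by (intro sum.cong refl) simp
  also have "\<dots> = (\<Sum>k\<in>?G. \<Sum>d\<in>?G. \<Sum>e\<in>?G. h d e * uroot b (\<Sum>i=1..n. int (k i) * z d e i))"
    unfolding sum_distrib_right z_def distrib_left sum.distrib uroot_add by (simp only: mult.assoc)
  also have "\<dots> = (\<Sum>d\<in>?G. \<Sum>k\<in>?G. \<Sum>e\<in>?G. h d e * uroot b (\<Sum>i=1..n. int (k i) * z d e i))"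
    by (rule sum.swap)
  also have "\<dots> = (\<Sum>d\<in>?G. \<Sum>e\<in>?G. \<Sum>k\<in>?G. h d e * uroot b (\<Sum>i=1..n. int (k i) * z d e i))"
    by (intro sum.cong refl sum.swap)
  also have "\<dots> = (\<Sum>d\<in>?G. \<Sum>e\<in>?G. h d e * (if \<forall>i\<in>{1..n}. int b dvd z d e i then of_nat b ^ n else 0))"
    unfolding sum_distrib_left[symmetric] digit_vecs_def sum_uroot_PiE[OF b finite_atLeastAtMost]
    by (simp only: card_atLeastAtMost diff_Suc_1)
  also have "\<dots> = (\<Sum>\<sigma>\<in>?G. \<Sum>e\<in>?G. h (dadd b n d0 \<sigma>) e *
      (if \<forall>i\<in>{1..n}. int b dvd z (dadd b n d0 \<sigma>) e i then of_nat b ^ n else 0))"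
    by (rule sum.reindex_bij_betw[OF bij_betw_dadd[OF b], symmetric])
  also have "\<dots> = (\<Sum>\<sigma>\<in>?G. \<Sum>e\<in>?G. if e = dadd b n e0 \<sigma> then h (dadd b n d0 \<sigma>) (dadd b n e0 \<sigma>) * of_nat b ^ n else 0)"
  proof (intro sum.cong refl)
    fix \<sigma> e assume "\<sigma> \<in> ?G" "e \<in> ?G"
    note d = delta[OF this]
    show "h (dadd b n d0 \<sigma>) e * (if \<forall>i\<in>{1..n}. int b dvd z (dadd b n d0 \<sigma>) e i then of_nat b ^ n else 0) =
      (if e = dadd b n e0 \<sigma> then h (dadd b n d0 \<sigma>) (dadd b n e0 \<sigma>) * of_nat b ^ n else 0)"
      unfolding d by simp
  qed
  also have "\<dots> = (\<Sum>\<sigma>\<in>?G. h (dadd b n d0 \<sigma>) (dadd b n e0 \<sigma>)) * of_nat b ^ n"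
    by (simp add: sum_distrib_right dadd_in[OF b])
  finally have "(\<Sum>k\<in>?G. walsh_coeff b n g k * uroot b (\<Sum>i=1..n. int (k i) * (int (d0 i) - int (e0 i)))) =
      (\<Sum>\<sigma>\<in>?G. h (dadd b n d0 \<sigma>) (dadd b n e0 \<sigma>)) / of_nat b ^ n"
    using B by (simp add: field_simps power_mult power2_eq_square power_add mult_2)
  thus ?thesis by (simp add: h_def)
qed

section \<open>Digital nets and their duals\<close>

lemma digits_eq_imp_eq:
  assumes "0 < b" "h < b ^ m" "h' < b ^ m" "\<And>k. k < m \<Longrightarrow> h div b ^ k mod b = h' div b ^ k mod b"
  shows "h = (h' :: nat)"
  using assms(2-)
proof (induction m arbitrary: h h')
  case (Suc m)
  have "h div b = h' div b"
  proof (rule Suc.IH)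
    show "h div b < b ^ m" "h' div b < b ^ m" using Suc.prems by (auto simp: less_mult_imp_div_less mult.commute)
    show "h div b div b ^ k mod b = h' div b div b ^ k mod b" if "k < m" for k
      using Suc.prems(3)[of "Suc k"] that by (simp add: div_mult2_eq)
  qed
  moreover have "h mod b = h' mod b" using Suc.prems(3)[of 0] by simp
  ultimately show ?case by (metis div_mult_mod_eq)
qed simp

lemma bij_betw_digits:
  assumes "0 < (b :: nat)"
  shows "bij_betw (\<lambda>h. \<lambda>k\<in>{..<m}. h div b ^ k mod b) {0..<b ^ m} ({..<m} \<rightarrow>\<^sub>E {0..<b})"
proof -
  let ?f = "\<lambda>h. \<lambda>k\<in>{..<m}. h div b ^ k mod b"
  have inj: "inj_on ?f {0..<b ^ m}"
  proof (rule inj_onI)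
    fix h h' assume "h \<in> {0..<b ^ m}" "h' \<in> {0..<b ^ m}" and eq: "?f h = ?f h'"
    moreover have "h div b ^ k mod b = h' div b ^ k mod b" if "k < m" for k
      using fun_cong[OF eq, of k] that by simp
    ultimately show "h = h'" using digits_eq_imp_eq[OF assms, of h m h'] by auto
  qed
  moreover have "?f ` {0..<b ^ m} \<subseteq> {..<m} \<rightarrow>\<^sub>E {0..<b}" using assms by (auto simp: PiE_iff split: if_splits)
  moreover have "card (?f ` {0..<b ^ m}) = card ({..<m} \<rightarrow>\<^sub>E {0..<b})"
    using card_image[OF inj] by (simp add: card_PiE)
  moreover have "finite ({..<m} \<rightarrow>\<^sub>E {0..<b})" by (intro finite_PiE) auto
  ultimately show ?thesis using card_subset_eq unfolding bij_betw_def by blast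
qed

definition net_vec :: "nat \<Rightarrow> nat \<Rightarrow> nat \<Rightarrow> (nat \<Rightarrow> nat \<Rightarrow> nat \<Rightarrow> nat) \<Rightarrow> nat \<Rightarrow> nat \<Rightarrow> (nat \<Rightarrow> nat)" where
  "net_vec b n m C h j = (\<lambda>i\<in>{1..n}. net_digit b m C i h j)"

lemma net_vec_in: "0 < b \<Longrightarrow> net_vec b n m C h j \<in> digit_vecs b n"
  by (auto simp: net_vec_def digit_vecs_def net_digit_def)

lemma net_point_eq: "net_point b n m s C h = (\<lambda>j\<in>{1..s}. dval b n (net_vec b n m C h j))"
  by (auto simp: net_point_def dval_def net_vec_def fun_eq_iff intro!: sum.cong)

text \<open>The m congruences express that the transposed matrices annihilate the frequency.
  Frequencies are indexed by \<open>u\<close> alone, which amounts to zero components outside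
  \<open>u\<close>.\<close>

definition dual_net :: "nat \<Rightarrow> nat \<Rightarrow> nat \<Rightarrow> (nat \<Rightarrow> nat \<Rightarrow> nat \<Rightarrow> nat) \<Rightarrow> nat set \<Rightarrow> (nat \<Rightarrow> nat \<Rightarrow> nat) set" where
  "dual_net b n m C u = {\<kappa> \<in> u \<rightarrow>\<^sub>E digit_vecs b n. \<forall>k<m. b dvd (\<Sum>j\<in>u. \<Sum>i=1..n. \<kappa> j i * C j i k)}"

text \<open>Modulo b the exponent is a linear form in the digits of h, with coefficients
  \<open>z k\<close>. As h varies, its digits run through all vectors, so the sum vanishes unless
  all coefficients do.\<close>

lemma net_character_sum:
  assumes b: "0 < b"
  shows "(\<Sum>h\<in>{0..<b ^ m}. uroot b (\<Sum>j\<in>u. \<Sum>i=1..n. int (\<kappa> j i) * int (net_vec b n m C h j i))) =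
    (if \<forall>k<m. b dvd (\<Sum>j\<in>u. \<Sum>i=1..n. \<kappa> j i * C j i k) then of_nat b ^ m else 0)"
proof -
  define z where "z k = (\<Sum>j\<in>u. \<Sum>i=1..n. int (\<kappa> j i) * int (C j i k))" for k
  have "uroot b (\<Sum>j\<in>u. \<Sum>i=1..n. int (\<kappa> j i) * int (net_vec b n m C h j i)) =
        uroot b (\<Sum>k\<in>{..<m}. int ((\<lambda>k\<in>{..<m}. h div b ^ k mod b) k) * z k)" for h
  proof (rule uroot_cong[OF b])
    have "(\<Sum>k\<in>{..<m}. int ((\<lambda>k\<in>{..<m}. h div b ^ k mod b) k) * z k) =
       (\<Sum>k<m. \<Sum>j\<in>u. \<Sum>i=1..n. int (\<kappa> j i) * (int (C j i k) * int (h div b ^ k mod b)))"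
      unfolding z_def sum_distrib_left by (intro sum.cong refl) (simp add: mult_ac)
    also have "\<dots> = (\<Sum>j\<in>u. \<Sum>k<m. \<Sum>i=1..n. int (\<kappa> j i) * (int (C j i k) * int (h div b ^ k mod b)))"
      by (rule sum.swap)
    also have "\<dots> = (\<Sum>j\<in>u. \<Sum>i=1..n. \<Sum>k<m. int (\<kappa> j i) * (int (C j i k) * int (h div b ^ k mod b)))"
      by (intro sum.cong refl sum.swap)
    also have "\<dots> = (\<Sum>j\<in>u. \<Sum>i=1..n. int (\<kappa> j i) * int (\<Sum>k<m. C j i k * (h div b ^ k mod b)))"
      by (simp add: sum_distrib_left)
    finally have "(\<Sum>j\<in>u. \<Sum>i=1..n. int (\<kappa> j i) * int (net_vec b n m C h j i)) -
        (\<Sum>k\<in>{..<m}. int ((\<lambda>k\<in>{..<m}. h div b ^ k mod b) k) * z k) =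
        (\<Sum>j\<in>u. \<Sum>i=1..n. int (\<kappa> j i) * (int (net_vec b n m C h j i) - int (\<Sum>k<m. C j i k * (h div b ^ k mod b))))"
      by (simp only: right_diff_distrib sum_subtractf)
    moreover have "int b dvd (int (net_vec b n m C h j i) - int (\<Sum>k<m. C j i k * (h div b ^ k mod b)))"
      if "i \<in> {1..n}" for j i
      unfolding mod_eq_iff_int_dvd[symmetric] using that by (simp add: net_vec_def net_digit_def)
    ultimately show "int b dvd (\<Sum>j\<in>u. \<Sum>i=1..n. int (\<kappa> j i) * int (net_vec b n m C h j i)) -
        (\<Sum>k\<in>{..<m}. int ((\<lambda>k\<in>{..<m}. h div b ^ k mod b) k) * z k)"
      by (simp only:) (intro dvd_sum dvd_mult)
  qed
  hence "(\<Sum>h\<in>{0..<b ^ m}. uroot b (\<Sum>j\<in>u. \<Sum>i=1..n. int (\<kappa> j i) * int (net_vec b n m C h j i))) =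
      (\<Sum>\<eta>\<in>{..<m} \<rightarrow>\<^sub>E {0..<b}. uroot b (\<Sum>k\<in>{..<m}. int (\<eta> k) * z k))"
    by (simp only: sum.reindex_bij_betw[OF bij_betw_digits[OF b], of "\<lambda>\<eta>. uroot b (\<Sum>k\<in>{..<m}. int (\<eta> k) * z k)" m])
  also have "\<dots> = (if \<forall>k\<in>{..<m}. int b dvd z k then of_nat b ^ m else 0)"
    using sum_uroot_PiE[OF b, of "{..<m}" z] by simp
  also have "(\<forall>k\<in>{..<m}. int b dvd z k) \<longleftrightarrow> (\<forall>k<m. b dvd (\<Sum>j\<in>u. \<Sum>i=1..n. \<kappa> j i * C j i k))"
    unfolding z_def int_dvd_int_iff[symmetric] by (auto simp: of_nat_sum)
  finally show ?thesis .
qed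

text \<open>After expansion the sums over h and h' separate into \<open>S \<kappa>\<close> and its
  conjugate. Their product is \<open>b ^ (2 * m)\<close> on the dual net and zero elsewhere; the
  triangle inequality does the rest.\<close>

lemma net_kernel_average_bound:
  assumes b: "0 < b" and u: "finite u"
  shows "\<bar>\<Sum>h\<in>{0..<b ^ m}. \<Sum>h'\<in>{0..<b ^ m}. \<Prod>j\<in>u.
      (\<Sum>\<sigma>\<in>digit_vecs b n. g (dval b n (dadd b n (net_vec b n m C h j) \<sigma>)) (dval b n (dadd b n (net_vec b n m C h' j) \<sigma>))) / real b ^ n\<bar>
      \<le> real b ^ (2 * m) * (\<Sum>\<kappa>\<in>dual_net b n m C u. \<Prod>j\<in>u. norm (walsh_coeff b n g (\<kappa> j)))"
proof -
  let ?G = "digit_vecs b n" and ?H = "{0..<b ^ m}"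
  let ?D = "net_vec b n m C"
  let ?w = "walsh_coeff b n g"
  define S where "S \<kappa> = (\<Sum>h\<in>?H. uroot b (\<Sum>j\<in>u. \<Sum>i=1..n. int (\<kappa> j i) * int (?D h j i)))" for \<kappa>
  define T where "T h h' = (\<Prod>j\<in>u. (\<Sum>\<sigma>\<in>?G. g (dval b n (dadd b n (?D h j) \<sigma>)) (dval b n (dadd b n (?D h' j) \<sigma>))) / real b ^ n)" for h h'
  have fin: "finite (u \<rightarrow>\<^sub>E ?G)" using u by (intro finite_PiE) auto
  have T: "of_real (T h h') = (\<Sum>\<kappa>\<in>u \<rightarrow>\<^sub>E ?G. (\<Prod>j\<in>u. ?w (\<kappa> j)) *
      (uroot b (\<Sum>j\<in>u. \<Sum>i=1..n. int (\<kappa> j i) * int (?D h j i)) *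
       cnj (uroot b (\<Sum>j\<in>u. \<Sum>i=1..n. int (\<kappa> j i) * int (?D h' j i)))))" for h h'
  proof -
    have "of_real (T h h') = (\<Prod>j\<in>u. \<Sum>k\<in>?G. ?w k * uroot b (\<Sum>i=1..n. int (k i) * (int (?D h j i) - int (?D h' j i))))"
      unfolding T_def of_real_prod by (intro prod.cong refl shift_average_eq b net_vec_in)
    also have "\<dots> = (\<Sum>\<kappa>\<in>u \<rightarrow>\<^sub>E ?G. \<Prod>j\<in>u. ?w (\<kappa> j) * uroot b (\<Sum>i=1..n. int (\<kappa> j i) * (int (?D h j i) - int (?D h' j i))))"
      using u by (intro prod_sum_PiE) auto
    also have "\<dots> = (\<Sum>\<kappa>\<in>u \<rightarrow>\<^sub>E ?G. (\<Prod>j\<in>u. ?w (\<kappa> j)) *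
        uroot b ((\<Sum>j\<in>u. \<Sum>i=1..n. int (\<kappa> j i) * int (?D h j i)) + - (\<Sum>j\<in>u. \<Sum>i=1..n. int (\<kappa> j i) * int (?D h' j i))))"
      unfolding prod.distrib uroot_sum[symmetric] by (simp only: right_diff_distrib sum_subtractf add_uminus_conv_diff)
    finally show ?thesis by (simp only: uroot_add cnj_uroot)
  qed
  have "complex_of_real (\<Sum>h\<in>?H. \<Sum>h'\<in>?H. T h h') =
     (\<Sum>h\<in>?H. \<Sum>h'\<in>?H. \<Sum>\<kappa>\<in>u \<rightarrow>\<^sub>E ?G. (\<Prod>j\<in>u. ?w (\<kappa> j)) *
      (uroot b (\<Sum>j\<in>u. \<Sum>i=1..n. int (\<kappa> j i) * int (?D h j i)) *
       cnj (uroot b (\<Sum>j\<in>u. \<Sum>i=1..n. int (\<kappa> j i) * int (?D h' j i)))))"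
    unfolding of_real_sum T ..
  also have "\<dots> = (\<Sum>h\<in>?H. \<Sum>\<kappa>\<in>u \<rightarrow>\<^sub>E ?G. \<Sum>h'\<in>?H. (\<Prod>j\<in>u. ?w (\<kappa> j)) *
      (uroot b (\<Sum>j\<in>u. \<Sum>i=1..n. int (\<kappa> j i) * int (?D h j i)) *
       cnj (uroot b (\<Sum>j\<in>u. \<Sum>i=1..n. int (\<kappa> j i) * int (?D h' j i)))))"
    by (intro sum.cong refl sum.swap)
  also have "\<dots> = (\<Sum>\<kappa>\<in>u \<rightarrow>\<^sub>E ?G. \<Sum>h\<in>?H. \<Sum>h'\<in>?H. (\<Prod>j\<in>u. ?w (\<kappa> j)) *
      (uroot b (\<Sum>j\<in>u. \<Sum>i=1..n. int (\<kappa> j i) * int (?D h j i)) *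
       cnj (uroot b (\<Sum>j\<in>u. \<Sum>i=1..n. int (\<kappa> j i) * int (?D h' j i)))))"
    by (rule sum.swap)
  also have "\<dots> = (\<Sum>\<kappa>\<in>u \<rightarrow>\<^sub>E ?G. (\<Prod>j\<in>u. ?w (\<kappa> j)) * (S \<kappa> * cnj (S \<kappa>)))"
    unfolding S_def cnj_sum sum_product by (simp only: sum_distrib_left)
  also have "\<dots> = (\<Sum>\<kappa>\<in>dual_net b n m C u. (\<Prod>j\<in>u. ?w (\<kappa> j)) * of_real (real b ^ (2 * m)))"
  proof (rule sum.mono_neutral_cong_right[OF fin])
    show "dual_net b n m C u \<subseteq> (u \<rightarrow>\<^sub>E ?G)" by (auto simp: dual_net_def)
    show "\<forall>\<kappa>\<in>(u \<rightarrow>\<^sub>E ?G) - dual_net b n m C u. (\<Prod>j\<in>u. ?w (\<kappa> j)) * (S \<kappa> * cnj (S \<kappa>)) = 0"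
      unfolding S_def net_character_sum[OF b] by (auto simp: dual_net_def)
    show "(\<Prod>j\<in>u. ?w (\<kappa> j)) * (S \<kappa> * cnj (S \<kappa>)) = (\<Prod>j\<in>u. ?w (\<kappa> j)) * of_real (real b ^ (2 * m))"
      if "\<kappa> \<in> dual_net b n m C u" for \<kappa>
      using that unfolding S_def net_character_sum[OF b] by (simp add: dual_net_def mult_2 power_add)
  qed
  finally have "norm (complex_of_real (\<Sum>h\<in>?H. \<Sum>h'\<in>?H. T h h')) =
     norm (\<Sum>\<kappa>\<in>dual_net b n m C u. (\<Prod>j\<in>u. ?w (\<kappa> j)) * complex_of_real (real b ^ (2 * m)))"
    by (rule arg_cong)
  also have "\<dots> \<le> (\<Sum>\<kappa>\<in>dual_net b n m C u. norm ((\<Prod>j\<in>u. ?w (\<kappa> j)) * complex_of_real (real b ^ (2 * m))))"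
    by (rule norm_sum)
  also have "\<dots> = real b ^ (2 * m) * (\<Sum>\<kappa>\<in>dual_net b n m C u. \<Prod>j\<in>u. norm (?w (\<kappa> j)))"
    unfolding norm_mult prod_norm[symmetric] norm_of_real sum_distrib_left by (simp add: mult.commute)
  finally show ?thesis unfolding T_def norm_of_real .
qed

section \<open>Iterated differences\<close>

fun dif :: "real list \<Rightarrow> (real \<Rightarrow> real) \<Rightarrow> real \<Rightarrow> real" where
  "dif [] f x = f x"
| "dif (h # hs) f x = dif hs f (x + h) - dif hs f x"

text \<open>The sums of the negative and of the positive steps are the extreme subsums of the list,
  so the condition places every evaluation point of the iterated difference in the interval.\<close>

definition in_window :: "real \<Rightarrow> real \<Rightarrow> real list \<Rightarrow> real \<Rightarrow> bool" where
  "in_window lo hi hs x \<longleftrightarrow> lo \<le> x + (\<Sum>h\<leftarrow>hs. min 0 h) \<and> x + (\<Sum>h\<leftarrow>hs. max 0 h) \<le> hi"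

lemma in_window_Cons:
  assumes "in_window lo hi (h # hs) x"
  shows "in_window lo hi hs x" "in_window lo hi hs (x + h)"
    "y \<in> closed_segment x (x + h) \<Longrightarrow> in_window lo hi hs y"
  using assms by (auto simp: in_window_def min_def max_def closed_segment_eq_real_ivl split: if_splits)

lemma in_window_subset: "in_window lo hi hs x \<Longrightarrow> x \<in> {lo..hi}"
proof -
  have "(\<Sum>h\<leftarrow>hs. min 0 h) \<le> (0 :: real)" "(0 :: real) \<le> (\<Sum>h\<leftarrow>hs. max 0 h)"
    by (induction hs) auto
  thus "in_window lo hi hs x \<Longrightarrow> x \<in> {lo..hi}" by (auto simp: in_window_def)
qed

lemma dif_append: "dif hs (\<lambda>t. dif hs' f (c + t)) x = dif (hs @ hs') f (c + x)"
  by (induction hs arbitrary: x) (simp_all add: add.assoc)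

lemma DERIV_dif:
  assumes "\<And>y. y \<in> {lo..hi} \<Longrightarrow> (f has_field_derivative f' y) (at y)" "in_window lo hi hs x"
  shows "(dif hs f has_field_derivative dif hs f' x) (at x)"
  using assms(2)
proof (induction hs arbitrary: x)
  case Nil
  thus ?case using assms(1) by (simp add: in_window_def)
next
  case (Cons h hs)
  have "((\<lambda>x. dif hs f (x + h)) has_field_derivative dif hs f' (x + h)) (at x)"
    using Cons.IH[OF in_window_Cons(2)[OF Cons.prems]] by (simp add: DERIV_shift)
  thus ?case using Cons.IH[OF in_window_Cons(1)[OF Cons.prems]] by (simp add: DERIV_diff)
qed

text \<open>Mean value inequality on the segment covered by the step: one derivative is exchanged
  for one factor |h|.\<close>

lemma dif_Cons_bound:
  assumes "\<And>y. y \<in> {lo..hi} \<Longrightarrow> (f has_field_derivative f' y) (at y)"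
    and "\<And>y. in_window lo hi hs y \<Longrightarrow> \<bar>dif hs f' y\<bar> \<le> M" and w: "in_window lo hi (h # hs) x"
  shows "\<bar>dif (h # hs) f x\<bar> \<le> M * \<bar>h\<bar>"
proof -
  have "norm (dif hs f (x + h) - dif hs f x) \<le> M * norm (x + h - x)"
  proof (rule field_differentiable_bound[of "closed_segment x (x + h)"])
    fix y assume y: "y \<in> closed_segment x (x + h)"
    show "(dif hs f has_field_derivative dif hs f' y) (at y within closed_segment x (x + h))"
      using DERIV_dif[OF assms(1) in_window_Cons(3)[OF w y]] has_field_derivative_at_within by blast
    show "norm (dif hs f' y) \<le> M" using assms(2)[OF in_window_Cons(3)[OF w y]] by simp
  qed auto
  thus ?thesis by simp
qed

lemma dif_bound:
  assumes "\<And>i y. i < length hs \<Longrightarrow> y \<in> {lo..hi} \<Longrightarrow> (F i has_field_derivative F (Suc i) y) (at y)"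
    and "\<And>y. y \<in> {lo..hi} \<Longrightarrow> \<bar>F (length hs) y\<bar> \<le> M" and "in_window lo hi hs x"
  shows "\<bar>dif hs (F 0) x\<bar> \<le> M * (\<Prod>h\<leftarrow>hs. \<bar>h\<bar>)"
  using assms
proof (induction hs arbitrary: F x)
  case Nil
  thus ?case using in_window_subset[OF Nil(3)] by simp
next
  case (Cons h hs)
  have "\<bar>dif hs (F (Suc 0)) y\<bar> \<le> M * (\<Prod>h\<leftarrow>hs. \<bar>h\<bar>)" if "in_window lo hi hs y" for y
    using Cons.IH[of "\<lambda>i. F (Suc i)" y] Cons.prems(1)[of "Suc _"] Cons.prems(2) that by simp
  from dif_Cons_bound[OF _ this Cons.prems(3), of "F 0"] Cons.prems(1)[of 0] show ?case
    by (simp add: mult_ac)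
qed

text \<open>The innermost difference is paid for by a Lipschitz bound in place of a derivative. This
  gains one step for functions with a kink in the last derivative.\<close>

lemma dif_bound_lipschitz:
  assumes "\<And>i y. i < q \<Longrightarrow> y \<in> {lo..hi} \<Longrightarrow> (F i has_field_derivative F (Suc i) y) (at y)"
    and "\<And>y z. y \<in> {lo..hi} \<Longrightarrow> z \<in> {lo..hi} \<Longrightarrow> \<bar>F q y - F q z\<bar> \<le> M * \<bar>y - z\<bar>"
    and "length hs = Suc q" "in_window lo hi hs x"
  shows "\<bar>dif hs (F 0) x\<bar> \<le> M * (\<Prod>h\<leftarrow>hs. \<bar>h\<bar>)"
  using assms
proof (induction q arbitrary: F x hs)
  case 0
  then obtain h where hs: "hs = [h]" by (cases hs) auto
  show ?case
    using 0(2)[of "x + h" x] in_window_subset[OF in_window_Cons(1)] in_window_subset[OF in_window_Cons(2)] 0(4)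
    unfolding hs by fastforce
next
  case (Suc q)
  then obtain h hs' where hs: "hs = h # hs'" "length hs' = Suc q" by (cases hs) auto
  have "\<bar>dif hs' (F (Suc 0)) y\<bar> \<le> M * (\<Prod>h\<leftarrow>hs'. \<bar>h\<bar>)" if "in_window lo hi hs' y" for y
    using Suc.IH[of "\<lambda>i. F (Suc i)" hs' y] Suc.prems(1)[of "Suc _"] Suc.prems(2) that hs(2) by simp
  from dif_Cons_bound[OF _ this Suc.prems(4)[unfolded hs], of "F 0"] Suc.prems(1)[of 0] show ?case
    by (simp add: mult_ac hs)
qed

text \<open>Derivatives beyond the r-th are zero, so any number of steps is admissible. The
  translation c = 0 is meant for the product terms of the kernel and c = 1 for the reflected
  difference term.\<close>

lemma dif_nbern_bound:
  assumes M: "\<And>n x. n \<le> N \<Longrightarrow> x \<in> {-3..3} \<Longrightarrow> \<bar>nbern n x\<bar> \<le> M" "0 \<le> M" and r: "r \<le> N"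
    and w: "in_window (-2) 2 hs x" and c: "c \<in> {0, 1}"
  shows "\<bar>dif hs (\<lambda>t. nbern r (c + t)) x\<bar> \<le> M * (\<Prod>h\<leftarrow>hs. \<bar>h\<bar>)"
proof -
  define F where "F i t = (if i \<le> r then nbern (r - i) (c + t) else 0)" for i t
  have D: "((\<lambda>t. nbern (Suc k) (c + t)) has_field_derivative nbern k (c + t)) (at t)" for k t
    by (auto intro!: derivative_eq_intros)
  have D0: "((\<lambda>t. nbern 0 (c + t)) has_field_derivative 0) (at t)" for t by simp
  have "(F i has_field_derivative F (Suc i) t) (at t)" for i t
  proof (cases i r rule: linorder_cases)
    case less
    hence "r - i = Suc (r - Suc i)" by simp
    thus ?thesis using D[of "r - Suc i" t] less unfolding F_def by simp
  qed (use D0[of t] in \<open>auto simp: F_def[abs_def]\<close>)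
  moreover have "\<bar>F i t\<bar> \<le> M" if "t \<in> {-2..2}" for i t
    unfolding F_def using M(1)[of "r - i" "c + t"] M(2) r that c by auto
  moreover have "F 0 = (\<lambda>t. nbern r (c + t))" by (simp add: F_def[abs_def])
  ultimately show ?thesis
    using dif_bound[of hs "-2" 2 F M x] w by simp
qed

text \<open>With fewer steps than the degree, all derivatives involved exist at the kink as
  well.\<close>

lemma dif_tpower_bound:
  assumes "length hs < p" "in_window lo 2 hs x"
  shows "\<bar>dif hs (tpower p) x\<bar> \<le> 3 ^ p * (\<Prod>h\<leftarrow>hs. \<bar>h\<bar>)"
proof -
  have "(tpower (p - i) has_field_derivative tpower (p - Suc i) t) (at t)" if "i < length hs" for i t
  proof -
    have "p - i = Suc (p - Suc i)" using that assms by simp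
    moreover have "1 \<le> p - Suc i" using that assms by simp
    ultimately show ?thesis using DERIV_tpower[of t "p - Suc i"] by (simp only:) blast
  qed
  moreover have "\<bar>tpower (p - length hs) t\<bar> \<le> 3 ^ p" if "t \<in> {lo..2}" for t
  proof -
    have "tpower (p - length hs) t \<le> 3 ^ (p - length hs)" using that by (intro tpower_le) auto
    also have "\<dots> \<le> (3 :: real) ^ p" by (intro power_increasing) auto
    finally show ?thesis using tpower_nonneg[of "p - length hs" t] by simp
  qed
  ultimately show ?thesis
    using dif_bound[of hs lo 2 "\<lambda>i. tpower (p - i)" "3 ^ p" x] assms(2) by simp
qed

text \<open>After p - 1 derivatives the truncated power has become the positive part, which is
  1-Lipschitz across the kink.\<close>

lemma dif_tpower_eq_bound:
  assumes "1 \<le> p" "length hs = p" "in_window lo hi hs x"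
  shows "\<bar>dif hs (tpower p) x\<bar> \<le> (\<Prod>h\<leftarrow>hs. \<bar>h\<bar>)"
proof -
  have "(tpower (p - i) has_field_derivative tpower (p - Suc i) t) (at t)" if "i < p - 1" for i t
  proof -
    have "p - i = Suc (p - Suc i)" using that assms by simp
    moreover have "1 \<le> p - Suc i" using that assms by simp
    ultimately show ?thesis using DERIV_tpower[of t "p - Suc i"] by (simp only:) blast
  qed
  moreover have "\<bar>tpower (Suc 0) y - tpower (Suc 0) z\<bar> \<le> \<bar>y - z\<bar>" for y z
    by (auto simp: tpower_def)
  moreover have "p - (p - 1) = Suc 0" "length hs = Suc (p - 1)" using assms by auto
  ultimately show ?thesis
    using dif_bound_lipschitz[of "p - 1" lo hi "\<lambda>i. tpower (p - i)" 1 hs x] assms(3) by simp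
qed

text \<open>On either side of the kink the function is a polynomial of degree at most p, which p + 1
  differences annihilate.\<close>

lemma dif_tpower_eq_0:
  assumes "length hs = Suc p" "in_window lo hi hs x" "0 < lo \<or> hi < 0"
  shows "dif hs (tpower p) x = 0"
proof -
  define F where "F i = (if i \<le> p then tpower (p - i) else (\<lambda>_. 0))" for i
  have D0: "(tpower 0 has_field_derivative 0) (at t)" if t: "t \<noteq> 0" for t
  proof -
    have "((\<lambda>_ :: real. if 0 < t then 1 else 0 :: real) has_field_derivative 0) (at t)" by simp
    moreover have "open (if 0 < t then {0 :: real<..} else {..<0})" "t \<in> (if 0 < t then {0<..} else {..<0})"
      using t by simp_all
    ultimately show ?thesis
      by (rule has_field_derivative_transform_within_open) (auto simp: tpower_def split: if_splits)
  qed
  have "(F i has_field_derivative F (Suc i) t) (at t)" if t: "t \<in> {lo..hi}" for i t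
  proof (cases i p rule: linorder_cases)
    case less
    hence "p - i = Suc (p - Suc i)" by simp
    thus ?thesis using DERIV_tpower[of t "p - Suc i"] less t assms(3) unfolding F_def by force
  next
    case equal
    thus ?thesis using D0[of t] t assms(3) by (auto simp: F_def)
  qed (simp add: F_def)
  from dif_bound[of hs lo hi F 0 x, OF this] assms(1,2) show ?thesis by (simp add: F_def)
qed

section \<open>Differences in single digits and Walsh coefficients\<close>

definition ddif :: "nat \<Rightarrow> ((nat \<Rightarrow> nat) \<Rightarrow> 'a :: ab_group_add) \<Rightarrow> (nat \<Rightarrow> nat) \<Rightarrow> 'a" where
  "ddif a F d = F d - F (d(a := 0))"

lemma foldr_ddif_of_real: "foldr ddif as (\<lambda>d. of_real (F d)) d = of_real (foldr ddif as F d)"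
  by (induction as arbitrary: d) (simp_all add: ddif_def)

lemma foldr_ddif_cmult:
  fixes c :: real
  shows "foldr ddif as (\<lambda>d. c * F d) d = c * foldr ddif as F d" "foldr ddif as (\<lambda>d. F d * c) d = foldr ddif as F d * c"
  by (induction as arbitrary: d) (simp_all add: ddif_def algebra_simps)

text \<open>Shifting digit \<open>a\<close> cyclically multiplies the sum over the subtracted terms \<open>F (d(a := 0))\<close> by a
  root of unity different from \<open>1\<close>, so this sum vanishes.\<close>

lemma sum_ddif:
  fixes F :: "(nat \<Rightarrow> nat) \<Rightarrow> complex"
  assumes b: "0 < b" and a: "a \<in> {1..n}" and k: "0 < k a" "k a < b" and s: "s \<in> {1, -1}"
  shows "(\<Sum>d\<in>digit_vecs b n. ddif a F d * uroot b (s * (\<Sum>i=1..n. int (k i) * int (d i)))) =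
         (\<Sum>d\<in>digit_vecs b n. F d * uroot b (s * (\<Sum>i=1..n. int (k i) * int (d i))))"
proof -
  let ?G = "digit_vecs b n"
  define \<delta> where "\<delta> i = (if i = a then 1 else 0 :: nat)" for i
  define chr where "chr d = uroot b (s * (\<Sum>i=1..n. int (k i) * int (d i)))" for d :: "nat \<Rightarrow> nat"
  define S where "S = (\<Sum>d\<in>?G. F (d(a := 0)) * chr d)"
  have "S = (\<Sum>d\<in>?G. F ((dadd b n \<delta> d)(a := 0)) * chr (dadd b n \<delta> d))"
    unfolding S_def by (rule sum.reindex_bij_betw[OF bij_betw_dadd[OF b], symmetric])
  also have "\<dots> = (\<Sum>d\<in>?G. F (d(a := 0)) * chr d * uroot b (s * int (k a)))"
  proof (intro sum.cong refl)
    fix d assume d: "d \<in> ?G"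
    have "(dadd b n \<delta> d)(a := 0) = d(a := 0)"
    proof
      fix i
      show "((dadd b n \<delta> d)(a := 0)) i = (d(a := 0)) i"
        using d digit_vecs_less[OF d, of i] a
        by (cases "i \<in> {1..n}") (auto simp: dadd_def \<delta>_def digit_vecs_def PiE_iff extensional_def)
    qed
    moreover have "chr (dadd b n \<delta> d) = uroot b (s * (\<Sum>i=1..n. int (k i) * int (d i)) + s * int (k a))"
      unfolding chr_def
    proof (rule uroot_cong[OF b])
      have "(\<Sum>i=1..n. int (k i) * int (\<delta> i)) = int (k a)"
        using a by (simp add: \<delta>_def if_distrib cong: if_cong)
      hence eq: "s * (\<Sum>i=1..n. int (k i) * int (dadd b n \<delta> d i)) -
          (s * (\<Sum>i=1..n. int (k i) * int (d i)) + s * int (k a)) =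
          s * (\<Sum>i=1..n. int (k i) * (int (dadd b n \<delta> d i) - int (\<delta> i + d i)))"
        by (simp add: right_diff_distrib distrib_left sum_subtractf sum.distrib)
      have "int b dvd int (dadd b n \<delta> d i) - int (\<delta> i + d i)" if "i \<in> {1..n}" for i
        unfolding mod_eq_iff_int_dvd[symmetric] using that by (simp add: dadd_def)
      thus "int b dvd s * (\<Sum>i=1..n. int (k i) * int (dadd b n \<delta> d i)) -
          (s * (\<Sum>i=1..n. int (k i) * int (d i)) + s * int (k a))"
        unfolding eq by (intro dvd_mult dvd_sum)
    qed
    ultimately show "F ((dadd b n \<delta> d)(a := 0)) * chr (dadd b n \<delta> d) = F (d(a := 0)) * chr d * uroot b (s * int (k a))"
      by (simp only: uroot_add chr_def mult.assoc)
  qed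
  also have "\<dots> = S * uroot b (s * int (k a))" by (simp add: S_def sum_distrib_right)
  finally have "S * (uroot b (s * int (k a)) - 1) = 0" by (simp add: algebra_simps)
  moreover have "\<not> int b dvd s * int (k a)"
    using s k by (auto dest: nat_dvd_not_less)
  hence "uroot b (s * int (k a)) \<noteq> 1" using uroot_eq_1[OF b] by blast
  ultimately have "S = 0" by simp
  thus ?thesis unfolding S_def chr_def ddif_def by (simp add: left_diff_distrib sum_subtractf)
qed

lemma sum_foldr_ddif:
  fixes F :: "(nat \<Rightarrow> nat) \<Rightarrow> complex"
  assumes b: "0 < b" and as: "\<And>a. a \<in> set as \<Longrightarrow> a \<in> {1..n} \<and> 0 < k a \<and> k a < b" and s: "s \<in> {1, -1}"
  shows "(\<Sum>d\<in>digit_vecs b n. foldr ddif as F d * uroot b (s * (\<Sum>i=1..n. int (k i) * int (d i)))) =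
         (\<Sum>d\<in>digit_vecs b n. F d * uroot b (s * (\<Sum>i=1..n. int (k i) * int (d i))))"
  using as
proof (induction as)
  case (Cons a as)
  have a: "a \<in> {1..n}" "0 < k a" "k a < b" using Cons.prems by auto
  show ?case using Cons sum_ddif[where k = k and F = "foldr ddif as F", OF b a s] by simp
qed simp

text \<open>The character splits into a factor in e and a conjugate factor in d, hence the two signs
  allowed for s. Differences are therefore inserted in one variable at a time, after which the
  triangle inequality discards the characters.\<close>

lemma norm_walsh_coeff_le:
  assumes b: "0 < b" and as: "\<And>a. a \<in> set as \<Longrightarrow> a \<in> {1..n} \<and> 0 < k a \<and> k a < b"
  shows "norm (walsh_coeff b n g k) \<le>
    (\<Sum>d\<in>digit_vecs b n. \<Sum>e\<in>digit_vecs b n.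
      \<bar>foldr ddif as (\<lambda>d. foldr ddif as (\<lambda>e. g (dval b n d) (dval b n e)) e) d\<bar>) / real b ^ (2 * n)"
proof -
  let ?G = "digit_vecs b n"
  define chr where "chr s d = uroot b (s * (\<Sum>i=1..n. int (k i) * int (d i)))" for s and d :: "nat \<Rightarrow> nat"
  define h where "h d e = (of_real (g (dval b n d) (dval b n e)) :: complex)" for d e
  define E where "E d e = foldr ddif as (\<lambda>d. foldr ddif as (\<lambda>e. g (dval b n d) (dval b n e)) e) d" for d e
  have u: "uroot b (\<Sum>i=1..n. int (k i) * (int (e i) - int (d i))) = chr 1 e * chr (-1) d" for d e
    unfolding chr_def uroot_add[symmetric] by (simp add: right_diff_distrib sum_subtractf)
  have "(\<Sum>d\<in>?G. \<Sum>e\<in>?G. h d e * (chr 1 e * chr (-1) d)) = (\<Sum>d\<in>?G. (\<Sum>e\<in>?G. h d e * chr 1 e) * chr (-1) d)"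
    by (simp add: sum_distrib_right mult.assoc)
  also have "\<dots> = (\<Sum>d\<in>?G. (\<Sum>e\<in>?G. foldr ddif as (h d) e * chr 1 e) * chr (-1) d)"
    unfolding chr_def using sum_foldr_ddif[OF b as, where s = 1] by simp
  also have "\<dots> = (\<Sum>e\<in>?G. (\<Sum>d\<in>?G. foldr ddif as (h d) e * chr (-1) d) * chr 1 e)"
    unfolding sum_distrib_right by (subst sum.swap) (simp add: mult_ac)
  also have "\<dots> = (\<Sum>e\<in>?G. (\<Sum>d\<in>?G. foldr ddif as (\<lambda>d. foldr ddif as (h d) e) d * chr (-1) d) * chr 1 e)"
    unfolding chr_def using sum_foldr_ddif[OF b as, where s = "-1"] by simp
  also have "\<dots> = (\<Sum>e\<in>?G. (\<Sum>d\<in>?G. of_real (E d e) * chr (-1) d) * chr 1 e)"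
    unfolding h_def foldr_ddif_of_real E_def ..
  finally have "walsh_coeff b n g k = (\<Sum>e\<in>?G. (\<Sum>d\<in>?G. of_real (E d e) * chr (-1) d) * chr 1 e) / of_nat b ^ (2 * n)"
    unfolding walsh_coeff_def u h_def by simp
  hence "norm (walsh_coeff b n g k) = norm (\<Sum>e\<in>?G. \<Sum>d\<in>?G. of_real (E d e) * chr (-1) d * chr 1 e) / real b ^ (2 * n)"
    by (simp add: norm_divide norm_power sum_distrib_right)
  also have "\<dots> \<le> (\<Sum>e\<in>?G. \<Sum>d\<in>?G. norm (of_real (E d e) * chr (-1) d * chr 1 e)) / real b ^ (2 * n)"
    by (intro divide_right_mono sum_norm_le norm_sum) auto
  also have "\<dots> = (\<Sum>e\<in>?G. \<Sum>d\<in>?G. \<bar>E d e\<bar>) / real b ^ (2 * n)"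
    by (simp add: norm_mult chr_def)
  also have "(\<Sum>e\<in>?G. \<Sum>d\<in>?G. \<bar>E d e\<bar>) = (\<Sum>d\<in>?G. \<Sum>e\<in>?G. \<bar>E d e\<bar>)" by (rule sum.swap)
  finally show ?thesis unfolding E_def .
qed

definition steps :: "nat \<Rightarrow> nat list \<Rightarrow> (nat \<Rightarrow> nat) \<Rightarrow> real list" where
  "steps b as d = map (\<lambda>a. real (d a) / real b ^ a) as"

lemma dval_upd_0:
  assumes "a \<in> {1..n}" shows "dval b n (d(a := 0)) = dval b n d - real (d a) / real b ^ a"
proof -
  have "dval b n d = real (d a) / real b ^ a + (\<Sum>i\<in>{1..n} - {a}. real (d i) / real b ^ i)"
    unfolding dval_def using assms by (intro sum.remove) auto
  moreover have "dval b n (d(a := 0)) = (\<Sum>i\<in>{1..n} - {a}. real ((d(a := 0)) i) / real b ^ i)"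
    unfolding dval_def using assms by (subst sum.remove[of _ a]) auto
  moreover have "\<dots> = (\<Sum>i\<in>{1..n} - {a}. real (d i) / real b ^ i)" by (intro sum.cong) auto
  ultimately show ?thesis by simp
qed

text \<open>Setting a digit to 0 causes no carries, so a digit difference is an ordinary difference
  of step d a / b^a, based at the point with all digits in \<open>as\<close> erased. The factor
  \<epsilon> is applied with 1 and, for the variable entering with a minus sign, with -1.\<close>

lemma foldr_ddif_dval:
  assumes "distinct as" "set as \<subseteq> {1..n}"
  shows "foldr ddif as (\<lambda>d. f (\<epsilon> * dval b n d)) d =
    dif (map ((*) \<epsilon>) (steps b as d)) f (\<epsilon> * (dval b n d - sum_list (steps b as d)))"
  using assms
proof (induction as arbitrary: d)
  case (Cons a as)
  have st: "steps b as (d(a := 0)) = steps b as d" using Cons.prems by (auto simp: steps_def)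
  have IH: "foldr ddif as (\<lambda>d. f (\<epsilon> * dval b n d)) d = dif (map ((*) \<epsilon>) (steps b as d)) f (\<epsilon> * (dval b n d - sum_list (steps b as d)))" for d
    using Cons by simp
  have "foldr ddif (a # as) (\<lambda>d. f (\<epsilon> * dval b n d)) d =
     foldr ddif as (\<lambda>d. f (\<epsilon> * dval b n d)) d - foldr ddif as (\<lambda>d. f (\<epsilon> * dval b n d)) (d(a := 0))"
    by (simp add: ddif_def)
  also have "\<dots> =
     dif (map ((*) \<epsilon>) (steps b as d)) f (\<epsilon> * (dval b n d - sum_list (steps b as d))) -
     dif (map ((*) \<epsilon>) (steps b as d)) f (\<epsilon> * (dval b n d - real (d a) / real b ^ a - sum_list (steps b as d)))"
    using Cons.prems unfolding IH by (simp add: dval_upd_0 st)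
  finally have eq: "foldr ddif (a # as) (\<lambda>d. f (\<epsilon> * dval b n d)) d = \<dots>" .
  have e1: "\<epsilon> * (dval b n d - sum_list (steps b (a # as) d)) =
      \<epsilon> * (dval b n d - real (d a) / real b ^ a - sum_list (steps b as d))"
    by (simp add: steps_def)
  have e2: "\<epsilon> * (dval b n d - real (d a) / real b ^ a - sum_list (steps b as d)) + \<epsilon> * (real (d a) / real b ^ a) =
      \<epsilon> * (dval b n d - sum_list (steps b as d))"
    by (simp add: algebra_simps)
  have e3: "map ((*) \<epsilon>) (steps b (a # as) d) = \<epsilon> * (real (d a) / real b ^ a) # map ((*) \<epsilon>) (steps b as d)"
    by (simp add: steps_def)
  show ?case unfolding eq e1 e3 dif.simps e2 ..
qed (simp add: steps_def)

text \<open>The digit differences in both variables merge into one iterated difference of a function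
  of the single variable y - x, with negative steps from d and positive ones from e.\<close>

lemma foldr_ddif_dval_diff:
  assumes "distinct as" "set as \<subseteq> {1..n}"
  shows "foldr ddif as (\<lambda>d. foldr ddif as (\<lambda>e. \<phi> (dval b n e - dval b n d)) e) d =
    dif (map uminus (steps b as d) @ steps b as e) \<phi>
      ((dval b n e - sum_list (steps b as e)) - (dval b n d - sum_list (steps b as d)))"
proof -
  let ?c = "dval b n e - sum_list (steps b as e)"
  have "foldr ddif as (\<lambda>e. \<phi> (dval b n e - dval b n d)) e = dif (steps b as e) \<phi> (?c + - 1 * dval b n d)" for d
    using foldr_ddif_dval[OF assms, of "\<lambda>t. \<phi> (t - dval b n d)" 1 b e]
      dif_append[of "steps b as e" "[]" \<phi> "- dval b n d" ?c] by (simp add: map_idI algebra_simps)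
  hence "foldr ddif as (\<lambda>d. foldr ddif as (\<lambda>e. \<phi> (dval b n e - dval b n d)) e) d =
     foldr ddif as (\<lambda>d. (\<lambda>t. dif (steps b as e) \<phi> (?c + t)) (- 1 * dval b n d)) d"
    by simp
  also have "\<dots> = dif (map ((*) (- 1)) (steps b as d)) (\<lambda>t. dif (steps b as e) \<phi> (?c + t)) (- 1 * (dval b n d - sum_list (steps b as d)))"
    by (rule foldr_ddif_dval[OF assms])
  also have "map ((*) (- 1)) (steps b as d) = map uminus (steps b as d)" by simp
  finally show ?thesis unfolding dif_append by (simp add: algebra_simps)
qed

section \<open>Decay of the Walsh coefficients of the kernel\<close>

lemma steps_nonneg: "h \<in> set (steps b as d) \<Longrightarrow> 0 \<le> h"
  by (auto simp: steps_def)

lemma length_steps [simp]: "length (steps b as d) = length as"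
  by (simp add: steps_def)

lemma sum_list_steps_eq: "distinct as \<Longrightarrow> sum_list (steps b as d) = (\<Sum>a\<in>set as. real (d a) / real b ^ a)"
  by (simp add: steps_def sum_list_distinct_conv_sum_set)

lemma sum_list_steps_le:
  assumes "distinct as" "set as \<subseteq> {1..n}" shows "sum_list (steps b as d) \<le> dval b n d"
  unfolding sum_list_steps_eq[OF assms(1)] dval_def using assms(2) by (intro sum_mono2) auto

lemma geometric_tail:
  assumes "0 < b" "a \<le> n + 1"
  shows "(\<Sum>i=a..n. (real b - 1) / real b ^ i) = real b / real b ^ a - 1 / real b ^ n"
  using assms(2)
proof (induction n)
  case 0
  have "a = 0 \<or> a = 1" using 0 by auto
  thus ?case using assms(1) by auto
next
  case (Suc n)
  show ?case
  proof (cases "a \<le> n + 1")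
    case True
    have "(real b - 1) / real b ^ Suc n = 1 / real b ^ n - 1 / real b ^ Suc n"
      using assms(1) by (simp add: field_simps)
    thus ?thesis using Suc.IH True by (simp add: sum.cl_ivl_Suc)
  next
    case False
    hence "a = Suc (Suc n)" using Suc.prems by simp
    thus ?thesis using assms(1) by simp
  qed
qed

lemma sum_list_steps_le_geometric:
  assumes b: "0 < b" and as: "distinct as" "set as \<subseteq> {a0..n}" "1 \<le> a0" "a0 \<le> n + 1" and d: "d \<in> digit_vecs b n"
  shows "sum_list (steps b as d) \<le> real b / real b ^ a0"
proof -
  have "sum_list (steps b as d) \<le> (\<Sum>a\<in>set as. (real b - 1) / real b ^ a)"
    unfolding sum_list_steps_eq[OF as(1)]
  proof (intro sum_mono divide_right_mono)
    fix a assume "a \<in> set as"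
    hence "d a < b" using as by (intro digit_vecs_less[OF d]) auto
    thus "real (d a) \<le> real b - 1" by linarith
  qed auto
  also have "\<dots> \<le> (\<Sum>a=a0..n. (real b - 1) / real b ^ a)"
    using as(2) b by (intro sum_mono2) auto
  also have "\<dots> \<le> real b / real b ^ a0" using geometric_tail[OF b as(4)] by simp
  finally show ?thesis .
qed

text \<open>The product of the upper bounds b / b^a for the steps, independent of the digits of the
  point.\<close>

definition step_weight :: "nat \<Rightarrow> nat list \<Rightarrow> real" where
  "step_weight b as = (\<Prod>a\<leftarrow>as. real b / real b ^ a)"

lemma step_weight_nonneg: "0 \<le> step_weight b as"
  unfolding step_weight_def by (intro prod_list_nonneg) auto

lemma step_weight_eq: "step_weight b as = real b ^ length as / real b ^ sum_list as"
  unfolding step_weight_def by (induction as) (simp_all add: power_add)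

lemma prod_list_steps_le:
  assumes "set as \<subseteq> {1..n}" "d \<in> digit_vecs b n"
  shows "(\<Prod>h\<leftarrow>steps b as d. \<bar>h\<bar>) \<le> step_weight b as"
  using assms(1)
proof (induction as)
  case (Cons a as)
  have "d a < b" using Cons.prems by (intro digit_vecs_less[OF assms(2)]) auto
  hence "real (d a) / real b ^ a \<le> real b / real b ^ a" by (intro divide_right_mono) auto
  moreover have "(\<Prod>h\<leftarrow>steps b as d. \<bar>h\<bar>) \<le> step_weight b as" using Cons by simp
  ultimately have "real (d a) / real b ^ a * (\<Prod>h\<leftarrow>steps b as d. \<bar>h\<bar>) \<le> real b / real b ^ a * step_weight b as"
    by (intro mult_mono prod_list_nonneg) auto
  thus ?case by (simp add: steps_def step_weight_def)
qed (simp add: steps_def step_weight_def)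

lemma prod_list_abs_nonneg: "0 \<le> (\<Prod>h\<leftarrow>hs. \<bar>h :: real\<bar>)"
  by (intro prod_list_nonneg) auto

lemma prod_list_abs_uminus: "(\<Prod>h\<leftarrow>map uminus hs. \<bar>h :: real\<bar>) = (\<Prod>h\<leftarrow>hs. \<bar>h\<bar>)"
  by (induction hs) auto

lemma in_window_steps:
  "in_window lo hi (map uminus (steps b as d) @ steps b as' e) x \<longleftrightarrow>
     lo \<le> x - sum_list (steps b as d) \<and> x + sum_list (steps b as' e) \<le> hi"
proof -
  have "(\<Sum>h\<leftarrow>hs. min 0 h) = 0" "(\<Sum>h\<leftarrow>hs. max 0 h) = sum_list hs"
    "(\<Sum>h\<leftarrow>map uminus hs. min 0 h) = - sum_list hs" "(\<Sum>h\<leftarrow>map uminus hs. max 0 h) = 0"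
    if "\<And>h. h \<in> set hs \<Longrightarrow> (0 :: real) \<le> h" for hs
    using that by (induction hs) (force simp: min_def max_def)+
  note this[OF steps_nonneg]
  thus ?thesis by (simp add: in_window_def del: map_map)
qed

lemma ddif_nbern_prod_bound:
  assumes M: "\<And>n x. n \<le> N \<Longrightarrow> x \<in> {-3..3} \<Longrightarrow> \<bar>nbern n x\<bar> \<le> M" "0 \<le> M" and r: "r \<le> N"
    and b: "0 < b" and as: "distinct as" "set as \<subseteq> {1..n}"
    and d: "d \<in> digit_vecs b n" and e: "e \<in> digit_vecs b n"
  shows "\<bar>foldr ddif as (\<lambda>d. foldr ddif as (\<lambda>e. nbern r (dval b n d) * nbern r (dval b n e)) e) d\<bar>
     \<le> (M * step_weight b as)\<^sup>2"
proof -
  have B: "\<bar>foldr ddif as (\<lambda>d. nbern r (dval b n d)) d\<bar> \<le> M * step_weight b as" if d: "d \<in> digit_vecs b n" for d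
  proof -
    have "foldr ddif as (\<lambda>d. nbern r (dval b n d)) d =
        dif (steps b as d) (\<lambda>t. nbern r (0 + t)) (dval b n d - sum_list (steps b as d))"
      using foldr_ddif_dval[OF as, of "nbern r" 1 b d] by (simp add: map_idI)
    also have "\<bar>\<dots>\<bar> \<le> M * (\<Prod>h\<leftarrow>steps b as d. \<bar>h\<bar>)"
    proof (rule dif_nbern_bound[OF M r])
      show "in_window (- 2) 2 (steps b as d) (dval b n d - sum_list (steps b as d))"
        using in_window_steps[of "-2" 2 b "[]" d as d "dval b n d - sum_list (steps b as d)"]
          sum_list_steps_le[OF as, of b d] dval_bounds[OF b d] by (simp add: steps_def)
    qed auto
    also have "\<dots> \<le> M * step_weight b as"
      by (intro mult_left_mono prod_list_steps_le[OF as(2) d] M(2))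
    finally show ?thesis .
  qed
  have "foldr ddif as (\<lambda>d. foldr ddif as (\<lambda>e. nbern r (dval b n d) * nbern r (dval b n e)) e) d =
     foldr ddif as (\<lambda>d. nbern r (dval b n d)) d * foldr ddif as (\<lambda>e. nbern r (dval b n e)) e"
    by (simp only: foldr_ddif_cmult)
  thus ?thesis
    using mult_mono[OF B[OF d] B[OF e]] M(2) step_weight_nonneg[of b as]
    by (simp add: abs_mult power2_eq_square)
qed

lemma prod_list_two_steps_le:
  assumes "set as \<subseteq> {1..n}" "set as' \<subseteq> {1..n}" "d \<in> digit_vecs b n" "e \<in> digit_vecs b n"
  shows "(\<Prod>h\<leftarrow>map uminus (steps b as d) @ steps b as' e. \<bar>h\<bar>) \<le> step_weight b as * step_weight b as'"
  using mult_mono[OF prod_list_steps_le[OF assms(1,3)] prod_list_steps_le[OF assms(2,4)]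
      step_weight_nonneg prod_list_abs_nonneg]
  by (simp only: map_append prod_list.append prod_list_abs_uminus)

lemma in_window_two_steps:
  assumes b: "0 < b" and as: "distinct as" "set as \<subseteq> {1..n}"
    and d: "d \<in> digit_vecs b n" and e: "e \<in> digit_vecs b n"
  shows "in_window (-2) 2 (map uminus (steps b as d) @ steps b as e)
      ((dval b n e - sum_list (steps b as e)) - (dval b n d - sum_list (steps b as d)))"
  unfolding in_window_steps
  using sum_list_steps_le[OF as, of b d] sum_list_steps_le[OF as, of b e] dval_bounds[OF b d] dval_bounds[OF b e]
  by simp

lemma ddif_nbern_diff_bound:
  assumes M: "\<And>n x. n \<le> 2 * \<alpha> \<Longrightarrow> x \<in> {-3..3} \<Longrightarrow> \<bar>nbern n x\<bar> \<le> M" "0 \<le> M"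
    and b: "0 < b" and as: "distinct as" "set as \<subseteq> {1..n}"
    and d: "d \<in> digit_vecs b n" and e: "e \<in> digit_vecs b n"
  shows "\<bar>foldr ddif as (\<lambda>d. foldr ddif as (\<lambda>e. nbern (2 * \<alpha>) (dval b n d - dval b n e)) e) d\<bar>
     \<le> M * (step_weight b as)\<^sup>2"
proof -
  \<comment> \<open>Reflection gives a function of y - x, the orientation also used for the
    truncated power.\<close>
  have "nbern (2 * \<alpha>) (x - y) = nbern (2 * \<alpha>) (1 + (y - x))" for x y
    using nbern_reflect[of "2 * \<alpha>" "x - y"] by (simp add: algebra_simps)
  hence "\<bar>foldr ddif as (\<lambda>d. foldr ddif as (\<lambda>e. nbern (2 * \<alpha>) (dval b n d - dval b n e)) e) d\<bar> =
     \<bar>dif (map uminus (steps b as d) @ steps b as e) (\<lambda>t. nbern (2 * \<alpha>) (1 + t))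
      ((dval b n e - sum_list (steps b as e)) - (dval b n d - sum_list (steps b as d)))\<bar>"
    using foldr_ddif_dval_diff[OF as, of "\<lambda>t. nbern (2 * \<alpha>) (1 + t)" b e d] by simp
  also have "\<dots> \<le> M * (\<Prod>h\<leftarrow>map uminus (steps b as d) @ steps b as e. \<bar>h\<bar>)"
    by (rule dif_nbern_bound[OF M order_refl in_window_two_steps[OF b as d e]]) auto
  also have "\<dots> \<le> M * (step_weight b as)\<^sup>2"
    unfolding power2_eq_square by (intro mult_left_mono prod_list_two_steps_le[OF as(2) as(2) d e] M(2))
  finally show ?thesis .
qed

text \<open>For degree 2 \<alpha> - 1 this covers the frequencies with fewer than \<alpha> nonzero
  digits, for which a bound uniform in both points holds even at the kink.\<close>

lemma ddif_tpower_bound: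
  assumes "2 * length as < p"
    and b: "0 < b" and as: "distinct as" "set as \<subseteq> {1..n}"
    and d: "d \<in> digit_vecs b n" and e: "e \<in> digit_vecs b n"
  shows "\<bar>foldr ddif as (\<lambda>d. foldr ddif as (\<lambda>e. tpower p (dval b n e - dval b n d)) e) d\<bar>
     \<le> 3 ^ p * (step_weight b as)\<^sup>2"
proof -
  have "\<bar>foldr ddif as (\<lambda>d. foldr ddif as (\<lambda>e. tpower p (dval b n e - dval b n d)) e) d\<bar> \<le>
     3 ^ p * (\<Prod>h\<leftarrow>map uminus (steps b as d) @ steps b as e. \<bar>h\<bar>)"
    unfolding foldr_ddif_dval_diff[OF as]
    using assms(1) by (intro dif_tpower_bound[OF _ in_window_two_steps[OF b as d e]]) simp
  also have "\<dots> \<le> 3 ^ p * (step_weight b as)\<^sup>2"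
    unfolding power2_eq_square by (intro mult_left_mono prod_list_two_steps_le[OF as(2) as(2) d e]) simp
  finally show ?thesis .
qed

lemma card_near:
  assumes b: "2 \<le> b" and d: "d \<in> digit_vecs b n" and a: "a \<le> n"
  shows "real (card {e \<in> digit_vecs b n. \<bar>dval b n e - dval b n d\<bar> \<le> real b / real b ^ a})
      \<le> 3 * (real b / real b ^ a) * real b ^ n"
proof -
  let ?S = "{e \<in> digit_vecs b n. \<bar>dval b n e - dval b n d\<bar> \<le> real b / real b ^ a}"
  \<comment> \<open>The radius measured in grid steps; it is an integer because a is at most
    n.\<close>
  define w where "w = b * b ^ (n - a)"
  have w: "real w = real b / real b ^ a * real b ^ n"
  proof -
    have "real b ^ n = real b ^ a * real b ^ (n - a)" using a by (simp add: power_add[symmetric])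
    thus ?thesis unfolding w_def using b by simp
  qed
  have "w \<ge> 1" using b by (simp add: w_def)
  have "dnum b n ` ?S \<subseteq> {dnum b n d - w .. dnum b n d + w}"
  proof
    fix x assume "x \<in> dnum b n ` ?S"
    then obtain e where e: "x = dnum b n e" "\<bar>dval b n e - dval b n d\<bar> \<le> real b / real b ^ a" by auto
    have "\<bar>real x / real b ^ n - real (dnum b n d) / real b ^ n\<bar> \<le> real b / real b ^ a"
      using e b by (simp add: dval_eq_dnum)
    hence "\<bar>real x - real (dnum b n d)\<bar> / real b ^ n \<le> real b / real b ^ a"
      by (simp add: diff_divide_distrib[symmetric] abs_divide)
    hence "\<bar>real x - real (dnum b n d)\<bar> \<le> real w"
      unfolding w using b by (subst (asm) pos_divide_le_eq) auto
    thus "x \<in> {dnum b n d - w .. dnum b n d + w}" by auto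
  qed
  hence "card (dnum b n ` ?S) \<le> card {dnum b n d - w .. dnum b n d + w}" by (intro card_mono) auto
  moreover have "card (dnum b n ` ?S) = card ?S"
    by (intro card_image inj_on_subset[OF inj_on_dnum[OF b]]) auto
  \<comment> \<open>An integer interval of radius w has at most 2 w + 1 elements, and w is at least
    1.\<close>
  ultimately have "card ?S \<le> 3 * w" using \<open>w \<ge> 1\<close> by simp
  thus ?thesis using w by (simp add: of_nat_mono[of _ "3 * w", where 'a = real, simplified])
qed

text \<open>The difference vanishes when all evaluation points lie on one side of the kink. Near the kink one
  of the two largest steps is left out of the estimate, which is compensated by the small
  number of pairs concerned.\<close>

lemma sum_ddif_tpower_bound:
  assumes b: "2 \<le> b" and as: "sorted as" "distinct as" "set as \<subseteq> {1..n}" "length as = \<alpha>" "1 \<le> \<alpha>"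
    and d: "d \<in> digit_vecs b n"
  shows "(\<Sum>e\<in>digit_vecs b n. \<bar>foldr ddif as (\<lambda>d. foldr ddif as (\<lambda>e. tpower (2 * \<alpha> - 1) (dval b n e - dval b n d)) e) d\<bar>)
     \<le> 6 * (step_weight b as)\<^sup>2 * real b ^ n"
proof -
  have b0: "0 < b" using b by simp
  \<comment> \<open>The list is increasing, so its head is the lowest selected position and carries
    the largest step bound \<open>W\<close>.\<close>
  obtain a as' where Cons: "as = a # as'" using as by (cases as) auto
  define W where "W = real b / real b ^ a"
  define Q where "Q = step_weight b as'"
  have Q: "step_weight b as = W * Q" by (simp add: Cons step_weight_def W_def Q_def)
  have nn: "0 \<le> W" "0 \<le> Q" by (simp_all add: W_def Q_def step_weight_nonneg)
  have a: "1 \<le> a" "a \<le> n" using as Cons by auto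
  have sub: "set as \<subseteq> {a..n}" using as Cons by auto
  let ?X = "\<lambda>e. \<bar>foldr ddif as (\<lambda>d. foldr ddif as (\<lambda>e. tpower (2 * \<alpha> - 1) (dval b n e - dval b n d)) e) d\<bar>"
  let ?S = "{e \<in> digit_vecs b n. \<bar>dval b n e - dval b n d\<bar> \<le> W}"
  have X: "?X e \<le> (if \<bar>dval b n e - dval b n d\<bar> \<le> W then 2 * (Q * (W * Q)) else 0)" if e: "e \<in> digit_vecs b n" for e
  proof -
    let ?hs = "map uminus (steps b as d) @ steps b as e"
    let ?x = "(dval b n e - sum_list (steps b as e)) - (dval b n d - sum_list (steps b as d))"
    have len: "length ?hs = Suc (2 * \<alpha> - 1)" using as by simp
    show ?thesis
    proof (cases "\<bar>dval b n e - dval b n d\<bar> \<le> W")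
      case True
      \<comment> \<open>The largest step in d is expanded into two values, which costs the factor 2;
        the remaining 2 \<alpha> - 1 steps match the degree of the truncated power.\<close>
      let ?h = "- (real (d a) / real b ^ a)"
      let ?hs' = "map uminus (steps b as' d) @ steps b as e"
      have hs: "?hs = ?h # ?hs'" by (simp add: Cons steps_def)
      have w: "in_window (-2) 2 (?h # ?hs') ?x"
        using in_window_two_steps[OF b0 as(2,3) d e] unfolding hs .
      have len': "length ?hs' = 2 * \<alpha> - 1" using as Cons by simp
      have p1: "1 \<le> 2 * \<alpha> - 1" using as by simp
      have sub': "set as' \<subseteq> {1..n}" using as Cons by auto
      have P: "(\<Prod>h\<leftarrow>?hs'. \<bar>h\<bar>) \<le> Q * (W * Q)"
        using prod_list_two_steps_le[OF sub' as(3) d e] unfolding Q Q_def[symmetric] .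
      have "dif ?hs (tpower (2 * \<alpha> - 1)) ?x =
          dif ?hs' (tpower (2 * \<alpha> - 1)) (?x + ?h) - dif ?hs' (tpower (2 * \<alpha> - 1)) ?x"
        unfolding hs dif.simps ..
      hence "\<bar>dif ?hs (tpower (2 * \<alpha> - 1)) ?x\<bar> \<le> 2 * (Q * (W * Q))"
        using dif_tpower_eq_bound[OF p1 len' in_window_Cons(1)[OF w]]
          dif_tpower_eq_bound[OF p1 len' in_window_Cons(2)[OF w]] P by linarith
      thus ?thesis using True unfolding foldr_ddif_dval_diff[OF as(2,3)] by simp
    next
      case False
      have S: "sum_list (steps b as d) \<le> W" "sum_list (steps b as e) \<le> W"
        unfolding W_def using sum_list_steps_le_geometric[OF b0 as(2) sub] a d e by auto
      define lo hi where "lo = ?x - sum_list (steps b as d)" and "hi = ?x + sum_list (steps b as e)"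
      have w: "in_window lo hi ?hs ?x" unfolding in_window_steps lo_def hi_def by simp
      \<comment> \<open>The window reaches from \<open>dval b n e - dval b n d\<close> to the left
        by the steps of e and to the right by those of d, each of total length at most
        \<open>W\<close>.\<close>
      have "0 < lo \<or> hi < 0" using False S unfolding lo_def hi_def by linarith
      from dif_tpower_eq_0[OF len w this] show ?thesis
        using False unfolding foldr_ddif_dval_diff[OF as(2,3)] by simp
    qed
  qed
  have "(\<Sum>e\<in>digit_vecs b n. ?X e) \<le> (\<Sum>e\<in>digit_vecs b n. if \<bar>dval b n e - dval b n d\<bar> \<le> W then 2 * (Q * (W * Q)) else 0)"
    by (intro sum_mono X)
  also have "\<dots> = (\<Sum>e\<in>?S. 2 * (Q * (W * Q)))" by (rule sum.inter_filter[symmetric]) simp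
  also have "\<dots> = real (card ?S) * (2 * (Q * (W * Q)))" by simp
  \<comment> \<open>The proportion 3 \<open>W\<close> of nearby points restores the missing factor
    \<open>W\<close>; hence the constant 6.\<close>
  also have "\<dots> \<le> (3 * W * real b ^ n) * (2 * (Q * (W * Q)))"
    using card_near[OF b d a(2)] nn unfolding W_def[symmetric] by (intro mult_right_mono) auto
  also have "\<dots> = 6 * (step_weight b as)\<^sup>2 * real b ^ n" unfolding Q by (simp add: power2_eq_square)
  finally show ?thesis .
qed

lemma walsh_coeff_add: "walsh_coeff b n (\<lambda>x y. f x y + g x y) k = walsh_coeff b n f k + walsh_coeff b n g k"
  unfolding walsh_coeff_def by (simp add: distrib_right sum.distrib add_divide_distrib)

lemma walsh_coeff_cmult: "walsh_coeff b n (\<lambda>x y. c * g x y) k = of_real c * walsh_coeff b n g k"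
  unfolding walsh_coeff_def by (simp add: sum_distrib_left mult.assoc)

lemma walsh_coeff_sum:
  "walsh_coeff b n (\<lambda>x y. \<Sum>r\<in>R. g r x y) k = (\<Sum>r\<in>R. walsh_coeff b n (g r) k)"
  by (induction R rule: infinite_finite_induct) (simp_all add: walsh_coeff_add, simp_all add: walsh_coeff_def)

lemma double_average_le:
  assumes "0 < b" "\<And>d. d \<in> digit_vecs b n \<Longrightarrow> (\<Sum>e\<in>digit_vecs b n. X d e) \<le> c * real b ^ n"
  shows "(\<Sum>d\<in>digit_vecs b n. \<Sum>e\<in>digit_vecs b n. X d e) / real b ^ (2 * n) \<le> c"
proof -
  have "(\<Sum>d\<in>digit_vecs b n. \<Sum>e\<in>digit_vecs b n. X d e) \<le> (\<Sum>d\<in>digit_vecs b n. c * real b ^ n)"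
    by (intro sum_mono assms(2))
  also have "\<dots> = c * real b ^ (2 * n)" by (simp add: card_digit_vecs mult_2 power_add)
  finally show ?thesis using assms(1) by (simp add: pos_divide_le_eq)
qed

lemma sum_digit_vecs_le:
  assumes "\<And>e. e \<in> digit_vecs b n \<Longrightarrow> X e \<le> c"
  shows "(\<Sum>e\<in>digit_vecs b n. X e) \<le> c * real b ^ n"
proof -
  have "(\<Sum>e\<in>digit_vecs b n. X e) \<le> (\<Sum>e\<in>digit_vecs b n. c)" by (intro sum_mono assms)
  thus ?thesis by (simp add: card_digit_vecs mult.commute)
qed

text \<open>\<open>mu r n k\<close> is the weight \<open>\<mu>\<^sub>r\<close> of the integer whose \<open>b\<close>-adic digits are \<open>k 1, \<dots>, k n\<close>, lowest first:
  the sum of the \<open>r\<close> largest positions of nonzero digits.\<close>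

definition positions :: "nat \<Rightarrow> (nat \<Rightarrow> nat) \<Rightarrow> nat list" where
  "positions n k = rev (sorted_list_of_set {i \<in> {1..n}. k i \<noteq> 0})"

definition mu :: "nat \<Rightarrow> nat \<Rightarrow> (nat \<Rightarrow> nat) \<Rightarrow> nat" where
  "mu r n k = sum_list (take r (positions n k))"

lemma set_positions: "set (positions n k) = {i \<in> {1..n}. k i \<noteq> 0}"
  by (simp add: positions_def)

lemma distinct_positions: "distinct (positions n k)"
  by (simp add: positions_def)

text \<open>The kernel is treated termwise. Every smooth term tolerates differences of any order and
  gains a full step weight in each variable; only the truncated power calls for a distinction by the
  number of nonzero digits.\<close>

lemma walsh_coeff_sob_ker_bound:
  assumes b: "2 \<le> b" and \<alpha>: "2 \<le> \<alpha>"
  shows "\<exists>D\<ge>0. \<forall>n. \<forall>k\<in>digit_vecs b n. norm (walsh_coeff b n (sob_ker \<alpha>) k) \<le> D / real b ^ (2 * mu \<alpha> n k)"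
proof -
  have b0: "0 < b" using b by simp
  obtain M where M: "M \<ge> 1" "\<And>n x. n \<le> 2 * \<alpha> \<Longrightarrow> x \<in> {-3..3} \<Longrightarrow> \<bar>nbern n x\<bar> \<le> M"
    using nbern_bounded[of "2 * \<alpha>"] by blast
  have M0: "0 \<le> M" using M by simp
  define p where "p = 2 * \<alpha> - 1"
  define D where "D = \<alpha> * M\<^sup>2 + (M + (3 ^ p + 6))"
  have "norm (walsh_coeff b n (sob_ker \<alpha>) k) \<le> D * real b ^ (2 * \<alpha>) / real b ^ (2 * mu \<alpha> n k)"
    if k: "k \<in> digit_vecs b n" for n k
  proof -
    \<comment> \<open>The highest nonzero positions of k, at most \<alpha> of them, reversed into
      increasing order.\<close>
    define as where "as = rev (take \<alpha> (positions n k))"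
    have "as = drop (length (positions n k) - \<alpha>) (sorted_list_of_set {i \<in> {1..n}. k i \<noteq> 0})"
      by (simp add: as_def positions_def rev_take)
    hence sorted: "sorted as" by (simp add: sorted_wrt_drop)
    have dist: "distinct as" by (simp add: as_def distinct_positions)
    have set_as: "set as \<subseteq> {i \<in> {1..n}. k i \<noteq> 0}"
      unfolding as_def using set_take_subset[of \<alpha> "positions n k"] by (simp add: set_positions)
    hence sub: "set as \<subseteq> {1..n}" by auto
    have cond: "a \<in> {1..n} \<and> 0 < k a \<and> k a < b" if "a \<in> set as" for a
      using set_as that digit_vecs_less[OF k, of a] by auto
    have len: "length as \<le> \<alpha>" by (simp add: as_def)
    define q where "q = (step_weight b as)\<^sup>2"
    have q0: "0 \<le> q" by (simp add: q_def)
    note N = norm_walsh_coeff_le[OF b0 cond, of as]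
    have 1: "norm (walsh_coeff b n (\<lambda>x y. nbern r x * nbern r y) k) \<le> M\<^sup>2 * q" if "r \<in> {1..\<alpha>}" for r
      using that unfolding q_def power_mult_distrib[symmetric]
      by (intro order.trans[OF N] double_average_le sum_digit_vecs_le b0
          ddif_nbern_prod_bound[OF M(2) M0 _ b0 dist sub]) auto
    have 2: "norm (walsh_coeff b n (\<lambda>x y. nbern (2 * \<alpha>) (x - y)) k) \<le> M * q"
      unfolding q_def
      by (intro order.trans[OF N] double_average_le sum_digit_vecs_le b0
          ddif_nbern_diff_bound[OF M(2) M0 b0 dist sub]) auto
    have 3: "norm (walsh_coeff b n (\<lambda>x y. tpower p (y - x)) k) \<le> (3 ^ p + 6) * q"
    \<comment> \<open>With \<alpha> positions there are 2 \<alpha> differences, one more than the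
      degree; then the sum over e is estimated as a whole. With fewer positions the pointwise bound
      suffices.\<close>
    proof (cases "length as = \<alpha>")
      case True
      have "norm (walsh_coeff b n (\<lambda>x y. tpower p (y - x)) k) \<le> 6 * q"
        unfolding q_def p_def using \<alpha>
        by (intro order.trans[OF N] double_average_le b0 sum_ddif_tpower_bound[OF b sorted dist sub True]) auto
      also have "\<dots> \<le> (3 ^ p + 6) * q" using q0 by (intro mult_right_mono) auto
      finally show ?thesis .
    next
      case False
      hence lt: "2 * length as < p" using len unfolding p_def by linarith
      have "norm (walsh_coeff b n (\<lambda>x y. tpower p (y - x)) k) \<le> 3 ^ p * q"
        unfolding q_def
        by (intro order.trans[OF N] double_average_le sum_digit_vecs_le b0
            ddif_tpower_bound[OF lt b0 dist sub]) auto
      also have "\<dots> \<le> (3 ^ p + 6) * q" using q0 by (intro mult_right_mono) auto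
      finally show ?thesis .
    qed
    have "sob_ker \<alpha> = (\<lambda>x y. (\<Sum>r=1..\<alpha>. nbern r x * nbern r y) +
        (-1) ^ (\<alpha> + 1) * (nbern (2 * \<alpha>) (x - y) + - 1 * tpower p (y - x)))"
      using \<alpha> by (intro ext, subst sob_ker_altdef) (simp_all add: p_def)
    hence eq: "walsh_coeff b n (sob_ker \<alpha>) k = (\<Sum>r=1..\<alpha>. walsh_coeff b n (\<lambda>x y. nbern r x * nbern r y) k) +
        of_real ((-1) ^ (\<alpha> + 1)) * (walsh_coeff b n (\<lambda>x y. nbern (2 * \<alpha>) (x - y)) k +
          of_real (- 1) * walsh_coeff b n (\<lambda>x y. tpower p (y - x)) k)"
      by (simp only: walsh_coeff_add walsh_coeff_cmult walsh_coeff_sum)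
    have "norm (walsh_coeff b n (sob_ker \<alpha>) k) \<le>
        norm (\<Sum>r=1..\<alpha>. walsh_coeff b n (\<lambda>x y. nbern r x * nbern r y) k) +
        norm (walsh_coeff b n (\<lambda>x y. nbern (2 * \<alpha>) (x - y)) k - walsh_coeff b n (\<lambda>x y. tpower p (y - x)) k)"
      unfolding eq by (rule order.trans[OF norm_triangle_ineq]) (simp add: norm_mult norm_power)
    also have "\<dots> \<le> (\<Sum>r=1..\<alpha>. M\<^sup>2 * q) + (M * q + (3 ^ p + 6) * q)"
      by (intro add_mono sum_norm_le 1 order.trans[OF norm_triangle_ineq4] 2 3)
    also have "\<dots> = D * q" by (simp add: D_def algebra_simps)
    \<comment> \<open>There may be fewer than \<alpha> positions; the power of b coming from the
      digit bounds is enlarged to a constant.\<close>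
    also have "q \<le> real b ^ (2 * \<alpha>) / real b ^ (2 * mu \<alpha> n k)"
    proof -
      have s: "sum_list as = mu \<alpha> n k" by (simp add: as_def mu_def)
      have "q = real b ^ (2 * length as) / real b ^ (2 * mu \<alpha> n k)"
        unfolding q_def step_weight_eq s by (simp add: power_divide power_mult[symmetric] mult.commute)
      also have "\<dots> \<le> real b ^ (2 * \<alpha>) / real b ^ (2 * mu \<alpha> n k)"
        using len b by (intro divide_right_mono power_increasing) auto
      finally show ?thesis .
    qed
    hence "D * q \<le> D * (real b ^ (2 * \<alpha>) / real b ^ (2 * mu \<alpha> n k))"
      using M0 by (intro mult_left_mono) (auto simp: D_def)
    finally show ?thesis by simp
  qed
  moreover have "D * real b ^ (2 * \<alpha>) \<ge> 0" using M0 by (auto simp: D_def)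
  ultimately show ?thesis by blast
qed

text \<open>At frequency zero the weight \<open>mu\<close> is 0 and gives no decay. The coefficient
  is the grid mean of a kernel with integral zero, so only the discretisation error of order 1 / b^n
  remains.\<close>

lemma walsh_coeff_sob_ker_0:
  assumes b: "2 \<le> b" and \<alpha>: "2 \<le> \<alpha>"
  shows "\<exists>D\<ge>0. \<forall>n k. (\<forall>i\<in>{1..n}. k i = 0) \<longrightarrow> norm (walsh_coeff b n (sob_ker \<alpha>) k) \<le> D / real b ^ n"
proof -
  have b0: "0 < b" using b by simp
  obtain L where L: "L \<ge> 0" "\<And>x M. x \<in> {0..1} \<Longrightarrow> M \<ge> 1 \<Longrightarrow> \<bar>\<Sum>i<M. sob_ker \<alpha> x (real i / real M)\<bar> \<le> L"
    using sob_ker_riemann[OF \<alpha>] by blast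
  have "norm (walsh_coeff b n (sob_ker \<alpha>) k) \<le> L / real b ^ n" if k: "\<forall>i\<in>{1..n}. k i = 0" for n k
  proof -
    have "walsh_coeff b n (sob_ker \<alpha>) k =
       of_real ((\<Sum>d\<in>digit_vecs b n. \<Sum>e\<in>digit_vecs b n. sob_ker \<alpha> (dval b n d) (dval b n e)) / real b ^ (2 * n))"
      unfolding walsh_coeff_def using k by simp
    hence "norm (walsh_coeff b n (sob_ker \<alpha>) k) =
       \<bar>\<Sum>d\<in>digit_vecs b n. \<Sum>e\<in>digit_vecs b n. sob_ker \<alpha> (dval b n d) (dval b n e)\<bar> / real b ^ (2 * n)"
      by (simp only: norm_of_real abs_divide) simp
    also have "\<dots> \<le> (\<Sum>d\<in>digit_vecs b n. L) / real b ^ (2 * n)"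
    proof (rule divide_right_mono, rule order.trans[OF sum_abs], rule sum_mono)
      fix d assume d: "d \<in> digit_vecs b n"
      show "\<bar>\<Sum>e\<in>digit_vecs b n. sob_ker \<alpha> (dval b n d) (dval b n e)\<bar> \<le> L"
        unfolding sum_dval[OF b, of "sob_ker \<alpha> (dval b n d)"]
        using L(2)[of "dval b n d" "b ^ n"] dval_bounds[OF b0 d] b0 by simp
    qed simp
    also have "\<dots> = L / real b ^ n" using b0 by (simp add: card_digit_vecs mult_2 power_add)
    finally show ?thesis .
  qed
  with L(1) show ?thesis by blast
qed

section \<open>Summation over the dual net\<close>

lemma sum_list_le_const:
  fixes xs :: "nat list"
  assumes "\<And>x. x \<in> set xs \<Longrightarrow> x \<le> c" "length xs \<le> q" shows "sum_list xs \<le> q * c"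
  using assms
proof (induction xs arbitrary: q)
  case (Cons x xs)
  then obtain q' where "q = Suc q'" by (cases q) auto
  with Cons show ?case by (auto intro!: add_mono)
qed simp

lemma sum_list_ge_const:
  fixes xs :: "nat list"
  assumes "\<And>x. x \<in> set xs \<Longrightarrow> c \<le> x" shows "length xs * c \<le> sum_list xs"
  using assms by (induction xs) (auto intro!: add_mono)

text \<open>In a decreasing list longer averages are smaller: the entry \<open>c\<close> of index p
  bounds the first p entries from below and the later ones from above. Entries missing from a short
  list count as zeros.\<close>

lemma sum_list_take_average:
  fixes xs :: "nat list"
  assumes "sorted_wrt (\<ge>) xs" "p \<le> q"
  shows "p * sum_list (take q xs) \<le> q * sum_list (take p xs)"
proof -
  have split: "sum_list (take q xs) = sum_list (take p xs) + sum_list (take (q - p) (drop p xs))"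
    using assms(2) by (metis le_add_diff_inverse sum_list_append take_add)
  show ?thesis
  proof (cases "length xs \<le> p")
    case True
    thus ?thesis using split assms(2) by simp
  next
    case False
    define c where "c = xs ! p"
    have "x \<le> c" if "x \<in> set (take (q - p) (drop p xs))" for x
    proof -
      have "x \<in> set (drop p xs)" using that in_set_takeD by metis
      moreover have "drop p xs = c # drop (Suc p) xs" using False by (simp add: c_def Cons_nth_drop_Suc)
      moreover have "sorted_wrt (\<ge>) (drop p xs)" using assms(1) by (rule sorted_wrt_drop)
      ultimately show ?thesis by auto
    qed
    hence 1: "sum_list (take (q - p) (drop p xs)) \<le> (q - p) * c" by (intro sum_list_le_const) auto
    have "c \<le> x" if "x \<in> set (take p xs)" for x
    proof -
      have "\<forall>x\<in>set (take p xs). \<forall>y\<in>set (drop p xs). y \<le> x"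
        using assms(1) sorted_wrt_append[of "(\<ge>)" "take p xs" "drop p xs"] by simp
      moreover have "c \<in> set (drop p xs)" using False by (simp add: c_def Cons_nth_drop_Suc[symmetric])
      ultimately show ?thesis using that by blast
    qed
    from sum_list_ge_const[where xs = "take p xs", OF this] have 2: "p * c \<le> sum_list (take p xs)" using False by simp
    have "p * sum_list (take (q - p) (drop p xs)) \<le> p * ((q - p) * c)" using 1 by (rule mult_le_mono2)
    also have "\<dots> = (q - p) * (p * c)" by simp
    also have "\<dots> \<le> (q - p) * sum_list (take p xs)" using 2 by (rule mult_le_mono2)
    finally have "p * sum_list (take q xs) \<le> (p + (q - p)) * sum_list (take p xs)"
      unfolding split by (simp add: algebra_simps)
    thus ?thesis using assms(2) by simp
  qed
qed

lemma sorted_positions: "sorted_wrt (\<ge>) (positions n k)"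
  by (simp add: positions_def sorted_wrt_rev)

text \<open>This interpolation inequality is what trades the order \<open>\<beta>\<close> net property against the counting of
  dual vectors by their leading positions.\<close>

lemma mu_interpolation:
  assumes "1 \<le> \<alpha>" "\<alpha> \<le> \<beta>"
  shows "(\<alpha> - 1) * mu \<beta> n k + (\<beta> - \<alpha>) * mu 1 n k \<le> (\<beta> - 1) * mu \<alpha> n k"
proof (cases "positions n k")
  case Nil
  thus ?thesis by (simp add: mu_def)
next
  case (Cons x ys)
  obtain a c where ac: "\<alpha> = Suc a" "\<beta> = Suc (a + c)"
    using assms by (metis Suc_le_D One_nat_def le_add_diff_inverse add_Suc)
  \<comment> \<open>The leading position has coefficient \<beta> - 1 on both sides and cancels; what
    remains compares averages of the tail.\<close>
  have "sorted_wrt (\<ge>) ys" using sorted_positions[of n k] Cons by simp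
  from sum_list_take_average[OF this, of a "a + c"] show ?thesis
    by (simp add: mu_def Cons ac algebra_simps)
qed

lemma mu_le: "mu r n k \<le> r * mu 1 n k"
  using sum_list_take_average[OF sorted_positions, of 1 r n k] by (cases r) (auto simp: mu_def)

lemma mu_1_ge: "i \<in> {1..n} \<Longrightarrow> k i \<noteq> 0 \<Longrightarrow> i \<le> mu 1 n k"
proof -
  assume "i \<in> {1..n}" "k i \<noteq> 0"
  hence "i \<in> set (positions n k)" by (simp add: set_positions)
  thus ?thesis using sorted_positions[of n k] by (cases "positions n k") (auto simp: mu_def)
qed

lemma mu_1_le:
  assumes "\<And>i. i \<in> {1..n} \<Longrightarrow> k i \<noteq> 0 \<Longrightarrow> i \<le> l" shows "mu 1 n k \<le> l"
proof (cases "positions n k")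
  case (Cons x ys)
  hence "x \<in> {1..n} \<and> k x \<noteq> 0" using set_positions[of n k] by auto
  thus ?thesis using assms Cons by (simp add: mu_def)
qed (simp add: mu_def)

section \<open>From independent rows to heavy dual vectors\<close>

lemma sum_nth_eq_sum_list: "(\<Sum>l=1..length xs. g (xs ! (l - 1))) = sum_list (map g xs)"
  unfolding One_nat_def sum.atLeast1_atMost_eq by (simp add: sum_list_sum_nth atLeast0LessThan)

lemma sum_nth_take: "(\<Sum>l=1..min r (length xs). (xs ! (l - 1) :: nat)) = sum_list (take r xs)"
proof -
  have "(\<Sum>l=1..min r (length xs). xs ! (l - 1)) = (\<Sum>l=1..length (take r xs). take r xs ! (l - 1))"
    by (intro sum.cong) auto
  also have "\<dots> = sum_list (take r xs)" using sum_nth_eq_sum_list[of "\<lambda>x. x" "take r xs"] by simp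
  finally show ?thesis .
qed

text \<open>The quantified clause of \<open>order_digital_net\<close>, isolated for fixed
  matrices.\<close>

definition net_condition :: "nat \<Rightarrow> nat \<Rightarrow> nat \<Rightarrow> nat \<Rightarrow> nat \<Rightarrow> nat \<Rightarrow> (nat \<Rightarrow> nat \<Rightarrow> nat \<Rightarrow> nat) \<Rightarrow> bool" where
  "net_condition b \<beta> t m s n C \<longleftrightarrow>
     (\<forall>(v :: nat \<Rightarrow> nat) (i :: nat \<Rightarrow> nat \<Rightarrow> nat).
           (\<forall>j\<in>{1..s}. (\<forall>l\<in>{1..v j}. i j l \<in> {1..n}) \<and>
                        (\<forall>l\<in>{1..v j}. \<forall>l'\<in>{1..v j}. l < l' \<longrightarrow> i j l' < i j l)) \<and>
           (\<Sum>j=1..s. \<Sum>l=1..min \<beta> (v j). i j l) \<le> \<beta> * m - t \<longrightarrow>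
           lin_indep_family b m (SIGMA j:{1..s}. {1..v j}) (\<lambda>(j, l). C j (i j l)))"

definition zero_vec :: "nat \<Rightarrow> nat set \<Rightarrow> (nat \<Rightarrow> nat \<Rightarrow> nat)" where
  "zero_vec n u = (\<lambda>j\<in>u. \<lambda>i\<in>{1..n}. 0)"

lemma eq_zero_vec:
  assumes "\<kappa> \<in> u \<rightarrow>\<^sub>E digit_vecs b n" "\<And>j i. j \<in> u \<Longrightarrow> i \<in> {1..n} \<Longrightarrow> \<kappa> j i = 0"
  shows "\<kappa> = zero_vec n u"
proof
  fix j
  show "\<kappa> j = zero_vec n u j"
  proof (cases "j \<in> u")
    case True
    hence "\<kappa> j \<in> digit_vecs b n" using assms(1) by (auto simp: PiE_iff)
    thus ?thesis using assms(2)[OF True] True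
      by (auto simp: zero_vec_def digit_vecs_def PiE_iff extensional_def)
  qed (use assms(1) in \<open>auto simp: zero_vec_def PiE_iff extensional_def\<close>)
qed

text \<open>A dual vector is a linear relation among the rows at its nonzero positions, with nonzero
  coefficients. If its weight were within the bound, these rows would be an admissible choice and
  hence independent.\<close>

lemma dual_net_weight:
  assumes net: "net_condition b \<beta> t m s n C" and u: "u \<subseteq> {1..s}"
    and \<kappa>: "\<kappa> \<in> dual_net b n m C u" "\<kappa> \<noteq> zero_vec n u"
  shows "\<beta> * m - t < (\<Sum>j\<in>u. mu \<beta> n (\<kappa> j))"
proof (rule ccontr)
  assume contr: "\<not> ?thesis"
  have mem: "\<kappa> \<in> u \<rightarrow>\<^sub>E digit_vecs b n" and dual: "\<And>k. k < m \<Longrightarrow> b dvd (\<Sum>j\<in>u. \<Sum>i=1..n. \<kappa> j i * C j i k)"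
    using \<kappa>(1) by (auto simp: dual_net_def)
  \<comment> \<open>Outside \<open>u\<close> the list is empty, so no row is chosen there.\<close>
  define xs where "xs j = (if j \<in> u then positions n (\<kappa> j) else [])" for j
  define v where "v j = length (xs j)" for j
  define i where "i j l = xs j ! (l - 1)" for j l
  have xs: "x \<in> {1..n} \<and> \<kappa> j x \<noteq> 0 \<and> j \<in> u" if "x \<in> set (xs j)" for x j
    using that by (auto simp: xs_def set_positions split: if_splits)
  have i_in: "i j l \<in> set (xs j)" if "l \<in> {1..v j}" for j l
    using that by (auto simp: i_def v_def)
  have dec: "i j l' < i j l" if "l \<in> {1..v j}" "l' \<in> {1..v j}" "l < l'" for j l l'
  proof -
    have "sorted_wrt (\<ge>) (xs j)" "distinct (xs j)"
      by (auto simp: xs_def sorted_positions distinct_positions)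
    moreover have "l - 1 < l' - 1" "l' - 1 < length (xs j)" "l - 1 < length (xs j)" using that by (auto simp: v_def)
    ultimately show ?thesis
      unfolding i_def by (metis le_neq_implies_less nth_eq_iff_index_eq nat_neq_iff sorted_wrt_iff_nth_less)
  qed
  have "(\<Sum>j=1..s. \<Sum>l=1..min \<beta> (v j). i j l) = (\<Sum>j=1..s. sum_list (take \<beta> (xs j)))"
    unfolding i_def v_def sum_nth_take ..
  also have "\<dots> = (\<Sum>j\<in>u. mu \<beta> n (\<kappa> j))"
    using u by (intro sum.mono_neutral_cong_right) (auto simp: xs_def mu_def)
  finally have "(\<Sum>j=1..s. \<Sum>l=1..min \<beta> (v j). i j l) \<le> \<beta> * m - t" using contr by simp
  hence lin: "lin_indep_family b m (SIGMA j:{1..s}. {1..v j}) (\<lambda>(j, l). C j (i j l))"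
    using net[unfolded net_condition_def, rule_format, of v i] i_in xs dec by blast
  \<comment> \<open>The coefficients of the relation are the digits of \<open>\<kappa>\<close> at
    the chosen positions.\<close>
  define a where "a p = \<kappa> (fst p) (i (fst p) (snd p))" for p
  have ab: "a p < b" if p: "p \<in> (SIGMA j:{1..s}. {1..v j})" for p
  proof -
    have x: "i (fst p) (snd p) \<in> {1..n}" "fst p \<in> u" using p i_in[of "snd p" "fst p"] xs by auto
    hence "\<kappa> (fst p) \<in> digit_vecs b n" using mem by (auto simp: PiE_iff)
    thus ?thesis unfolding a_def using x(1) by (rule digit_vecs_less)
  qed
  have am: "(\<Sum>p\<in>(SIGMA j:{1..s}. {1..v j}). a p * (\<lambda>(j, l). C j (i j l)) p k) mod b = 0" if k: "k < m" for k
  proof -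
    have "(\<Sum>p\<in>(SIGMA j:{1..s}. {1..v j}). a p * (\<lambda>(j, l). C j (i j l)) p k) =
        (\<Sum>j=1..s. \<Sum>l=1..v j. \<kappa> j (i j l) * C j (i j l) k)"
      by (subst sum.Sigma) (auto simp: a_def case_prod_beta)
    also have "\<dots> = (\<Sum>j=1..s. sum_list (map (\<lambda>x. \<kappa> j x * C j x k) (xs j)))"
      unfolding i_def v_def using sum_nth_eq_sum_list[of "\<lambda>x. \<kappa> _ x * C _ x k"] by simp
    also have "\<dots> = (\<Sum>j\<in>u. sum_list (map (\<lambda>x. \<kappa> j x * C j x k) (positions n (\<kappa> j))))"
      using u by (intro sum.mono_neutral_cong_right) (auto simp: xs_def)
    also have "\<dots> = (\<Sum>j\<in>u. \<Sum>i=1..n. \<kappa> j i * C j i k)"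
    proof (intro sum.cong refl)
      fix j assume "j \<in> u"
      have "sum_list (map (\<lambda>x. \<kappa> j x * C j x k) (positions n (\<kappa> j))) = (\<Sum>x\<in>set (positions n (\<kappa> j)). \<kappa> j x * C j x k)"
        by (rule sum_list_distinct_conv_sum_set[OF distinct_positions])
      also have "\<dots> = (\<Sum>i=1..n. \<kappa> j i * C j i k)"
        by (intro sum.mono_neutral_left) (auto simp: set_positions)
      finally show "sum_list (map (\<lambda>x. \<kappa> j x * C j x k) (positions n (\<kappa> j))) = (\<Sum>i=1..n. \<kappa> j i * C j i k)" .
    qed
    finally show ?thesis using dual[OF k] by simp
  qed
  have zero: "\<forall>p\<in>(SIGMA j:{1..s}. {1..v j}). a p = 0"
    by (rule lin[unfolded lin_indep_family_def, THEN spec, THEN mp]) (intro conjI ballI allI impI ab am)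
  have "\<kappa> j x = 0" if j: "j \<in> u" and x: "x \<in> {1..n}" for j x
  proof (rule ccontr)
    assume nz: "\<kappa> j x \<noteq> 0"
    hence "x \<in> set (xs j)" using j x by (simp add: xs_def set_positions)
    then obtain l where l: "l < v j" "x = xs j ! l" by (auto simp: in_set_conv_nth v_def)
    hence "(j, Suc l) \<in> (SIGMA j:{1..s}. {1..v j})" using u j by auto
    hence "a (j, Suc l) = 0" using zero by blast
    thus False using nz l by (simp add: a_def i_def)
  qed
  thus False using eq_zero_vec[OF mem] \<kappa>(2) by blast
qed

section \<open>Counting dual vectors by leading positions\<close>

lemma exists_smaller_sum:
  fixes l :: "'i \<Rightarrow> nat"
  assumes "finite u" "\<tau> \<le> (\<Sum>j\<in>u. l j)"
  shows "\<exists>l'. (\<forall>j\<in>u. l' j \<le> l j) \<and> (\<Sum>j\<in>u. l' j) = \<tau>"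
  using assms
proof (induction u arbitrary: \<tau> rule: finite_induct)
  case (insert j u)
  have "\<tau> - min \<tau> (l j) \<le> (\<Sum>j\<in>u. l j)" using insert by simp
  from insert.IH[OF this] obtain l' where l': "\<forall>j\<in>u. l' j \<le> l j" "(\<Sum>j\<in>u. l' j) = \<tau> - min \<tau> (l j)" by blast
  have "(\<Sum>i\<in>insert j u. (l'(j := min \<tau> (l j))) i) = min \<tau> (l j) + (\<Sum>i\<in>u. l' i)"
    using insert.hyps by (simp add: sum.insert) (intro sum.cong, auto)
  thus ?case using l' insert.hyps by (intro exI[of _ "l'(j := min \<tau> (l j))"]) auto
qed simp

text \<open>Vectors that agree on the positions between \<open>l' j\<close> and \<open>l j\<close> differ by a dual vector too light to
  be nonzero.\<close>

lemma card_dual_le: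
  assumes b: "0 < b" and u: "finite u"
    and light: "\<And>\<kappa>. \<kappa> \<in> dual_net b n m C u \<Longrightarrow> (\<Sum>j\<in>u. mu 1 n (\<kappa> j)) \<le> \<tau> \<Longrightarrow> \<kappa> = zero_vec n u"
    and l: "\<tau> \<le> (\<Sum>j\<in>u. l j)"
  shows "card {\<kappa> \<in> dual_net b n m C u. \<forall>j\<in>u. mu 1 n (\<kappa> j) \<le> l j} \<le> b ^ ((\<Sum>j\<in>u. l j) - \<tau>)"
proof -
  let ?A = "{\<kappa> \<in> dual_net b n m C u. \<forall>j\<in>u. mu 1 n (\<kappa> j) \<le> l j}"
  \<comment> \<open>The lower thresholds sum to exactly \<tau>, so vectors below them are zero and
    at most the sum of the l j minus \<tau> digits remain free.\<close>
  obtain l' where l': "\<And>j. j \<in> u \<Longrightarrow> l' j \<le> l j" "(\<Sum>j\<in>u. l' j) = \<tau>"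
    using exists_smaller_sum[OF u l] by blast
  define \<Phi> where "\<Phi> \<kappa> = (\<lambda>j\<in>u. \<lambda>i\<in>{l' j<..l j} \<inter> {1..n}. \<kappa> j i)" for \<kappa> :: "nat \<Rightarrow> nat \<Rightarrow> nat"
  let ?B = "PiE u (\<lambda>j. PiE ({l' j<..l j} \<inter> {1..n}) (\<lambda>_. {0..<b}))"
  have digits: "\<kappa> j i < b" if "\<kappa> \<in> dual_net b n m C u" "j \<in> u" "i \<in> {1..n}" for \<kappa> j i
    using that digit_vecs_less[of "\<kappa> j" b n i] by (auto simp: dual_net_def PiE_iff)
  have "inj_on \<Phi> ?A"
  proof (rule inj_onI)
    fix \<kappa> \<kappa>' assume k: "\<kappa> \<in> ?A" "\<kappa>' \<in> ?A" and eq: "\<Phi> \<kappa> = \<Phi> \<kappa>'"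
    \<comment> \<open>The digitwise difference modulo b; adding b before subtracting keeps it in the
      natural numbers.\<close>
    define \<delta> where "\<delta> = (\<lambda>j\<in>u. \<lambda>i\<in>{1..n}. (\<kappa> j i + (b - \<kappa>' j i)) mod b)"
    have dd: "int b dvd int (\<delta> j i) - (int (\<kappa> j i) - int (\<kappa>' j i))" if ji: "j \<in> u" "i \<in> {1..n}" for j i
    proof -
      have "int b dvd int (\<delta> j i) - int (\<kappa> j i + (b - \<kappa>' j i))"
        unfolding mod_eq_iff_int_dvd[symmetric] using ji by (simp add: \<delta>_def)
      hence "int b dvd int (\<delta> j i) - int (\<kappa> j i + (b - \<kappa>' j i)) + int b" by simp
      also have "int (\<delta> j i) - int (\<kappa> j i + (b - \<kappa>' j i)) + int b = int (\<delta> j i) - (int (\<kappa> j i) - int (\<kappa>' j i))"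
        using digits[of \<kappa>' j i] k ji by (simp add: of_nat_diff)
      finally show ?thesis .
    qed
    have \<delta>: "\<delta> \<in> dual_net b n m C u"
      unfolding dual_net_def
    proof (intro CollectI conjI allI impI)
      show "\<delta> \<in> u \<rightarrow>\<^sub>E digit_vecs b n" using b by (auto simp: \<delta>_def digit_vecs_def)
      fix c assume c: "c < m"
      have "int b dvd (\<Sum>j\<in>u. \<Sum>i=1..n. (int (\<delta> j i) - (int (\<kappa> j i) - int (\<kappa>' j i))) * int (C j i c))"
        by (intro dvd_sum dvd_mult2 dd)
      moreover have "int b dvd int (\<Sum>j\<in>u. \<Sum>i=1..n. \<kappa> j i * C j i c)" "int b dvd int (\<Sum>j\<in>u. \<Sum>i=1..n. \<kappa>' j i * C j i c)"
        using k c unfolding int_dvd_int_iff by (auto simp: dual_net_def)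
      ultimately have "int b dvd (\<Sum>j\<in>u. \<Sum>i=1..n. (int (\<delta> j i) - (int (\<kappa> j i) - int (\<kappa>' j i))) * int (C j i c)) +
          (int (\<Sum>j\<in>u. \<Sum>i=1..n. \<kappa> j i * C j i c) - int (\<Sum>j\<in>u. \<Sum>i=1..n. \<kappa>' j i * C j i c))"
        by (intro dvd_add dvd_diff)
      also have "\<dots> = int (\<Sum>j\<in>u. \<Sum>i=1..n. \<delta> j i * C j i c)"
        by (simp add: left_diff_distrib sum_subtractf)
      finally show "b dvd (\<Sum>j\<in>u. \<Sum>i=1..n. \<delta> j i * C j i c)" by (simp only: int_dvd_int_iff)
    qed
    have eqi: "\<kappa> j i = \<kappa>' j i" if ji: "j \<in> u" "i \<in> {1..n}" "l' j < i" for j i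
    proof (cases "i \<le> l j")
      case True
      thus ?thesis using fun_cong[OF fun_cong[OF eq], of j i] ji by (simp add: \<Phi>_def)
    next
      case False
      hence "\<kappa> j i = 0" "\<kappa>' j i = 0" using mu_1_ge[of i n "\<kappa> j"] mu_1_ge[of i n "\<kappa>' j"] k ji by force+
      thus ?thesis by simp
    qed
    have "mu 1 n (\<delta> j) \<le> l' j" if j: "j \<in> u" for j
    proof (rule mu_1_le, rule ccontr)
      fix i assume i: "i \<in> {1..n}" "\<delta> j i \<noteq> 0" "\<not> i \<le> l' j"
      thus False using eqi[OF j, of i] digits[of \<kappa>' j i] k j by (simp add: \<delta>_def)
    qed
    hence "(\<Sum>j\<in>u. mu 1 n (\<delta> j)) \<le> \<tau>" unfolding l'(2)[symmetric] by (rule sum_mono)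
    hence z: "\<delta> = zero_vec n u" by (rule light[OF \<delta>])
    have "\<kappa> j i = \<kappa>' j i" if ji: "j \<in> u" "i \<in> {1..n}" for j i
    proof -
      have "\<delta> j i = 0" using z ji by (simp add: zero_vec_def)
      hence "int b dvd int (\<kappa>' j i) - int (\<kappa> j i)" using dd[OF ji] by simp
      thus ?thesis using digits[of \<kappa> j i] digits[of \<kappa>' j i] k ji by (intro int_dvd_diff_imp_eq[symmetric]) auto
    qed
    moreover have "\<kappa> \<in> u \<rightarrow>\<^sub>E digit_vecs b n" "\<kappa>' \<in> u \<rightarrow>\<^sub>E digit_vecs b n" using k by (auto simp: dual_net_def)
    ultimately show "\<kappa> = \<kappa>'"
      by (intro PiE_ext[of \<kappa> u "\<lambda>_. digit_vecs b n"] digit_vecs_ext[of _ b n]) (auto simp: PiE_iff)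
  qed
  moreover have "\<Phi> ` ?A \<subseteq> ?B"
    using digits by (auto simp: \<Phi>_def intro!: PiE_I split: if_splits)
  moreover have "finite ?B" using u by (intro finite_PiE) auto
  ultimately have "card ?A \<le> card ?B" by (rule card_inj_on_le)
  also have "card ?B = (\<Prod>j\<in>u. b ^ card ({l' j<..l j} \<inter> {1..n}))"
    using u by (simp add: card_PiE)
  also have "\<dots> \<le> (\<Prod>j\<in>u. b ^ (l j - l' j))"
  proof (intro prod_mono conjI power_increasing)
    fix j
    have "card ({l' j<..l j} \<inter> {1..n}) \<le> card {l' j<..l j}" by (intro card_mono) auto
    thus "card ({l' j<..l j} \<inter> {1..n}) \<le> l j - l' j" by simp
  qed (use b in auto)
  also have "\<dots> = b ^ ((\<Sum>j\<in>u. l j) - \<tau>)"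
    unfolding l'(2)[symmetric] using l' by (simp add: power_sum[symmetric] sum_subtractf_nat)
  finally show ?thesis .
qed

lemma finite_dual_net: "finite u \<Longrightarrow> finite (dual_net b n m C u)"
  by (rule finite_subset[of _ "u \<rightarrow>\<^sub>E digit_vecs b n"]) (auto simp: dual_net_def intro!: finite_PiE)

text \<open>All but one of the parts determine the last one. The exponent |u| - 1 becomes the power
  of the logarithm in the squared error.\<close>

lemma card_compositions:
  assumes "finite u" "u \<noteq> {}"
  shows "card {l \<in> u \<rightarrow>\<^sub>E {..z}. (\<Sum>j\<in>u. l j) = z} \<le> (z + 1) ^ (card u - 1)"
proof -
  let ?L = "{l \<in> u \<rightarrow>\<^sub>E {..z}. (\<Sum>j\<in>u. l j) = (z :: nat)}"
  obtain j0 where j0: "j0 \<in> u" using assms by blast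
  have split: "(\<Sum>j\<in>u. l j) = l j0 + (\<Sum>j\<in>u - {j0}. l j)" for l :: "'a \<Rightarrow> nat"
    using assms(1) j0 by (rule sum.remove)
  have "inj_on (\<lambda>l. restrict l (u - {j0})) ?L"
  proof (rule inj_onI)
    fix l l' assume l: "l \<in> ?L" "l' \<in> ?L" and eq: "restrict l (u - {j0}) = restrict l' (u - {j0})"
    have e: "l j = l' j" if "j \<in> u - {j0}" for j using fun_cong[OF eq, of j] that by simp
    hence "(\<Sum>j\<in>u - {j0}. l j) = (\<Sum>j\<in>u - {j0}. l' j)" by (intro sum.cong) auto
    hence "l j0 = l' j0" using l split[of l] split[of l'] by simp
    hence "l j = l' j" if "j \<in> u" for j using e that by (cases "j = j0") auto
    thus "l = l'" using l by (intro PiE_ext[of l u "\<lambda>_. {..z}"]) auto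
  qed
  moreover have "(\<lambda>l. restrict l (u - {j0})) ` ?L \<subseteq> (u - {j0}) \<rightarrow>\<^sub>E {..z}"
    by (auto simp: PiE_iff split: if_splits)
  moreover have "finite ((u - {j0}) \<rightarrow>\<^sub>E {..z})" using assms by (intro finite_PiE) auto
  ultimately have "card ?L \<le> card ((u - {j0}) \<rightarrow>\<^sub>E {..z})" by (rule card_inj_on_le)
  also have "\<dots> = (z + 1) ^ (card u - 1)" using assms j0 by (simp add: card_PiE)
  finally show ?thesis .
qed

text \<open>Union bound over the possible vectors of leading positions, each of which admits at most
  b^(z - \<tau>) dual vectors.\<close>

lemma card_dual_weight_eq:
  assumes b: "0 < b" and u: "finite u" "u \<noteq> {}"
    and light: "\<And>\<kappa>. \<kappa> \<in> dual_net b n m C u \<Longrightarrow> (\<Sum>j\<in>u. mu 1 n (\<kappa> j)) \<le> \<tau> \<Longrightarrow> \<kappa> = zero_vec n u"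
    and z: "\<tau> \<le> z"
  shows "card {\<kappa> \<in> dual_net b n m C u. (\<Sum>j\<in>u. mu 1 n (\<kappa> j)) = z} \<le> (z + 1) ^ (card u - 1) * b ^ (z - \<tau>)"
proof -
  let ?L = "{l \<in> u \<rightarrow>\<^sub>E {..z}. (\<Sum>j\<in>u. l j) = z}"
  let ?A = "\<lambda>l. {\<kappa> \<in> dual_net b n m C u. \<forall>j\<in>u. mu 1 n (\<kappa> j) \<le> l j}"
  have finL: "finite ?L" by (rule finite_subset[of _ "u \<rightarrow>\<^sub>E {..z}"]) (use u in \<open>auto intro!: finite_PiE\<close>)
  have "{\<kappa> \<in> dual_net b n m C u. (\<Sum>j\<in>u. mu 1 n (\<kappa> j)) = z} \<subseteq> (\<Union>l\<in>?L. ?A l)"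
  proof
    fix \<kappa> assume k: "\<kappa> \<in> {\<kappa> \<in> dual_net b n m C u. (\<Sum>j\<in>u. mu 1 n (\<kappa> j)) = z}"
    define l where "l = (\<lambda>j\<in>u. mu 1 n (\<kappa> j))"
    have "mu 1 n (\<kappa> j) \<le> z" if "j \<in> u" for j
      using k member_le_sum[of j u "\<lambda>j. mu 1 n (\<kappa> j)"] that u by auto
    hence "l \<in> ?L" using k by (auto simp: l_def)
    moreover have "\<kappa> \<in> ?A l" using k by (auto simp: l_def)
    ultimately show "\<kappa> \<in> (\<Union>l\<in>?L. ?A l)" by blast
  qed
  hence "card {\<kappa> \<in> dual_net b n m C u. (\<Sum>j\<in>u. mu 1 n (\<kappa> j)) = z} \<le> card (\<Union>l\<in>?L. ?A l)"
    by (intro card_mono finite_UN_I finL) (use finite_dual_net[OF u(1)] in auto)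
  also have "\<dots> \<le> (\<Sum>l\<in>?L. card (?A l))" by (rule card_UN_le[OF finL])
  also have "\<dots> \<le> (\<Sum>l\<in>?L. b ^ (z - \<tau>))"
  proof (rule sum_mono)
    fix l assume l: "l \<in> ?L"
    thus "card (?A l) \<le> b ^ (z - \<tau>)" using card_dual_le[OF b u(1) light, where l = l] z by auto
  qed
  also have "\<dots> = card ?L * b ^ (z - \<tau>)" by simp
  also have "\<dots> \<le> (z + 1) ^ (card u - 1) * b ^ (z - \<tau>)" by (intro mult_le_mono1 card_compositions u)
  finally show ?thesis .
qed

section \<open>The series over the dual net\<close>

lemma summable_poly_geometric:
  fixes \<rho> :: real
  assumes "0 < \<rho>" "\<rho> < 1"
  shows "summable (\<lambda>w. (real w + 1) ^ c * \<rho> ^ w)"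
proof -
  \<comment> \<open>Half of the decay rate of \<rho>: one half absorbs the polynomial through
    \<open>x ^ c / fact c \<le> exp x\<close>, the other half remains as geometric ratio.\<close>
  define h where "h = - ln \<rho> / 2"
  have h: "h > 0" using assms by (simp add: h_def)
  have e: "x ^ c / fact c \<le> exp x" if "x \<ge> 0" for x :: real
  proof -
    have "(\<Sum>i\<in>{c}. x ^ i /\<^sub>R fact i) \<le> exp x"
      unfolding exp_def using that summable_exp_generic[of x] by (intro sum_le_suminf) auto
    thus ?thesis by (simp add: divide_inverse mult.commute)
  qed
  have r: "exp h * \<rho> = exp (- h)"
  proof -
    have "\<rho> = exp (- 2 * h)" using assms by (simp add: h_def)
    thus ?thesis by (simp add: exp_add[symmetric])
  qed
  have nb: "norm ((real w + 1) ^ c * \<rho> ^ w) \<le> fact c / h ^ c * exp h * exp (- h) ^ w" for w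
  proof -
    have "(h * (real w + 1)) ^ c / fact c \<le> exp (h * (real w + 1))" using h by (intro e) auto
    hence "(real w + 1) ^ c * h ^ c \<le> fact c * exp (h * (real w + 1))"
      unfolding power_mult_distrib by (simp add: pos_divide_le_eq mult.commute)
    hence "(real w + 1) ^ c \<le> fact c / h ^ c * exp (h * (real w + 1))"
      using h by (simp add: pos_le_divide_eq)
    hence "(real w + 1) ^ c * \<rho> ^ w \<le> fact c / h ^ c * exp (h * (real w + 1)) * \<rho> ^ w"
      using assms by (intro mult_right_mono) auto
    also have "\<dots> = fact c / h ^ c * exp h * (exp h * \<rho>) ^ w"
      by (simp add: distrib_left exp_add exp_of_nat_mult[symmetric] power_mult_distrib mult_ac)
    finally show ?thesis using assms unfolding r by simp
  qed
  have "summable (\<lambda>w. fact c / h ^ c * exp h * exp (- h) ^ w)"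
    using h by (intro summable_mult summable_geometric) simp
  thus ?thesis by (rule summable_comparison_test') (rule nb)
qed

text \<open>Interpolation splits each term into a fixed factor \<open>P\<close> and b^(- \<theta>
  \<open>M 1 \<kappa>\<close>). The number of vectors with \<open>M 1 \<kappa>\<close> equal to
  \<tau> + w grows like b^w up to a polynomial, and \<theta> > 1 makes the sum over w converge
  uniformly in m.\<close>

lemma dual_sum_bound:
  assumes b: "2 \<le> b" and \<alpha>: "2 \<le> \<alpha>" "2 * \<alpha> \<le> \<beta>" and u: "finite u" "u \<noteq> {}"
  shows "\<exists>K\<ge>0. \<forall>s m n C. u \<subseteq> {1..s} \<and> t \<le> \<beta> * m \<and> net_condition b \<beta> t m s n C \<longrightarrow>
    (\<Sum>\<kappa>\<in>dual_net b n m C u - {zero_vec n u}. 1 / real b ^ (2 * (\<Sum>j\<in>u. mu \<alpha> n (\<kappa> j))))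
      \<le> K * (real m + 1) ^ (card u - 1) / real b ^ (2 * \<alpha> * m)"
proof -
  define c where "c = card u - 1"
  define \<rho> where "\<rho> = real b powr (- 1 / (real \<beta> - 1))"
  \<comment> \<open>Twice the coefficient of \<open>\<mu>\<^sub>1\<close> in the interpolation
    inequality after division by \<beta> - 1; the 2 comes from the exponent 2
    \<open>\<mu>\<^sub>\<alpha>\<close>.\<close>
  define \<theta> where "\<theta> = 2 * (real \<beta> - real \<alpha>) / (real \<beta> - 1)"
  have b1: "real b > 1" using b by simp
  have \<beta>1: "real \<beta> - 1 > 0" using \<alpha> by simp
  have \<rho>: "0 < \<rho>" "\<rho> < 1" using b1 \<beta>1 by (auto simp: \<rho>_def powr_less_one)
  define S where "S = (\<Sum>w. (real w + 1) ^ c * \<rho> ^ w)"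
  have S_le: "(\<Sum>w\<in>A. (real w + 1) ^ c * \<rho> ^ w) \<le> S" if "finite A" for A
    unfolding S_def using that \<rho> by (intro sum_le_suminf summable_poly_geometric) auto
  have S0: "0 \<le> S" using S_le[of "{}"] by simp
  \<comment> \<open>Here \<beta> \<ge> 2 \<alpha> enters; the gap makes b^(1 - \<theta>) at most
    \<rho>, which is the ratio of the series.\<close>
  have \<theta>: "\<theta> - 1 \<ge> 1 / (real \<beta> - 1)" "\<theta> \<ge> 0"
  proof -
    have "\<theta> - 1 = (real \<beta> - 2 * real \<alpha> + 1) / (real \<beta> - 1)" using \<beta>1 by (simp add: \<theta>_def field_simps)
    moreover have "real (2 * \<alpha>) \<le> real \<beta>" using \<alpha>(2) by (rule of_nat_mono)
    ultimately show "\<theta> - 1 \<ge> 1 / (real \<beta> - 1)" using \<beta>1 by (simp add: divide_right_mono)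
    thus "\<theta> \<ge> 0" using \<beta>1 by (smt (verit) divide_nonneg_pos)
  qed
  have "(\<Sum>\<kappa>\<in>dual_net b n m C u - {zero_vec n u}. 1 / real b ^ (2 * (\<Sum>j\<in>u. mu \<alpha> n (\<kappa> j))))
      \<le> real b ^ (2 * t) * S * (real m + 1) ^ (card u - 1) / real b ^ (2 * \<alpha> * m)"
    if us: "u \<subseteq> {1..s}" and t: "t \<le> \<beta> * m" and net: "net_condition b \<beta> t m s n C" for s m n C
  proof -
    let ?T = "dual_net b n m C u - {zero_vec n u}"
    define \<tau> where "\<tau> = m - t"
    define M where "M r \<kappa> = (\<Sum>j\<in>u. mu r n (\<kappa> j))" for r and \<kappa> :: "nat \<Rightarrow> nat \<Rightarrow> nat"
    have finT: "finite ?T" using finite_dual_net[OF u(1)] by simp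
    have M\<beta>: "\<beta> * m - t < M \<beta> \<kappa>" if "\<kappa> \<in> ?T" for \<kappa>
      unfolding M_def using dual_net_weight[OF net us, of \<kappa>] that by simp
    \<comment> \<open>A nonzero dual vector has \<open>\<mu>\<^sub>\<beta>\<close> above \<beta> m -
      t, hence \<open>\<mu>\<^sub>1\<close> above m - t. The truncated difference makes \<tau> zero
      for t > m, and the argument still holds.\<close>
    have light: "\<kappa> = zero_vec n u" if "\<kappa> \<in> dual_net b n m C u" "(\<Sum>j\<in>u. mu 1 n (\<kappa> j)) \<le> \<tau>" for \<kappa>
    proof (rule ccontr)
      assume "\<kappa> \<noteq> zero_vec n u"
      hence "\<beta> * m - t < M \<beta> \<kappa>" using M\<beta> that(1) by simp
      also have "M \<beta> \<kappa> \<le> \<beta> * M 1 \<kappa>" unfolding M_def sum_distrib_left by (intro sum_mono mu_le)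
      also have "\<dots> \<le> \<beta> * \<tau>" using that(2) unfolding M_def by (rule mult_le_mono2)
      also have "\<dots> = \<beta> * m - \<beta> * t" by (simp add: \<tau>_def diff_mult_distrib2)
      also have "\<dots> \<le> \<beta> * m - t" using \<alpha> by (intro diff_le_mono2) simp
      finally show False by simp
    qed
    \<comment> \<open>The part of the term bound that comes from the lower bound \<beta> m - t for
      \<open>\<mu>\<^sub>\<beta>\<close>.\<close>
    define P where "P = real b powr (- (2 * (real \<alpha> - 1) * (real \<beta> * real m - real t) / (real \<beta> - 1)))"
    have term_le: "1 / real b ^ (2 * M \<alpha> \<kappa>) \<le> P * real b powr (- \<theta> * real (M 1 \<kappa>))" if k: "\<kappa> \<in> ?T" for \<kappa>
    proof -
      have "(\<Sum>j\<in>u. (\<alpha> - 1) * mu \<beta> n (\<kappa> j) + (\<beta> - \<alpha>) * mu 1 n (\<kappa> j)) \<le> (\<Sum>j\<in>u. (\<beta> - 1) * mu \<alpha> n (\<kappa> j))"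
        using \<alpha> by (intro sum_mono mu_interpolation) auto
      hence "(\<alpha> - 1) * M \<beta> \<kappa> + (\<beta> - \<alpha>) * M 1 \<kappa> \<le> (\<beta> - 1) * M \<alpha> \<kappa>"
        unfolding M_def sum.distrib sum_distrib_left .
      hence "real ((\<alpha> - 1) * M \<beta> \<kappa> + (\<beta> - \<alpha>) * M 1 \<kappa>) \<le> real ((\<beta> - 1) * M \<alpha> \<kappa>)" by (rule of_nat_mono)
      hence i1: "(real \<alpha> - 1) * real (M \<beta> \<kappa>) + (real \<beta> - real \<alpha>) * real (M 1 \<kappa>) \<le> (real \<beta> - 1) * real (M \<alpha> \<kappa>)"
        using \<alpha> by (simp add: of_nat_diff)
      have "real (\<beta> * m - t) \<le> real (M \<beta> \<kappa>)" using M\<beta>[OF k] by simp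
      hence "real \<beta> * real m - real t \<le> real (M \<beta> \<kappa>)" using t by (simp add: of_nat_diff)
      hence "(real \<alpha> - 1) * (real \<beta> * real m - real t) \<le> (real \<alpha> - 1) * real (M \<beta> \<kappa>)"
        using \<alpha> by (intro mult_left_mono) auto
      with i1 have l2: "2 * ((real \<alpha> - 1) * (real \<beta> * real m - real t) + (real \<beta> - real \<alpha>) * real (M 1 \<kappa>)) / (real \<beta> - 1)
          \<le> 2 * real (M \<alpha> \<kappa>)"
        using \<beta>1 by (simp add: pos_divide_le_eq mult.commute)
      have le: "- real (2 * M \<alpha> \<kappa>) \<le> - (2 * (real \<alpha> - 1) * (real \<beta> * real m - real t) / (real \<beta> - 1)) + - \<theta> * real (M 1 \<kappa>)"
      proof -
        have "2 * ((real \<alpha> - 1) * (real \<beta> * real m - real t) + (real \<beta> - real \<alpha>) * real (M 1 \<kappa>)) / (real \<beta> - 1) =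
            2 * (real \<alpha> - 1) * (real \<beta> * real m - real t) / (real \<beta> - 1) + \<theta> * real (M 1 \<kappa>)"
          unfolding \<theta>_def times_divide_eq_left add_divide_distrib[symmetric] by (simp only: distrib_left mult.assoc)
        with l2 show ?thesis by simp
      qed
      have "1 / real b ^ (2 * M \<alpha> \<kappa>) = real b powr (- real (2 * M \<alpha> \<kappa>))"
        using b1 by (simp only: powr_minus powr_realpow inverse_eq_divide)
      also have "\<dots> \<le> real b powr (- (2 * (real \<alpha> - 1) * (real \<beta> * real m - real t) / (real \<beta> - 1)) + - \<theta> * real (M 1 \<kappa>))"
        using le b1 by (intro powr_mono) auto
      finally show ?thesis unfolding P_def powr_add .
    qed
    \<comment> \<open>Only a finite range is needed for grouping; its size disappears when the
      partial sum is bounded by the series \<open>S\<close>.\<close>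
    define W where "W = (\<Sum>\<kappa>\<in>?T. M 1 \<kappa>)"
    have range: "M 1 \<kappa> \<in> {\<tau>..\<tau> + W}" if k: "\<kappa> \<in> ?T" for \<kappa>
    proof -
      have "M 1 \<kappa> \<le> W" unfolding W_def using finT k by (intro member_le_sum) auto
      moreover have "\<tau> < M 1 \<kappa>" using light[of \<kappa>] k unfolding M_def by fastforce
      ultimately show ?thesis by simp
    qed
    have count: "real (card {\<kappa> \<in> ?T. M 1 \<kappa> = \<tau> + w}) * real b powr (- \<theta> * real (\<tau> + w))
        \<le> real b powr (- \<theta> * real \<tau>) * (real m + 1) ^ c * ((real w + 1) ^ c * \<rho> ^ w)" for w
    proof -
      have "card {\<kappa> \<in> ?T. M 1 \<kappa> = \<tau> + w} \<le> card {\<kappa> \<in> dual_net b n m C u. (\<Sum>j\<in>u. mu 1 n (\<kappa> j)) = \<tau> + w}"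
        unfolding M_def using finite_dual_net[OF u(1)] by (intro card_mono) auto
      also have "\<dots> \<le> (\<tau> + w + 1) ^ c * b ^ (\<tau> + w - \<tau>)"
        unfolding c_def using b by (intro card_dual_weight_eq u light) auto
      finally have "real (card {\<kappa> \<in> ?T. M 1 \<kappa> = \<tau> + w}) \<le> real ((\<tau> + w + 1) ^ c * b ^ w)"
        by (subst of_nat_le_iff) simp
      also have "\<dots> \<le> ((real m + 1) * (real w + 1)) ^ c * real b ^ w"
      proof -
        \<comment> \<open>This separates the power of m, destined for the logarithm, from the
          summation variable.\<close>
        have "real (\<tau> + w + 1) \<le> (real m + 1) * (real w + 1)"
        proof -
          have "real \<tau> \<le> real m" "0 \<le> real m * real w" by (simp_all add: \<tau>_def)
          hence "real \<tau> + real w + 1 \<le> real m + real m * real w + real w + 1" by linarith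
          thus ?thesis by (simp add: algebra_simps)
        qed
        hence "real (\<tau> + w + 1) ^ c \<le> ((real m + 1) * (real w + 1)) ^ c" by (intro power_mono) auto
        thus ?thesis unfolding of_nat_mult of_nat_power by (intro mult_right_mono) auto
      qed
      finally have 1: "real (card {\<kappa> \<in> ?T. M 1 \<kappa> = \<tau> + w}) \<le> (real m + 1) ^ c * (real w + 1) ^ c * real b ^ w"
        by (simp add: power_mult_distrib)
      have "real b ^ w * real b powr (- \<theta> * real (\<tau> + w)) = real b powr (- \<theta> * real \<tau>) * (real b powr (1 - \<theta>)) powr real w"
      proof -
        have "real b ^ w = real b powr real w" using b1 by (simp add: powr_realpow)
        thus ?thesis by (simp add: powr_powr powr_add[symmetric] algebra_simps)
      qed
      also have "(real b powr (1 - \<theta>)) powr real w \<le> \<rho> powr real w"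
      proof (intro powr_mono2)
        show "real b powr (1 - \<theta>) \<le> \<rho>" unfolding \<rho>_def using \<theta>(1) b1 by (intro powr_mono) auto
      qed auto
      also have "\<rho> powr real w = \<rho> ^ w" using \<rho> by (simp add: powr_realpow)
      finally have 2: "real b ^ w * real b powr (- \<theta> * real (\<tau> + w)) \<le> real b powr (- \<theta> * real \<tau>) * \<rho> ^ w"
        by (simp add: mult_left_mono)
      have "real (card {\<kappa> \<in> ?T. M 1 \<kappa> = \<tau> + w}) * real b powr (- \<theta> * real (\<tau> + w))
         \<le> (real m + 1) ^ c * (real w + 1) ^ c * real b ^ w * real b powr (- \<theta> * real (\<tau> + w))"
        using 1 by (intro mult_right_mono) auto
      also have "\<dots> = (real m + 1) ^ c * (real w + 1) ^ c * (real b ^ w * real b powr (- \<theta> * real (\<tau> + w)))"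
        by (simp only: mult.assoc)
      also have "\<dots> \<le> (real m + 1) ^ c * (real w + 1) ^ c * (real b powr (- \<theta> * real \<tau>) * \<rho> ^ w)"
        using 2 by (intro mult_left_mono) auto
      finally show ?thesis by (simp only: mult_ac)
    qed
    have "(\<Sum>\<kappa>\<in>?T. real b powr (- \<theta> * real (M 1 \<kappa>))) =
        (\<Sum>z\<in>{\<tau>..\<tau> + W}. \<Sum>\<kappa>\<in>{\<kappa> \<in> ?T. M 1 \<kappa> = z}. real b powr (- \<theta> * real (M 1 \<kappa>)))"
      by (rule sum.group[symmetric, OF finT finite_atLeastAtMost]) (use range in blast)
    also have "\<dots> = (\<Sum>z\<in>{\<tau>..\<tau> + W}. real (card {\<kappa> \<in> ?T. M 1 \<kappa> = z}) * real b powr (- \<theta> * real z))"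
      by (intro sum.cong refl) simp
    also have "\<dots> = (\<Sum>w\<in>{0..W}. real (card {\<kappa> \<in> ?T. M 1 \<kappa> = \<tau> + w}) * real b powr (- \<theta> * real (\<tau> + w)))"
      using sum.shift_bounds_cl_nat_ivl[of "\<lambda>z. real (card {\<kappa> \<in> ?T. M 1 \<kappa> = z}) * real b powr (- \<theta> * real z)" 0 \<tau> W]
      by (simp add: add.commute)
    also have "\<dots> \<le> (\<Sum>w\<in>{0..W}. real b powr (- \<theta> * real \<tau>) * (real m + 1) ^ c * ((real w + 1) ^ c * \<rho> ^ w))"
      by (intro sum_mono count)
    also have "\<dots> \<le> real b powr (- \<theta> * real \<tau>) * (real m + 1) ^ c * S"
      unfolding sum_distrib_left[symmetric] by (intro mult_left_mono S_le) auto
    finally have sumT: "(\<Sum>\<kappa>\<in>?T. real b powr (- \<theta> * real (M 1 \<kappa>))) \<le> real b powr (- \<theta> * real \<tau>) * (real m + 1) ^ c * S" .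
    have "(\<Sum>\<kappa>\<in>?T. 1 / real b ^ (2 * M \<alpha> \<kappa>)) \<le> (\<Sum>\<kappa>\<in>?T. P * real b powr (- \<theta> * real (M 1 \<kappa>)))"
      by (intro sum_mono term_le)
    also have "\<dots> = P * (\<Sum>\<kappa>\<in>?T. real b powr (- \<theta> * real (M 1 \<kappa>)))" by (simp only: sum_distrib_left)
    also have "\<dots> \<le> P * (real b powr (- \<theta> * real \<tau>) * (real m + 1) ^ c * S)"
      using sumT by (intro mult_left_mono) (auto simp: P_def)
    also have "\<dots> = (P * real b powr (- \<theta> * real \<tau>)) * ((real m + 1) ^ c * S)" by (simp only: mult.assoc)
    also have "\<dots> \<le> (real b ^ (2 * t) / real b ^ (2 * \<alpha> * m)) * ((real m + 1) ^ c * S)"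
    proof (intro mult_right_mono)
      have "real m - real t \<le> real \<tau>" by (simp add: \<tau>_def)
      hence "- \<theta> * real \<tau> \<le> - \<theta> * (real m - real t)" using \<theta>(2) by (simp add: mult_left_mono)
      \<comment> \<open>The exponents add up exactly, by (\<alpha> - 1) (\<beta> m - t) + (\<beta> -
        \<alpha>) (m - t) = (\<beta> - 1) (\<alpha> m - t).\<close>
      moreover have "- (2 * (real \<alpha> - 1) * (real \<beta> * real m - real t) / (real \<beta> - 1)) + - \<theta> * (real m - real t) =
          real (2 * t) - real (2 * \<alpha> * m)"
        unfolding \<theta>_def using \<beta>1 by (simp add: divide_simps) (simp add: algebra_simps)
      ultimately have "- (2 * (real \<alpha> - 1) * (real \<beta> * real m - real t) / (real \<beta> - 1)) + - \<theta> * real \<tau> \<le> real (2 * t) - real (2 * \<alpha> * m)"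
        by linarith
      hence "P * real b powr (- \<theta> * real \<tau>) \<le> real b powr (real (2 * t) - real (2 * \<alpha> * m))"
        unfolding P_def powr_add[symmetric] using b1 by (intro powr_mono) auto
      also have "\<dots> = real b ^ (2 * t) / real b ^ (2 * \<alpha> * m)"
        using b1 by (simp only: powr_diff powr_realpow)
      finally show "P * real b powr (- \<theta> * real \<tau>) \<le> real b ^ (2 * t) / real b ^ (2 * \<alpha> * m)" .
    qed (use S0 in auto)
    finally show ?thesis unfolding M_def c_def by (simp add: mult_ac)
  qed
  moreover have "0 \<le> real b ^ (2 * t) * S" using S0 by simp
  ultimately show ?thesis by blast
qed

text \<open>The constant is chosen before s, m, n and the matrices, which gives the required
  independence of them. The bound is stated as a square because it controls an averaged squared
  error.\<close>

lemma net_average_bound: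
  assumes b: "2 \<le> b" and \<alpha>: "2 \<le> \<alpha>" "2 * \<alpha> \<le> \<beta>" and u: "finite u" "u \<noteq> {}"
  shows "\<exists>K>0. \<forall>s m n C. u \<subseteq> {1..s} \<and> 1 \<le> m \<and> \<beta> * m \<le> n \<and> t \<le> \<beta> * m \<and> net_condition b \<beta> t m s n C \<longrightarrow>
    (\<Sum>\<kappa>\<in>dual_net b n m C u. \<Prod>j\<in>u. norm (walsh_coeff b n (sob_ker \<alpha>) (\<kappa> j)))
      \<le> (K * ln (real (b ^ m)) powr ((real (card u) - 1) / 2) / real (b ^ m) ^ \<alpha>)\<^sup>2"
proof -
  define c where "c = card u - 1"
  have cu: "card u = Suc c" using u by (simp add: c_def card_gt_0_iff)
  obtain D where D: "D \<ge> 0" "\<And>n k. k \<in> digit_vecs b n \<Longrightarrow> norm (walsh_coeff b n (sob_ker \<alpha>) k) \<le> D / real b ^ (2 * mu \<alpha> n k)"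
    using walsh_coeff_sob_ker_bound[OF b \<alpha>(1)] by blast
  obtain E where E: "E \<ge> 0" "\<And>n k. (\<forall>i\<in>{1..n}. k i = 0) \<Longrightarrow> norm (walsh_coeff b n (sob_ker \<alpha>) k) \<le> E / real b ^ n"
    using walsh_coeff_sob_ker_0[OF b \<alpha>(1)] by blast
  obtain K where K: "K \<ge> 0" "\<And>s m n C. u \<subseteq> {1..s} \<Longrightarrow> t \<le> \<beta> * m \<Longrightarrow> net_condition b \<beta> t m s n C \<Longrightarrow>
    (\<Sum>\<kappa>\<in>dual_net b n m C u - {zero_vec n u}. 1 / real b ^ (2 * (\<Sum>j\<in>u. mu \<alpha> n (\<kappa> j))))
      \<le> K * (real m + 1) ^ (card u - 1) / real b ^ (2 * \<alpha> * m)"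
    using dual_sum_bound[OF b \<alpha> u, of t] by blast
  \<comment> \<open>The summand 1 guarantees a positive constant.\<close>
  define A where "A = D ^ card u * K + E ^ card u + 1"
  \<comment> \<open>The factor comes from m + 1 \<le> 2 m = (2 / ln b) ln (b^m).\<close>
  define R where "R = A * (2 / ln (real b)) ^ c"
  have A: "A > 0" using D(1) E(1) K(1) by (simp add: A_def add_nonneg_pos)
  have lnb: "ln (real b) > 0" using b by simp
  have R: "R > 0" using A lnb by (simp add: R_def)
  have "(\<Sum>\<kappa>\<in>dual_net b n m C u. \<Prod>j\<in>u. norm (walsh_coeff b n (sob_ker \<alpha>) (\<kappa> j)))
      \<le> (sqrt R * ln (real (b ^ m)) powr ((real (card u) - 1) / 2) / real (b ^ m) ^ \<alpha>)\<^sup>2"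
    if us: "u \<subseteq> {1..s}" and m: "1 \<le> m" and n: "\<beta> * m \<le> n" and t: "t \<le> \<beta> * m" and net: "net_condition b \<beta> t m s n C"
    for s m n C
  proof -
    let ?T = "dual_net b n m C u"
    let ?f = "\<lambda>\<kappa>. \<Prod>j\<in>u. norm (walsh_coeff b n (sob_ker \<alpha>) (\<kappa> j))"
    define B where "B = real b ^ (2 * \<alpha> * m)"
    have B: "B > 0" using b by (simp add: B_def)
    have fin: "finite ?T" by (rule finite_dual_net[OF u(1)])
    have f_le: "?f \<kappa> \<le> D ^ card u * (1 / real b ^ (2 * (\<Sum>j\<in>u. mu \<alpha> n (\<kappa> j))))" if k: "\<kappa> \<in> ?T - {zero_vec n u}" for \<kappa>
    proof -
      have "?f \<kappa> \<le> (\<Prod>j\<in>u. D / real b ^ (2 * mu \<alpha> n (\<kappa> j)))"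
        using k by (intro prod_mono conjI D(2)) (auto simp: dual_net_def)
      also have "\<dots> = D ^ card u * (1 / real b ^ (2 * (\<Sum>j\<in>u. mu \<alpha> n (\<kappa> j))))"
        by (simp add: prod_dividef power_sum sum_distrib_left)
      finally show ?thesis .
    qed
    have "sum ?f (?T - {zero_vec n u}) \<le> (\<Sum>\<kappa>\<in>?T - {zero_vec n u}. D ^ card u * (1 / real b ^ (2 * (\<Sum>j\<in>u. mu \<alpha> n (\<kappa> j)))))"
      by (intro sum_mono f_le)
    also have "\<dots> \<le> D ^ card u * (K * (real m + 1) ^ c / B)"
      unfolding sum_distrib_left[symmetric] B_def c_def using D(1) by (intro mult_left_mono K(2)[OF us t net]) auto
    finally have 1: "sum ?f (?T - {zero_vec n u}) \<le> D ^ card u * K * (real m + 1) ^ c / B" by simp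
    have 2: "?f (zero_vec n u) \<le> E ^ card u * (real m + 1) ^ c / B"
    proof -
      have "?f (zero_vec n u) \<le> (\<Prod>j\<in>u. E / real b ^ n)"
        by (intro prod_mono conjI E(2)) (auto simp: zero_vec_def)
      also have "\<dots> = E ^ card u * (1 / real b ^ n) ^ card u" by (simp add: power_divide)
      \<comment> \<open>One factor b^(-n) is enough, because n \<ge> \<beta> m \<ge> 2 \<alpha>
        m.\<close>
      also have "\<dots> \<le> E ^ card u * (1 / real b ^ n) ^ 1"
        using E(1) b cu by (intro mult_left_mono power_decreasing) auto
      also have "\<dots> \<le> E ^ card u * (1 / B)"
      proof -
        have "2 * \<alpha> * m \<le> n" using n \<alpha>(2) by (meson le_trans mult_le_mono1)
        hence "B \<le> real b ^ n" unfolding B_def using b by (intro power_increasing) auto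
        hence "1 / real b ^ n \<le> 1 / B" using B b by (intro divide_left_mono mult_pos_pos) auto
        thus ?thesis using E(1) by (intro mult_left_mono) auto
      qed
      also have "\<dots> = E ^ card u * 1 / B" by simp
      also have "\<dots> \<le> E ^ card u * (real m + 1) ^ c / B"
        using B E(1) by (intro divide_right_mono mult_left_mono one_le_power) auto
      finally show ?thesis .
    qed
    have "sum ?f ?T \<le> sum ?f (insert (zero_vec n u) (?T - {zero_vec n u}))"
      using fin by (intro sum_mono2) (auto intro: prod_nonneg)
    also have "\<dots> = ?f (zero_vec n u) + sum ?f (?T - {zero_vec n u})" using fin by (subst sum.insert) auto
    also have "\<dots> \<le> E ^ card u * (real m + 1) ^ c / B + D ^ card u * K * (real m + 1) ^ c / B"
      by (rule add_mono[OF 2 1])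
    also have "\<dots> = (E ^ card u + D ^ card u * K) * (real m + 1) ^ c / B" by (simp add: add_divide_distrib distrib_right)
    also have "\<dots> \<le> A * (real m + 1) ^ c / B"
      using B by (intro divide_right_mono mult_right_mono) (auto simp: A_def)
    also have "\<dots> \<le> A * (2 / ln (real b) * ln (real (b ^ m))) ^ c / B"
    proof -
      have "real m + 1 \<le> 2 / ln (real b) * ln (real (b ^ m))" using m b lnb by (simp add: ln_realpow)
      thus ?thesis using A B by (intro divide_right_mono mult_left_mono power_mono) auto
    qed
    also have "\<dots> = R * ln (real (b ^ m)) ^ c / B" by (simp only: R_def power_mult_distrib mult.assoc)
    also have "\<dots> = (sqrt R * ln (real (b ^ m)) powr ((real (card u) - 1) / 2) / real (b ^ m) ^ \<alpha>)\<^sup>2"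
    proof -
      have "real (b ^ m) > 1" using b m by simp
      hence X: "ln (real (b ^ m)) > 0" by (rule ln_gt_zero)
      have "(ln (real (b ^ m)) powr ((real (card u) - 1) / 2))\<^sup>2 = ln (real (b ^ m)) powr real c"
        using cu by (simp add: power2_eq_square powr_add[symmetric])
      also have "\<dots> = ln (real (b ^ m)) ^ c" using X by (simp add: powr_realpow)
      finally have "(ln (real (b ^ m)) powr ((real (card u) - 1) / 2))\<^sup>2 = ln (real (b ^ m)) ^ c" .
      moreover have "(real (b ^ m) ^ \<alpha>)\<^sup>2 = B" by (simp add: B_def power_mult[symmetric] mult_ac)
      moreover have "(sqrt R)\<^sup>2 = R" using R by simp
      ultimately show ?thesis unfolding power_divide power_mult_distrib by simp
    qed
    finally show ?thesis .
  qed
  moreover have "sqrt R > 0" using R by simp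
  ultimately show ?thesis by blast
qed

section \<open>Choice of the shift and the final estimate\<close>

lemma exists_le_average:
  fixes g :: "'a \<Rightarrow> real"
  assumes "finite A" "A \<noteq> {}" "sum g A / real (card A) \<le> c"
  shows "\<exists>a\<in>A. g a \<le> c"
proof (rule ccontr)
  assume "\<not> ?thesis"
  hence "(\<Sum>a\<in>A. c) < sum g A" using assms by (intro sum_strict_mono) auto
  moreover have "sum g A \<le> c * real (card A)" using assms by (simp add: pos_divide_le_eq card_gt_0_iff)
  ultimately show False by (simp add: mult.commute)
qed

lemma sum_squares_le_square_sum:
  fixes q :: "'a \<Rightarrow> real"
  assumes "\<And>a. a \<in> A \<Longrightarrow> 0 \<le> q a"
  shows "(\<Sum>a\<in>A. (q a)\<^sup>2) \<le> (\<Sum>a\<in>A. q a)\<^sup>2"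
  using assms
proof (induction A rule: infinite_finite_induct)
  case (insert a A)
  have "0 \<le> 2 * q a * sum q A" using insert.prems by (intro mult_nonneg_nonneg sum_nonneg) auto
  thus ?case using insert by (simp add: power2_sum)
qed auto

theorem corollary1:
  fixes b :: nat
  assumes "prime b"
  shows "\<exists>C :: nat \<Rightarrow> nat \<Rightarrow> nat \<Rightarrow> nat set \<Rightarrow> real.
    (\<forall>\<alpha> \<beta> t u. 0 < C \<alpha> \<beta> t u) \<and>
    (\<forall>(s :: nat) (\<alpha> :: nat) (\<beta> :: nat) (m :: nat) (t :: nat)
       (P :: (nat \<Rightarrow> real) multiset) (\<gamma> :: nat set \<Rightarrow> real)
       (H :: ((nat \<Rightarrow> real) \<Rightarrow> real) set)
       (ip :: ((nat \<Rightarrow> real) \<Rightarrow> real) \<Rightarrow> ((nat \<Rightarrow> real) \<Rightarrow> real) \<Rightarrow> real).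
       1 \<le> s \<and> 1 \<le> m \<and> 2 \<le> \<alpha> \<and> 2 * \<alpha> \<le> \<beta> \<and> t \<le> \<beta> * m \<and>
       order_digital_net b \<beta> t m s P \<and>
       (\<forall>u. u \<subseteq> {1..s} \<longrightarrow> 0 \<le> \<gamma> u) \<and>
       rkhs (cube s) (sobolev_kernel s \<alpha> \<gamma>) H ip \<longrightarrow>
       (\<exists>\<sigma>\<in>cube s.
          worst_case_error s H ip (digital_shift b s P \<sigma>) \<le>
          ereal (1 / real (b ^ m) ^ \<alpha> *
            (\<Sum>u\<in>Pow {1..s} - {{}}.
               sqrt (\<gamma> u) * C \<alpha> \<beta> t u * ln (real (b ^ m)) powr ((real (card u) - 1) / 2)))))"
proof -
  have b: "2 \<le> b" using assms by (rule prime_ge_2_nat)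
  hence b0: "0 < b" by simp
  \<comment> \<open>Outside the admissible parameters only positivity is demanded, so a constant
    exists for all arguments and can be chosen as a function of them.\<close>
  define good where "good \<alpha> \<beta> t u K \<longleftrightarrow> K > 0 \<and> (2 \<le> \<alpha> \<and> 2 * \<alpha> \<le> \<beta> \<and> finite u \<and> u \<noteq> {} \<longrightarrow>
    (\<forall>s m n C. u \<subseteq> {1..s} \<and> 1 \<le> m \<and> \<beta> * m \<le> n \<and> t \<le> \<beta> * m \<and> net_condition b \<beta> t m s n C \<longrightarrow>
    (\<Sum>\<kappa>\<in>dual_net b n m C u. \<Prod>j\<in>u. norm (walsh_coeff b n (sob_ker \<alpha>) (\<kappa> j)))
      \<le> (K * ln (real (b ^ m)) powr ((real (card u) - 1) / 2) / real (b ^ m) ^ \<alpha>)\<^sup>2))" for \<alpha> \<beta> t u K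
  have "\<exists>K. good \<alpha> \<beta> t u K" for \<alpha> \<beta> t u
  proof (cases "2 \<le> \<alpha> \<and> 2 * \<alpha> \<le> \<beta> \<and> finite u \<and> u \<noteq> {}")
    case True
    thus ?thesis using net_average_bound[OF b, of \<alpha> \<beta> u t] unfolding good_def by blast
  qed (auto simp: good_def intro: exI[of _ 1])
  then obtain C where C: "\<And>\<alpha> \<beta> t u. good \<alpha> \<beta> t u (C \<alpha> \<beta> t u)" by metis
  have Cpos: "0 < C \<alpha> \<beta> t u" for \<alpha> \<beta> t u using C[of \<alpha> \<beta> t u] by (simp add: good_def)
  show ?thesis
  proof (intro exI[of _ C] conjI allI impI Cpos, elim conjE)
    fix s \<alpha> \<beta> m t :: nat and P :: "(nat \<Rightarrow> real) multiset" and \<gamma> :: "nat set \<Rightarrow> real"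
      and V :: "((nat \<Rightarrow> real) \<Rightarrow> real) set" and ip
    assume m: "1 \<le> m" and \<alpha>: "2 \<le> \<alpha>" "2 * \<alpha> \<le> \<beta>" and t: "t \<le> \<beta> * m"
      and net: "order_digital_net b \<beta> t m s P" and \<gamma>: "\<forall>u. u \<subseteq> {1..s} \<longrightarrow> 0 \<le> \<gamma> u"
      and H: "rkhs (cube s) (sobolev_kernel s \<alpha> \<gamma>) V ip"
    from net obtain n G where n: "\<beta> * m \<le> n" and P: "P = digital_net b n m s G" and nc: "net_condition b \<beta> t m s n G"
      unfolding order_digital_net_def net_condition_def by blast
    define N where "N = real (b ^ m)"
    define q where "q u = sqrt (\<gamma> u) * C \<alpha> \<beta> t u * ln N powr ((real (card u) - 1) / 2) / N ^ \<alpha>" for u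
    \<comment> \<open>The h-th point of the net after the shift whose digits in coordinate j are
      \<open>e j\<close>.\<close>
    define pt where "pt e h = (\<lambda>j\<in>{1..s}. dval b n (dadd b n (net_vec b n m G h j) (e j)))" for e h
    define E where "E = ({1..s} \<rightarrow>\<^sub>E digit_vecs b n)"
    define A where "A e u = (\<Sum>h\<in>{0..<b ^ m}. \<Sum>h'\<in>{0..<b ^ m}. \<Prod>j\<in>u. sob_ker \<alpha> (pt e h j) (pt e h' j)) / N\<^sup>2" for e u
    have N: "N > 0" using b by (simp add: N_def)
    have finE: "finite E" "E \<noteq> {}"
      unfolding E_def using b0 dadd_in[OF b0] by (auto intro!: finite_PiE simp: PiE_eq_empty_iff)
    have ne: "digit_vecs b n \<noteq> {}" using dadd_in[OF b0] by blast
    have cardE: "real (card E) = (real b ^ n) ^ s" by (simp add: E_def card_PiE card_digit_vecs)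
    have pt: "pt e h \<in> cube s" for e h
      using dval_bounds[OF b0 dadd_in[OF b0]] by (auto simp: pt_def cube_def)
    have avg: "(\<Sum>e\<in>E. A e u) / real (card E) \<le> (C \<alpha> \<beta> t u * ln N powr ((real (card u) - 1) / 2) / N ^ \<alpha>)\<^sup>2"
      if u: "u \<in> Pow {1..s} - {{}}" for u
    proof -
      have us: "u \<subseteq> {1..s}" "u \<noteq> {}" "finite u" using u finite_subset by auto
      have I: "(\<Sum>e\<in>E. \<Prod>j\<in>u. sob_ker \<alpha> (pt e h j) (pt e h' j)) / real (card E) = (\<Prod>j\<in>u. (\<Sum>\<sigma>\<in>digit_vecs b n.
          sob_ker \<alpha> (dval b n (dadd b n (net_vec b n m G h j) \<sigma>)) (dval b n (dadd b n (net_vec b n m G h' j) \<sigma>))) / real b ^ n)" for h h'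
      proof -
        have 1: "(\<Sum>e\<in>E. \<Prod>j\<in>u. sob_ker \<alpha> (pt e h j) (pt e h' j)) =
          (\<Sum>e\<in>E. \<Prod>j\<in>u. sob_ker \<alpha> (dval b n (dadd b n (net_vec b n m G h j) (e j))) (dval b n (dadd b n (net_vec b n m G h' j) (e j))))"
          using us by (intro sum.cong prod.cong refl) (auto simp: pt_def)
        have 2: "(\<Sum>e\<in>E. \<Prod>j\<in>u. sob_ker \<alpha> (dval b n (dadd b n (net_vec b n m G h j) (e j))) (dval b n (dadd b n (net_vec b n m G h' j) (e j)))) / real (card E) = (\<Prod>j\<in>u. (\<Sum>\<sigma>\<in>digit_vecs b n.
          sob_ker \<alpha> (dval b n (dadd b n (net_vec b n m G h j) \<sigma>)) (dval b n (dadd b n (net_vec b n m G h' j) \<sigma>))) / real b ^ n)"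
          using PiE_average_prod[of "{1..s}" u "digit_vecs b n"
              "\<lambda>j \<sigma>. sob_ker \<alpha> (dval b n (dadd b n (net_vec b n m G h j) \<sigma>)) (dval b n (dadd b n (net_vec b n m G h' j) \<sigma>))"]
            us(1) ne unfolding cardE unfolding E_def by (simp add: card_digit_vecs)
        show ?thesis unfolding 1 by (rule 2)
      qed
      have "(\<Sum>e\<in>E. A e u) / real (card E) =
          (\<Sum>h\<in>{0..<b ^ m}. \<Sum>h'\<in>{0..<b ^ m}. (\<Sum>e\<in>E. \<Prod>j\<in>u. sob_ker \<alpha> (pt e h j) (pt e h' j)) / real (card E)) / N\<^sup>2"
      proof -
        have 1: "(\<Sum>e\<in>E. A e u) = (\<Sum>e\<in>E. \<Sum>h\<in>{0..<b ^ m}. \<Sum>h'\<in>{0..<b ^ m}. \<Prod>j\<in>u. sob_ker \<alpha> (pt e h j) (pt e h' j)) / N\<^sup>2"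
          unfolding A_def by (rule sum_divide_distrib[symmetric])
        have "(\<Sum>e\<in>E. \<Sum>h\<in>{0..<b ^ m}. \<Sum>h'\<in>{0..<b ^ m}. \<Prod>j\<in>u. sob_ker \<alpha> (pt e h j) (pt e h' j)) =
           (\<Sum>h\<in>{0..<b ^ m}. \<Sum>e\<in>E. \<Sum>h'\<in>{0..<b ^ m}. \<Prod>j\<in>u. sob_ker \<alpha> (pt e h j) (pt e h' j))"
          by (rule sum.swap)
        also have "\<dots> = (\<Sum>h\<in>{0..<b ^ m}. \<Sum>h'\<in>{0..<b ^ m}. \<Sum>e\<in>E. \<Prod>j\<in>u. sob_ker \<alpha> (pt e h j) (pt e h' j))"
          by (intro sum.cong refl sum.swap)
        finally show ?thesis unfolding 1 sum_divide_distrib[symmetric] by (simp only: divide_divide_eq_left mult.commute)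
      qed
      also have "\<dots> = (\<Sum>h\<in>{0..<b ^ m}. \<Sum>h'\<in>{0..<b ^ m}. \<Prod>j\<in>u. (\<Sum>\<sigma>\<in>digit_vecs b n.
          sob_ker \<alpha> (dval b n (dadd b n (net_vec b n m G h j) \<sigma>)) (dval b n (dadd b n (net_vec b n m G h' j) \<sigma>))) / real b ^ n) / N\<^sup>2"
        unfolding I ..
      also have "\<dots> \<le> (real b ^ (2 * m) * (\<Sum>\<kappa>\<in>dual_net b n m G u. \<Prod>j\<in>u. norm (walsh_coeff b n (sob_ker \<alpha>) (\<kappa> j)))) / N\<^sup>2"
        by (rule divide_right_mono[OF order.trans[OF abs_ge_self net_kernel_average_bound[OF b0 us(3)]]]) simp
      also have "\<dots> = (\<Sum>\<kappa>\<in>dual_net b n m G u. \<Prod>j\<in>u. norm (walsh_coeff b n (sob_ker \<alpha>) (\<kappa> j)))"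
        using b0 by (simp add: N_def power_mult[symmetric] mult.commute)
      also have "\<dots> \<le> (C \<alpha> \<beta> t u * ln N powr ((real (card u) - 1) / 2) / N ^ \<alpha>)\<^sup>2"
        using C[of \<alpha> \<beta> t u] \<alpha> us m n t nc unfolding good_def N_def by blast
      finally show ?thesis .
    qed
    let ?U = "Pow {1..s} - {{}}"
    \<comment> \<open>The weighted sum over all \<open>u\<close> is averaged at once, so that a
      single shift is good for every \<open>u\<close>.\<close>
    have "(\<Sum>e\<in>E. \<Sum>u\<in>?U. \<gamma> u * A e u) / real (card E) = (\<Sum>u\<in>?U. \<gamma> u * ((\<Sum>e\<in>E. A e u) / real (card E)))"
      by (subst sum.swap) (simp only: sum_distrib_left[symmetric] sum_divide_distrib[of _ "Pow {1..s} - {{}}"] times_divide_eq_right)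
    also have "\<dots> \<le> (\<Sum>u\<in>?U. \<gamma> u * (C \<alpha> \<beta> t u * ln N powr ((real (card u) - 1) / 2) / N ^ \<alpha>)\<^sup>2)"
      using \<gamma> by (intro sum_mono mult_left_mono avg) auto
    also have "\<dots> = (\<Sum>u\<in>?U. (q u)\<^sup>2)"
      using \<gamma> by (intro sum.cong refl) (simp add: q_def power_mult_distrib power_divide)
    finally obtain e where e: "e \<in> E" "(\<Sum>u\<in>?U. \<gamma> u * A e u) \<le> (\<Sum>u\<in>?U. (q u)\<^sup>2)"
      using exists_le_average[OF finE] by blast
    define \<sigma> where "\<sigma> = (\<lambda>j\<in>{1..s}. dval b n (e j))"
    have ej: "e j \<in> digit_vecs b n" if "j \<in> {1..s}" for j using e(1) that by (auto simp: E_def PiE_iff)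
    have \<sigma>: "\<sigma> \<in> cube s" using dval_bounds[OF b0 ej] by (auto simp: \<sigma>_def cube_def)
    \<comment> \<open>Net points and shift have at most n digits, so the digital shift acts as
      addition of digit vectors.\<close>
    have shift: "digital_shift b s P \<sigma> = image_mset (pt e) (mset_set {0..<b ^ m})"
      unfolding digital_shift_def P digital_net_def image_mset.compositionality
    proof (rule arg_cong[of _ _ "\<lambda>f. image_mset f _"], rule ext)
      fix h
      show "((\<lambda>x. \<lambda>j\<in>{1..s}. digit_add b (x j) (\<sigma> j)) \<circ> net_point b n m s G) h = pt e h"
        unfolding comp_def pt_def net_point_eq \<sigma>_def
        by (rule restrict_ext) (simp add: digit_add_dval[OF b net_vec_in[OF b0] ej])
    qed
    have q0: "0 \<le> q u" if "u \<in> ?U" for u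
      using Cpos[of \<alpha> \<beta> t u] N \<gamma> that unfolding q_def by (auto intro!: divide_nonneg_nonneg mult_nonneg_nonneg less_imp_le)
    have err: "\<bar>qmc f (digital_shift b s P \<sigma>) - cube_integral s f\<bar> \<le> (\<Sum>u\<in>?U. q u)"
      if f: "f \<in> V" "sqrt (ip f f) \<le> 1" for f
    proof -
      have ip: "0 \<le> ip f f" "ip f f \<le> 1"
        using H f by (auto simp: rkhs_def hilbert_function_space_def)
      have qmc: "qmc f (digital_shift b s P \<sigma>) = (\<Sum>h\<in>{0..<b ^ m}. f (pt e h)) / real (card {0..<b ^ m})"
        unfolding qmc_def shift by (simp add: image_mset.compositionality comp_def sum_unfold_sum_mset)
      have A0: "0 \<le> (\<Sum>u\<in>?U. (q u)\<^sup>2)" by (intro sum_nonneg) auto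
      have "(qmc f (digital_shift b s P \<sigma>) - cube_integral s f)\<^sup>2 \<le> ip f f * (\<Sum>u\<in>?U. \<gamma> u * A e u)"
        using quadrature_error_bound[OF \<alpha>(1) H f(1), of "{0..<b ^ m}" "pt e"] \<gamma> pt b0
        unfolding qmc A_def N_def by auto
      also have "\<dots> \<le> ip f f * (\<Sum>u\<in>?U. (q u)\<^sup>2)" using e(2) ip by (intro mult_left_mono)
      also have "\<dots> \<le> 1 * (\<Sum>u\<in>?U. (q u)\<^sup>2)" using ip A0 by (intro mult_right_mono)
      \<comment> \<open>Passing from the sum of squares to the square of the sum permits taking the
        root termwise.\<close>
      also have "\<dots> \<le> (\<Sum>u\<in>?U. q u)\<^sup>2" unfolding mult_1 by (intro sum_squares_le_square_sum q0)
      finally show ?thesis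
        using sum_nonneg[of ?U q, OF q0] by (simp add: abs_le_square_iff[symmetric])
    qed
    have "worst_case_error s V ip (digital_shift b s P \<sigma>) \<le> ereal (\<Sum>u\<in>?U. q u)"
      unfolding worst_case_error_def using err by (intro SUP_least) auto
    also have "(\<Sum>u\<in>?U. q u) = 1 / N ^ \<alpha> * (\<Sum>u\<in>?U. sqrt (\<gamma> u) * C \<alpha> \<beta> t u * ln N powr ((real (card u) - 1) / 2))"
      unfolding q_def sum_distrib_left by (intro sum.cong) auto
    finally show "\<exists>\<sigma>\<in>cube s. worst_case_error s V ip (digital_shift b s P \<sigma>) \<le>
          ereal (1 / real (b ^ m) ^ \<alpha> *
            (\<Sum>u\<in>Pow {1..s} - {{}}.
               sqrt (\<gamma> u) * C \<alpha> \<beta> t u * ln (real (b ^ m)) powr ((real (card u) - 1) / 2)))"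
      using \<sigma> unfolding N_def by blast
  qed
qed

end
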